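(* Let $\tau_n=(n_1,\dots,n_t)$ be a partition of $n$ with $t\ge 2$. Let $\mathcal{A}=\{A_i\}_{i=1}^m$, $A_i\in\mathbb{R}^{n\times n}$, be $\tau_n$-block diagonalizable with $\tau_n$-block diagonalizer $W\in\mathbb{W}_{\tau_n}$, $W^{T}A_iW=\mathrm{diag}(A_i^{(11)},\dots,A_i^{(tt)})$ for $1\le i\le m$, and assume $\dim\mathscr{N}(\mathcal{A}_j)=1$ for all $1\le j\le t$, where $\mathcal{A}_j=\{A_i^{(jj)}\}_{i=1}^m$. Let $\widetilde{\mathcal{A}}=\{\widetilde A_i\}_{i=1}^m=\{A_i+\Delta A_i\}_{i=1}^m$ with $\Delta A_i\in\mathbb{R}^{n\times n}$, let $\widetilde W\in\mathbb{W}_{\tau_n}$ (an approximate $\tau_n$-block diagonalizer of $\widetilde{\mathcal{A}}$), and let $\Gamma=\mathrm{diag}(\gamma_1I_{n_1},\dots,\gamma_tI_{n_t})$ with distinct real numbers $\gamma_1,\dots,\gamma_t$, all $|\gamma_j|\le 1$. Put $$\delta_{\mathcal{A}}=\Big(\sum_{i=1}^m\|\Delta A_i\|_F^2\Big)^{1/2},\quad \widetilde R_i=\widetilde W^{T}\widetilde A_i\widetilde W\Gamma-\Gamma\widetilde W^{T}\widetilde A_i\widetilde W,\quad \tilde r=\Big(\sum_{i=1}^m\|\widetilde R_i\|_F^2\Big)^{1/2},\quad g=\min_{j\ne k}|\gamma_j-\gamma_k|.$$ Let $Q=W^{-1}\widetilde W$, $\kappa_2(Q)=\|Q\|_2\|Q^{-1}\|_2$,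 let $\omega_{\mathrm{uq}}=\omega_{\mathrm{uq}}(\mathcal{A};W)$ and $\omega_{\mathrm{nd}}=\omega_{\mathrm{nd}}(\mathcal{A};W)$ be the moduli of uniqueness and of non-divisibility, and $$\tau=\frac{\sqrt2-1}{\sqrt{t-1}},\quad \alpha=\frac{2\tau}{(\sqrt2+\tau)^2},\quad \delta=\|Q^{-1}\|_2^2\,\tilde r+2\|Q^{-1}\|_2\|W\|_2\|\widetilde W\|_2\,\delta_{\mathcal{A}},\quad \epsilon_*=\frac{\tau\,\kappa_2(Q)\,\delta}{\alpha\, g\,\omega_{\mathrm{uq}}}.$$ If $$\delta<\min\left\{\frac{\alpha g\,\omega_{\mathrm{uq}}}{\kappa_2(Q)},\ \frac{(1-2\alpha)g\,\omega_{\mathrm{nd}}}{\sqrt2}\right\},$$ then for $p\in\{2,F\}$ $$\min_{\substack{D\in\mathbb{D}_{\tau_n},\ D^{T}D=I\\ \Pi\in\mathbb{P}_{\tau_n}}}\frac{\|W-\widetilde WD\Pi\|_p}{\|\widetilde W\|_p}\le \varepsilon_{\mathrm{ub}}:=\frac{1+\sqrt t\,\epsilon_*}{\sqrt{1-2\sqrt{t-1}\,\epsilon_*-(t-1)\epsilon_*^2}}-1,$$ and $$\varepsilon_{\mathrm{ub}}=\frac{\tau}{\alpha}\cdot\frac{(\sqrt t+\sqrt{t-1})\,\kappa_2(Q)\,\delta}{g\,\omega_{\mathrm{uq}}}+O(\delta^2)$$ (as $\delta\to0$ with $t,g,\kappa_2(Q),\omega_{\mathrm{uq}}$ held fixed)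.
   Context: All matrices are real. $\|\cdot\|_2$ is the spectral norm and $\|\cdot\|_F$ the Frobenius norm. A partition $\tau_n=(n_1,\dots,n_t)$ of $n$ is a tuple of positive integers with $\sum n_j=n$; its cardinality is $t$. Partition $A\in\mathbb{R}^{n\times n}$ as $[A_{jk}]$ with $A_{jk}\in\mathbb{R}^{n_j\times n_k}$; $\mathrm{Bdiag}_{\tau_n}(A)=\mathrm{diag}(A_{11},\dots,A_{tt})$, and $A$ is $\tau_n$-block diagonal if $A=\mathrm{Bdiag}_{\tau_n}(A)$. $\mathbb{D}_{\tau_n}$ is the set of all $\tau_n$-block diagonal matrices. $\mathbb{P}_{\tau_n}$ is the set of permutation matrices $\Pi\in\mathbb{R}^{n\times n}$ such that $\Pi^{T}D\Pi\in\mathbb{D}_{\tau_n}$ for all $D\in\mathbb{D}_{\tau_n}$. $\mathbb{W}_{\tau_n}=\{W\in\mathbb{R}^{n\times n}: W \text{ nonsingular},\ \mathrm{Bdiag}_{\tau_n}(W^{T}W)=I_n\}$. $\mathcal{A}=\{A_i\}_{i=1}^m$ is $\tau_n$-block diagonalizable with $\tau_n$-block diagonalizer $W$ if $W$ is nonsingular and every $W^{T}A_iW$ is $\tau_n$-block diagonal, $W^{T}A_iW=\mathrm{diag}(A_i^{(11)},\dots,A_i^{(tt)})$ with $A_i^{(jj)}\in\mathbb{R}^{n_j\times n_j}$. $\mathscr{N}(\mathcal{A}_j)=\{Z\in\mathbb{R}^{n_j\times n_j}: A_i^{(jj)}Z-Z^{T}A_i^{(jj)}=0 \text{ for } 1\le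 i\le m\}$. For $j<k$, $G_{jk}$ is the $2mn_jn_k\times 2n_jn_k$ matrix obtained by stacking, for $i=1,\dots,m$, the two block rows $[\,I_{n_k}\otimes A_i^{(jj)},\ (A_i^{(kk)})^{T}\otimes I_{n_j}\,]$ and $[\,I_{n_k}\otimes (A_i^{(jj)})^{T},\ A_i^{(kk)}\otimes I_{n_j}\,]$. $G_{jj}$ is the $mn_j^2\times n_j^2$ matrix obtained by stacking, for $i=1,\dots,m$, the blocks $I_{n_j}\otimes A_i^{(jj)}-[(A_i^{(jj)})^{T}\otimes I_{n_j}]\Pi_j$, where $\Pi_j\in\mathbb{R}^{n_j^2\times n_j^2}$ is the perfect shuffle permutation with $\Pi_j\mathrm{vec}(X^{T})=\mathrm{vec}(X)$ for all $X\in\mathbb{R}^{n_j\times n_j}$; $\mathrm{vec}$ stacks columns. Convention: a matrix with $q$ columns has $q$ singular values, and $\sigma_{\min}$ is the smallest. Modulus of uniqueness: $\omega_{\mathrm{uq}}(\mathcal{A};W)=\min_{1\le j<k\le t}\sigma_{\min}(G_{jk})$. Modulus of non-divisibility (defined when no $\mathcal{A}_j$ is $\tau_{n_j}$-block diagonalizable for any partition $\tau_{n_j}$ of $n_j$ of cardinality $\ge2$; this holds when all $\dim\mathscr{N}(\mathcal{A}_j)=1$): $\omega_{\mathrm{nd}}(\mathcal{A};W)=\infty$ if $\tau_n=(1,\dots,1)$, and otherwise $\omega_{\mathrm{nd}}(\mathcal{A};W)=\min_{n_j>1}\{\text{smallest nonzero singular value of }G_{jj}\}$. The phrase "approximate $\tau_n$-block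 diagonalizer" imposes no condition on $\widetilde W\in\mathbb{W}_{\tau_n}$ beyond the stated bound on $\delta$; $\widetilde{\mathcal{A}}$ need not be $\tau_n$-block diagonalizable. *)

theory Defs
  imports
    "Jordan_Normal_Form.Char_Poly"
    "Jordan_Normal_Form.Gauss_Jordan_Elimination"
    "Jordan_Normal_Form.VS_Connect"
    "HOL-Library.Extended_Real"
    "HOL-Library.Landau_Symbols"
begin

text \<open>Rows, columns, blocks and the members of a matrix family are numbered from 0.
  A partition of \<open>n\<close> is a list \<open>ns\<close> of positive numbers; its cardinality is \<open>length ns\<close>.\<close>

definition euclid_norm :: "real vec \<Rightarrow> real" where
  "euclid_norm v = sqrt (v \<bullet> v)"

definition spectral_norm :: "real mat \<Rightarrow> real" where
  "spectral_norm A =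
     Sup {euclid_norm (A *\<^sub>v x) | x. x \<in> carrier_vec (dim_col A) \<and> euclid_norm x \<le> 1}"

definition frobenius_norm :: "real mat \<Rightarrow> real" where
  "frobenius_norm A = sqrt (\<Sum>i<dim_row A. \<Sum>j<dim_col A. (A $$ (i, j))\<^sup>2)"

definition mat_inv :: "real mat \<Rightarrow> real mat" where
  "mat_inv A = the (mat_inverse A)"

definition cond2 :: "real mat \<Rightarrow> real" where
  "cond2 A = spectral_norm A * spectral_norm (mat_inv A)"

text \<open>A matrix with \<open>q\<close> columns has \<open>q\<close> singular values, the square roots of the \<open>q\<close>
  eigenvalues of its Gram matrix. In particular a matrix with fewer rows than columns has the
  singular value 0. The set below forgets multiplicities.\<close>

definition singular_values :: "real mat \<Rightarrow> real set" where
  "singular_values M = {sqrt e | e. eigenvalue (M\<^sup>T * M) e}"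

definition sigma_min :: "real mat \<Rightarrow> real" where
  "sigma_min M = Min (singular_values M)"

definition sigma_min_nonzero :: "real mat \<Rightarrow> real" where
  "sigma_min_nonzero M = Min (singular_values M - {0})"

definition partition_of :: "nat \<Rightarrow> nat list \<Rightarrow> bool" where
  "partition_of n ns \<longleftrightarrow> (\<forall>k \<in> set ns. 0 < k) \<and> sum_list ns = n"

definition block :: "nat list \<Rightarrow> real mat \<Rightarrow> nat \<Rightarrow> nat \<Rightarrow> real mat" where
  "block ns A j k = mat (ns ! j) (ns ! k)
     (\<lambda>(a, b). A $$ (sum_list (take j ns) + a, sum_list (take k ns) + b))"

definition Bdiag :: "nat list \<Rightarrow> real mat \<Rightarrow> real mat" where
  "Bdiag ns A = diag_block_mat (map (\<lambda>j. block ns A j j) [0..<length ns])"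

definition block_diagonal :: "nat list \<Rightarrow> real mat set" where
  "block_diagonal ns = {A \<in> carrier_mat (sum_list ns) (sum_list ns). A = Bdiag ns A}"

definition permutation_mats :: "nat \<Rightarrow> real mat set" where
  "permutation_mats n =
     {mat n n (\<lambda>(i, j). if i = p j then 1 else 0) | p. p permutes {..<n}}"

definition block_permutations :: "nat list \<Rightarrow> real mat set" where
  "block_permutations ns = {P \<in> permutation_mats (sum_list ns).
     \<forall>D \<in> block_diagonal ns. P\<^sup>T * D * P \<in> block_diagonal ns}"

definition block_normalized :: "nat list \<Rightarrow> real mat set" where
  "block_normalized ns = {W \<in> carrier_mat (sum_list ns) (sum_list ns).
     invertible_mat W \<and> Bdiag ns (W\<^sup>T * W) = 1\<^sub>m (sum_list ns)}"

definition block_diagonalizer ::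
  "nat list \<Rightarrow> nat \<Rightarrow> (nat \<Rightarrow> real mat) \<Rightarrow> real mat \<Rightarrow> bool" where
  "block_diagonalizer ns m A W \<longleftrightarrow>
     W \<in> carrier_mat (sum_list ns) (sum_list ns) \<and> invertible_mat W \<and>
     (\<forall>i<m. W\<^sup>T * A i * W \<in> block_diagonal ns)"

definition diag_part :: "nat list \<Rightarrow> (nat \<Rightarrow> real mat) \<Rightarrow> real mat \<Rightarrow> nat \<Rightarrow> nat \<Rightarrow> real mat" where
  "diag_part ns A W j i = block ns (W\<^sup>T * A i * W) j j"

definition N_space :: "nat \<Rightarrow> nat \<Rightarrow> (nat \<Rightarrow> real mat) \<Rightarrow> real mat set" where
  "N_space q m B = {Z \<in> carrier_mat q q. \<forall>i<m. B i * Z - Z\<^sup>T * B i = 0\<^sub>m q q}"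

definition N_dim :: "nat \<Rightarrow> nat \<Rightarrow> (nat \<Rightarrow> real mat) \<Rightarrow> nat" where
  "N_dim q m B = vectorspace.dim class_ring
     ((module_mat TYPE(real) q q)\<lparr>carrier := N_space q m B\<rparr>)"

lemma vectorspace_N_space:
  assumes B: "\<And>i. i < m \<Longrightarrow> B i \<in> carrier_mat q q"
  shows "vectorspace class_ring ((module_mat TYPE(real) q q)\<lparr>carrier := N_space q m B\<rparr>)"
proof -
  interpret V: vectorspace class_ring "module_mat TYPE(real) q q" by (rule matrix_vs)
  have "submodule class_ring (N_space q m B) (module_mat TYPE(real) q q)"
  proof (unfold_locales, goal_cases)
    case 1
    show ?case by (auto simp: N_space_def module_mat_simps)
  next
    case (2 X Y)
    have "B i * (X + Y) - (X + Y)\<^sup>T * B i = 0\<^sub>m q q" if i: "i < m" for i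
    proof -
      note b = B[OF i]
      from 2 i have x: "X \<in> carrier_mat q q" "B i * X - X\<^sup>T * B i = 0\<^sub>m q q"
        and y: "Y \<in> carrier_mat q q" "B i * Y - Y\<^sup>T * B i = 0\<^sub>m q q"
        by (auto simp: N_space_def)
      have "B i * (X + Y) - (X + Y)\<^sup>T * B i = (B i * X + B i * Y) - (X\<^sup>T * B i + Y\<^sup>T * B i)"
        using b x(1) y(1) by (simp add: mult_add_distrib_mat[of _ q q _ q] transpose_add[of _ q q]
            add_mult_distrib_mat[of _ q q _ _ q])
      also have "\<dots> = (B i * X - X\<^sup>T * B i) + (B i * Y - Y\<^sup>T * B i)"
        using b x(1) y(1) by (intro eq_matI) auto
      finally show ?thesis using x y by simp
    qed
    with 2 show ?case by (auto simp: N_space_def module_mat_simps)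
  next
    case 3
    have "B i * 0\<^sub>m q q - (0\<^sub>m q q)\<^sup>T * B i = 0\<^sub>m q q" if "i < m" for i
      using B[OF that] by auto
    thus ?case by (auto simp: N_space_def module_mat_simps)
  next
    case (4 c X)
    have "B i * (c \<cdot>\<^sub>m X) - (c \<cdot>\<^sub>m X)\<^sup>T * B i = 0\<^sub>m q q" if i: "i < m" for i
    proof -
      note b = B[OF i]
      from 4 i have x: "X \<in> carrier_mat q q" "B i * X - X\<^sup>T * B i = 0\<^sub>m q q"
        by (auto simp: N_space_def)
      have tr: "(c \<cdot>\<^sub>m X)\<^sup>T = c \<cdot>\<^sub>m X\<^sup>T" by auto
      have "B i * (c \<cdot>\<^sub>m X) - (c \<cdot>\<^sub>m X)\<^sup>T * B i = c \<cdot>\<^sub>m (B i * X) - c \<cdot>\<^sub>m (X\<^sup>T * B i)"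
        unfolding tr using b x(1)
        by (simp add: mult_smult_distrib[of _ q q _ q] mult_smult_assoc_mat[of _ q q _ q])
      also have "\<dots> = c \<cdot>\<^sub>m (B i * X - X\<^sup>T * B i)"
        using b x(1) by (intro eq_matI) (auto simp: right_diff_distrib)
      finally show ?thesis using x by simp
    qed
    with 4 show ?case by (auto simp: N_space_def module_mat_simps)
  qed
  thus ?thesis
    using V.subspace_is_vs[of "N_space q m B"] V.vectorspace_axioms
    by (simp add: VectorSpace.subspace_def)
qed

definition kron :: "real mat \<Rightarrow> real mat \<Rightarrow> real mat" (infixl \<open>\<otimes>\<^sub>K\<close> 70) where
  "A \<otimes>\<^sub>K B = mat (dim_row A * dim_row B) (dim_col A * dim_col B)
     (\<lambda>(i, j). A $$ (i div dim_row B, j div dim_col B) * B $$ (i mod dim_row B, j mod dim_col B))"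

definition vec_cols :: "real mat \<Rightarrow> real vec" where
  "vec_cols X = vec (dim_row X * dim_col X) (\<lambda>r. X $$ (r mod dim_row X, r div dim_row X))"

definition perfect_shuffle :: "nat \<Rightarrow> real mat" where
  "perfect_shuffle q =
     mat (q * q) (q * q) (\<lambda>(r, c). if c = (r mod q) * q + r div q then 1 else 0)"

lemma perfect_shuffle_vec_cols:
  assumes X: "X \<in> carrier_mat q q"
  shows "perfect_shuffle q *\<^sub>v vec_cols (X\<^sup>T) = vec_cols X"
proof (rule eq_vecI)
  fix r assume "r < dim_vec (vec_cols X)"
  with X have r: "r < q * q" by (simp add: vec_cols_def)
  hence q: "q > 0" by (cases q) auto
  define a b where "a = r mod q" and "b = r div q"
  have a: "a < q" using q by (simp add: a_def)
  have b: "b < q" using r by (simp add: b_def less_mult_imp_div_less)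
  have ab: "a * q + b < q * q"
  proof -
    have "a * q + b < a * q + q" using b by simp
    also have "\<dots> = Suc a * q" by simp
    also have "\<dots> \<le> q * q" using a by (intro mult_right_mono) auto
    finally show ?thesis .
  qed
  have "(perfect_shuffle q *\<^sub>v vec_cols (X\<^sup>T)) $ r
      = (\<Sum>c = 0..<q * q. (if c = a * q + b then 1 else 0) * vec_cols (X\<^sup>T) $ c)"
    using r X by (simp add: perfect_shuffle_def scalar_prod_def vec_cols_def a_def b_def)
  also have "\<dots> = (\<Sum>c = 0..<q * q. if c = a * q + b then vec_cols (X\<^sup>T) $ c else 0)"
    by (rule sum.cong) auto
  also have "\<dots> = vec_cols (X\<^sup>T) $ (a * q + b)"
    using ab by simp
  also have "\<dots> = X $$ (a, b)"
    using X ab a b by (simp add: vec_cols_def)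
  also have "\<dots> = vec_cols X $ r"
    using X r by (simp add: vec_cols_def a_def b_def)
  finally show "(perfect_shuffle q *\<^sub>v vec_cols (X\<^sup>T)) $ r = vec_cols X $ r" .
qed (use X in \<open>simp add: perfect_shuffle_def vec_cols_def\<close>)

definition stack_rows :: "nat \<Rightarrow> real mat list \<Rightarrow> real mat" where
  "stack_rows q Ms = foldr append_rows Ms (0\<^sub>m 0 q)"

text \<open>In the next two definitions \<open>B\<close> and \<open>C\<close> stand for the families of \<open>j\<close>-th and \<open>k\<close>-th
  diagonal blocks, of orders \<open>p\<close> and \<open>q\<close>.\<close>

definition G_off :: "nat \<Rightarrow> nat \<Rightarrow> nat \<Rightarrow> (nat \<Rightarrow> real mat) \<Rightarrow> (nat \<Rightarrow> real mat) \<Rightarrow> real mat" where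
  "G_off m p q B C = stack_rows (2 * p * q) (map (\<lambda>i. four_block_mat
       (1\<^sub>m q \<otimes>\<^sub>K B i)       ((C i)\<^sup>T \<otimes>\<^sub>K 1\<^sub>m p)
       (1\<^sub>m q \<otimes>\<^sub>K (B i)\<^sup>T)   (C i \<otimes>\<^sub>K 1\<^sub>m p)) [0..<m])"

definition G_diag :: "nat \<Rightarrow> nat \<Rightarrow> (nat \<Rightarrow> real mat) \<Rightarrow> real mat" where
  "G_diag m q B = stack_rows (q * q) (map (\<lambda>i.
       1\<^sub>m q \<otimes>\<^sub>K B i - ((B i)\<^sup>T \<otimes>\<^sub>K 1\<^sub>m q) * perfect_shuffle q) [0..<m])"

definition omega_uq :: "nat list \<Rightarrow> nat \<Rightarrow> (nat \<Rightarrow> real mat) \<Rightarrow> real mat \<Rightarrow> real" where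
  "omega_uq ns m A W = Min {sigma_min
       (G_off m (ns ! j) (ns ! k) (diag_part ns A W j) (diag_part ns A W k))
     | j k. j < k \<and> k < length ns}"

text \<open>This is meaningful only if no diagonal family can be block diagonalized further.\<close>

definition omega_nd :: "nat list \<Rightarrow> nat \<Rightarrow> (nat \<Rightarrow> real mat) \<Rightarrow> real mat \<Rightarrow> ereal" where
  "omega_nd ns m A W =
     (if \<forall>j<length ns. ns ! j = 1 then \<infinity>
      else ereal (Min {sigma_min_nonzero (G_diag m (ns ! j) (diag_part ns A W j))
        | j. j < length ns \<and> 1 < ns ! j}))"

end

theory Submission
  imports
    Defs
    "HOL-Analysis.L2_Norm"
    "HOL-Analysis.Function_Topology"
    "Jordan_Normal_Form.Schur_Decomposition"
begin

text \<open>Put \<open>Q = W\<^sup>-\<^sup>1 W'\<close>, \<open>V = Q\<^sup>-\<^sup>1\<close>, \<open>Z = Q \<Gamma> V\<close> and \<open>D\<^sub>i = W\<^sup>T A\<^sub>i W\<close>. Since \<open>W' = W Q\<close>, congruence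
  with \<open>V\<close> turns the computable residual of the perturbed family into \<open>D\<^sub>i Z - Z\<^sup>T D\<^sub>i\<close>, up to terms of
  the size of the perturbation, and the total size of these expressions is at most \<open>\<delta>\<close>
  (\<open>residual_norm_le\<close>). Read block by block they are the linear systems behind the two moduli. So
  the off-diagonal blocks of \<open>Z\<close> have total size at most \<open>\<delta> / \<omega>\<^sub>u\<^sub>q\<close> (\<open>off_block_bound\<close>), and its
  diagonal blocks are within \<open>\<delta> / \<omega>\<^sub>n\<^sub>d\<close> of scalar matrices (\<open>scalar_block_bound\<close>).

  On the other hand \<open>V Z = \<Gamma> V\<close>, so \<open>Z\<close> is similar to \<open>\<Gamma>\<close>. By a Bauer--Fike argument each eigenvalue
  of a diagonal block of \<open>Z\<close> lies within \<open>\<alpha> g\<close> of some \<open>\<gamma>\<^sub>k\<close> (\<open>eigenvalue_near_label\<close>), and because the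
  block is nearly scalar its eigenvalues are too close to each other to choose different \<open>k\<close>. Hence the
  mean of block \<open>j\<close> is close to a single \<open>\<gamma>\<^sub>k\<close> with \<open>k = \<pi> j\<close> (\<open>mean_eigenvalue_near\<close>). Let \<open>X\<close> be the part
  of \<open>V\<close> at the positions matched by \<open>\<pi>\<close>, and \<open>Y\<close> the rest. The equation \<open>V Z = \<Gamma> V\<close> is a Sylvester
  equation for \<open>Y\<close> and makes it small (\<open>frobenius_norm_Y_le\<close>), so \<open>X\<close> is invertible. A nonzero term
  of its determinant is a permutation of positions that moves whole blocks (\<open>matched_permutation\<close>);
  this shows that \<open>\<pi>\<close> is a bijection between blocks of equal orders.

  This first bound depends on \<open>\<omega>\<^sub>n\<^sub>d\<close> through the separation, and it is not sharp. It is improved by a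
  bootstrap: if \<open>\<parallel>Y y\<parallel> \<le> p \<parallel>X y\<parallel>\<close> on a block, then also
  \<open>\<parallel>Y y\<parallel> \<le> \<eta> (1 + p\<^sup>2) \<parallel>X y\<parallel>\<close> with \<open>\<eta> = \<kappa>\<^sub>2(Q) \<delta> / (g \<omega>\<^sub>u\<^sub>q)\<close> (\<open>bootstrap_step\<close>). Starting from
  \<open>p = 1\<close>, this yields \<open>\<parallel>Y y\<parallel> \<le> \<epsilon> \<parallel>X y\<parallel>\<close> with the \<open>\<epsilon>\<close> of the theorem (\<open>norm_Y_le_X\<close>).

  Finally \<open>W = W' V\<close>, and both \<open>W\<close> and \<open>W'\<close> are isometric on each block. Hence \<open>X\<close> is nearly
  isometric, with singular values between \<open>1 / (1 + x)\<close> and \<open>1 / (1 - x)\<close> for \<open>x = \<surd>(t - 1) \<epsilon>\<close>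
  (\<open>norm_X_bounds\<close>), and its polar factor is \<open>U P\<close> with \<open>U\<close> orthogonal and block diagonal and \<open>P\<close> the
  permutation matrix found above (\<open>block_orthogonal_approximation\<close>). The bound follows from
  \<open>W - W' U P = W' (V - U P)\<close>. The minimum is attained because the block diagonal orthogonal matrices
  form a compact set (\<open>block_distance_minimum\<close>).\<close>

section \<open>Euclidean, spectral and Frobenius norms\<close>

lemma euclid_norm_L2_set: "euclid_norm v = L2_set (\<lambda>i. v $ i) {..<dim_vec v}"
  by (simp add: euclid_norm_def L2_set_def scalar_prod_def power2_eq_square lessThan_atLeast0)

lemma euclid_norm_nonneg [simp]: "0 \<le> euclid_norm v"
  by (simp add: euclid_norm_L2_set)

lemma euclid_norm_sq: "(euclid_norm v)\<^sup>2 = (\<Sum>i<dim_vec v. (v $ i)\<^sup>2)"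
  by (simp add: euclid_norm_L2_set L2_set_def sum_nonneg)

lemma euclid_norm_sq_scalar: "(euclid_norm v)\<^sup>2 = v \<bullet> v"
  unfolding euclid_norm_sq by (simp add: scalar_prod_def power2_eq_square lessThan_atLeast0)

lemma euclid_norm_triangle:
  assumes "v \<in> carrier_vec n" "w \<in> carrier_vec n"
  shows "euclid_norm (v + w) \<le> euclid_norm v + euclid_norm w"
  using assms L2_set_triangle_ineq[of "\<lambda>i. v $ i" "\<lambda>i. w $ i" "{..<n}"]
  by (auto simp: euclid_norm_L2_set cong: L2_set_cong_simp)

lemma euclid_norm_uminus: "euclid_norm (- v) = euclid_norm v"
  by (auto simp: euclid_norm_L2_set L2_set_def)

lemma euclid_norm_minus_triangle:
  assumes "v \<in> carrier_vec n" "w \<in> carrier_vec n"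
  shows "euclid_norm (v - w) \<le> euclid_norm v + euclid_norm w"
proof -
  have "v - w = v + (- w)" using assms by auto
  then show ?thesis using euclid_norm_triangle[of v n "- w"] assms by (simp add: euclid_norm_uminus)
qed

lemma euclid_norm_ge_diff:
  assumes "v \<in> carrier_vec n" "w \<in> carrier_vec n"
  shows "euclid_norm v - euclid_norm w \<le> euclid_norm (v + w)"
proof -
  have "v = (v + w) - w" using assms by auto
  then show ?thesis using euclid_norm_minus_triangle[of "v + w" n w] assms by auto
qed

lemma euclid_norm_smult: "euclid_norm (c \<cdot>\<^sub>v v) = \<bar>c\<bar> * euclid_norm v"
proof -
  have "euclid_norm (c \<cdot>\<^sub>v v) = sqrt (\<Sum>i<dim_vec v. c\<^sup>2 * (v $ i)\<^sup>2)"
    by (simp add: euclid_norm_L2_set L2_set_def power_mult_distrib)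
  also have "\<dots> = \<bar>c\<bar> * euclid_norm v"
    by (simp add: euclid_norm_L2_set L2_set_def real_sqrt_mult flip: sum_distrib_left)
  finally show ?thesis .
qed

lemma euclid_norm_eq_0_iff:
  assumes "v \<in> carrier_vec n"
  shows "euclid_norm v = 0 \<longleftrightarrow> v = 0\<^sub>v n"
  using assms by (auto simp: euclid_norm_L2_set L2_set_eq_0_iff)

lemma euclid_norm_zero [simp]: "euclid_norm (0\<^sub>v n) = 0"
  by (simp add: euclid_norm_eq_0_iff[of _ n])

lemma abs_scalar_prod_le:
  assumes "v \<in> carrier_vec n" "w \<in> carrier_vec n"
  shows "\<bar>v \<bullet> w\<bar> \<le> euclid_norm v * euclid_norm w"
proof -
  have "\<bar>v \<bullet> w\<bar> \<le> (\<Sum>i<n. \<bar>v $ i\<bar> * \<bar>w $ i\<bar>)"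
    using assms sum_abs[of "\<lambda>i. v $ i * w $ i" "{..<n}"]
    by (simp add: scalar_prod_def abs_mult lessThan_atLeast0)
  also have "\<dots> \<le> euclid_norm v * euclid_norm w"
    using assms L2_set_mult_ineq[of "\<lambda>i. v $ i" "\<lambda>i. w $ i" "{..<n}"] by (simp add: euclid_norm_L2_set)
  finally show ?thesis .
qed

lemma scalar_prod_mult_mat_vec:
  fixes A :: "real mat"
  assumes "A \<in> carrier_mat m n" "x \<in> carrier_vec n" "y \<in> carrier_vec m"
  shows "y \<bullet> (A *\<^sub>v x) = (A\<^sup>T *\<^sub>v y) \<bullet> x"
proof -
  have "y \<bullet> (A *\<^sub>v x) = (A *\<^sub>v x) \<bullet> y" using assms by (intro comm_scalar_prod[of _ m]) auto
  also have "\<dots> = (A\<^sup>T *\<^sub>v y) \<bullet> x"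
    using assms
    by (simp add: scalar_prod_def sum_distrib_right sum_distrib_left)
       (subst sum.swap, simp add: mult.commute mult.left_commute)
  finally show ?thesis .
qed

lemma frobenius_norm_nonneg [simp]: "0 \<le> frobenius_norm A"
  by (simp add: frobenius_norm_def sum_nonneg)

lemma frobenius_norm_sq:
  "(frobenius_norm A)\<^sup>2 = (\<Sum>i<dim_row A. \<Sum>j<dim_col A. (A $$ (i, j))\<^sup>2)"
  by (simp add: frobenius_norm_def sum_nonneg)

lemma frobenius_norm_sq_rows: "(frobenius_norm A)\<^sup>2 = (\<Sum>i<dim_row A. (euclid_norm (row A i))\<^sup>2)"
  by (simp add: frobenius_norm_sq euclid_norm_sq)

lemma frobenius_norm_sq_cols: "(frobenius_norm A)\<^sup>2 = (\<Sum>j<dim_col A. (euclid_norm (col A j))\<^sup>2)"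
  unfolding frobenius_norm_sq euclid_norm_sq by (subst sum.swap) simp

lemma frobenius_norm_transpose [simp]: "frobenius_norm (A\<^sup>T) = frobenius_norm A"
  unfolding frobenius_norm_def by (subst sum.swap) simp

lemma frobenius_norm_L2_set:
  "frobenius_norm A = L2_set (\<lambda>(i, j). A $$ (i, j)) ({..<dim_row A} \<times> {..<dim_col A})"
  by (simp add: frobenius_norm_def L2_set_def sum.cartesian_product case_prod_unfold)

lemma frobenius_norm_eq_0D:
  assumes "frobenius_norm A = 0" "i < dim_row A" "j < dim_col A"
  shows "A $$ (i, j) = 0"
proof -
  have "\<forall>p \<in> {..<dim_row A} \<times> {..<dim_col A}. (\<lambda>(i, j). A $$ (i, j)) p = 0"
    using assms(1) unfolding frobenius_norm_L2_set by (subst (asm) L2_set_eq_0_iff) auto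
  then show ?thesis using assms by auto
qed

lemma frobenius_norm_triangle:
  assumes "A \<in> carrier_mat m n" "B \<in> carrier_mat m n"
  shows "frobenius_norm (A + B) \<le> frobenius_norm A + frobenius_norm B"
proof -
  have "frobenius_norm (A + B) =
      L2_set (\<lambda>p. (\<lambda>(i, j). A $$ (i, j)) p + (\<lambda>(i, j). B $$ (i, j)) p) ({..<m} \<times> {..<n})"
    using assms by (auto simp: frobenius_norm_L2_set intro!: L2_set_cong)
  also have "\<dots> \<le> frobenius_norm A + frobenius_norm B"
    using assms by (auto simp: frobenius_norm_L2_set intro!: L2_set_triangle_ineq)
  finally show ?thesis .
qed

lemma frobenius_norm_uminus: "frobenius_norm (- A) = frobenius_norm A"
  by (simp add: frobenius_norm_def)

lemma frobenius_norm_minus_triangle: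
  assumes "A \<in> carrier_mat m n" "B \<in> carrier_mat m n"
  shows "frobenius_norm (A - B) \<le> frobenius_norm A + frobenius_norm B"
proof -
  have "A - B = A + (- B)" using assms by (intro eq_matI) auto
  then show ?thesis
    using frobenius_norm_triangle[of A m n "- B"] assms by (simp add: frobenius_norm_uminus)
qed

lemma euclid_norm_mult_mat_vec_le_frobenius:
  assumes "A \<in> carrier_mat m n" "x \<in> carrier_vec n"
  shows "euclid_norm (A *\<^sub>v x) \<le> frobenius_norm A * euclid_norm x"
proof (rule power2_le_imp_le)
  have "(euclid_norm (A *\<^sub>v x))\<^sup>2 = (\<Sum>i<m. (row A i \<bullet> x)\<^sup>2)"
    using assms by (simp add: euclid_norm_sq)
  also have "\<dots> \<le> (\<Sum>i<m. (euclid_norm (row A i) * euclid_norm x)\<^sup>2)"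
  proof (rule sum_mono)
    fix i assume "i \<in> {..<m}"
    then have "row A i \<in> carrier_vec n" using assms by auto
    from abs_scalar_prod_le[OF this assms(2)]
    show "(row A i \<bullet> x)\<^sup>2 \<le> (euclid_norm (row A i) * euclid_norm x)\<^sup>2"
      by (metis abs_ge_zero power2_abs power_mono)
  qed
  also have "\<dots> = (frobenius_norm A * euclid_norm x)\<^sup>2"
    using assms by (simp add: frobenius_norm_sq_rows power_mult_distrib flip: sum_distrib_right)
  finally show "(euclid_norm (A *\<^sub>v x))\<^sup>2 \<le> (frobenius_norm A * euclid_norm x)\<^sup>2" .
qed auto

lemma spectral_norm_bdd:
  "bdd_above {euclid_norm (A *\<^sub>v x) | x. x \<in> carrier_vec (dim_col A) \<and> euclid_norm x \<le> 1}"
proof (rule bdd_aboveI)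
  fix r assume "r \<in> {euclid_norm (A *\<^sub>v x) | x. x \<in> carrier_vec (dim_col A) \<and> euclid_norm x \<le> 1}"
  then obtain x where x: "r = euclid_norm (A *\<^sub>v x)" "x \<in> carrier_vec (dim_col A)" "euclid_norm x \<le> 1"
    by auto
  have "r \<le> frobenius_norm A * euclid_norm x"
    using euclid_norm_mult_mat_vec_le_frobenius[of A "dim_row A" "dim_col A" x] x by auto
  also have "\<dots> \<le> frobenius_norm A * 1" by (rule mult_left_mono) (use x in auto)
  finally show "r \<le> frobenius_norm A" by simp
qed

lemma spectral_norm_nonneg [simp]: "0 \<le> spectral_norm A"
proof -
  have "euclid_norm (A *\<^sub>v 0\<^sub>v (dim_col A)) \<le> spectral_norm A"
    unfolding spectral_norm_def by (rule cSup_upper[OF _ spectral_norm_bdd]) auto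
  then show ?thesis using euclid_norm_nonneg order_trans by blast
qed

lemma euclid_norm_mult_mat_vec_le:
  assumes "A \<in> carrier_mat m n" "x \<in> carrier_vec n"
  shows "euclid_norm (A *\<^sub>v x) \<le> spectral_norm A * euclid_norm x"
proof (cases "euclid_norm x = 0")
  case True
  then have "x = 0\<^sub>v n" using assms euclid_norm_eq_0_iff by blast
  then have "A *\<^sub>v x = 0\<^sub>v m" using assms by (intro eq_vecI) auto
  then show ?thesis using True by simp
next
  case False
  then have pos: "euclid_norm x > 0" by (simp add: less_le)
  let ?u = "(1 / euclid_norm x) \<cdot>\<^sub>v x"
  have "euclid_norm ?u = 1" using pos by (simp add: euclid_norm_smult)
  then have "euclid_norm (A *\<^sub>v ?u) \<le> spectral_norm A"
    unfolding spectral_norm_def using assms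
    by (intro cSup_upper[OF _ spectral_norm_bdd] CollectI exI[of _ ?u]) auto
  moreover have "euclid_norm (A *\<^sub>v ?u) = euclid_norm (A *\<^sub>v x) / euclid_norm x"
    using pos assms by (simp add: mult_mat_vec euclid_norm_smult)
  ultimately show ?thesis using pos by (simp add: field_simps)
qed

lemma spectral_norm_le:
  assumes "A \<in> carrier_mat m n" "0 \<le> c"
    and "\<And>x. x \<in> carrier_vec n \<Longrightarrow> euclid_norm (A *\<^sub>v x) \<le> c * euclid_norm x"
  shows "spectral_norm A \<le> c"
  unfolding spectral_norm_def
proof (rule cSup_least)
  show "{euclid_norm (A *\<^sub>v x) | x. x \<in> carrier_vec (dim_col A) \<and> euclid_norm x \<le> 1} \<noteq> {}"
    by (auto intro!: exI[of _ "0\<^sub>v (dim_col A)"])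
  fix r assume "r \<in> {euclid_norm (A *\<^sub>v x) | x. x \<in> carrier_vec (dim_col A) \<and> euclid_norm x \<le> 1}"
  then obtain x where x: "r = euclid_norm (A *\<^sub>v x)" "x \<in> carrier_vec n" "euclid_norm x \<le> 1"
    using assms(1) by auto
  have "r \<le> c * euclid_norm x" using assms(3) x by auto
  also have "\<dots> \<le> c * 1" by (rule mult_left_mono) (use x assms in auto)
  finally show "r \<le> c" by simp
qed

lemma spectral_norm_le_frobenius: "spectral_norm A \<le> frobenius_norm A"
  by (rule spectral_norm_le[of A "dim_row A" "dim_col A"])
     (auto intro: euclid_norm_mult_mat_vec_le_frobenius)

lemma spectral_norm_transpose_le:
  assumes A: "A \<in> carrier_mat m n"
  shows "spectral_norm (A\<^sup>T) \<le> spectral_norm A"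
proof (rule spectral_norm_le[of _ n m])
  fix x :: "real vec" assume x: "x \<in> carrier_vec m"
  let ?y = "A\<^sup>T *\<^sub>v x"
  have y: "?y \<in> carrier_vec n" using A x by auto
  have "(euclid_norm ?y)\<^sup>2 = x \<bullet> (A *\<^sub>v ?y)"
    unfolding euclid_norm_sq_scalar using scalar_prod_mult_mat_vec[OF A y x] by simp
  also have "\<dots> \<le> euclid_norm x * euclid_norm (A *\<^sub>v ?y)"
    using abs_scalar_prod_le[of x m "A *\<^sub>v ?y"] A x y by auto
  also have "\<dots> \<le> euclid_norm x * (spectral_norm A * euclid_norm ?y)"
    by (intro mult_left_mono euclid_norm_mult_mat_vec_le[OF A y]) auto
  finally have "euclid_norm ?y * euclid_norm ?y \<le> (spectral_norm A * euclid_norm x) * euclid_norm ?y"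
    by (simp add: power2_eq_square ac_simps)
  then show "euclid_norm ?y \<le> spectral_norm A * euclid_norm x"
    by (metis euclid_norm_nonneg mult_nonneg_nonneg mult_right_le_imp_le order_le_less spectral_norm_nonneg)
qed (use A in auto)

lemma spectral_norm_triangle:
  assumes "A \<in> carrier_mat m n" "B \<in> carrier_mat m n"
  shows "spectral_norm (A + B) \<le> spectral_norm A + spectral_norm B"
proof (rule spectral_norm_le[of _ m n])
  fix x :: "real vec" assume x: "x \<in> carrier_vec n"
  have "euclid_norm ((A + B) *\<^sub>v x) \<le> euclid_norm (A *\<^sub>v x) + euclid_norm (B *\<^sub>v x)"
    using assms x by (simp add: add_mult_distrib_mat_vec[of _ m n] euclid_norm_triangle[of _ m])
  also have "\<dots> \<le> (spectral_norm A + spectral_norm B) * euclid_norm x"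
    using euclid_norm_mult_mat_vec_le[OF assms(1) x] euclid_norm_mult_mat_vec_le[OF assms(2) x]
    by (simp add: distrib_right)
  finally show "euclid_norm ((A + B) *\<^sub>v x) \<le> (spectral_norm A + spectral_norm B) * euclid_norm x" .
qed (use assms in auto)

lemma spectral_norm_mult_le:
  assumes "A \<in> carrier_mat m n" "B \<in> carrier_mat n k"
  shows "spectral_norm (A * B) \<le> spectral_norm A * spectral_norm B"
proof (rule spectral_norm_le[of _ m k])
  fix x :: "real vec" assume x: "x \<in> carrier_vec k"
  have "euclid_norm ((A * B) *\<^sub>v x) = euclid_norm (A *\<^sub>v (B *\<^sub>v x))"
    using assms x by (simp add: assoc_mult_mat_vec[of _ m n _ k])
  also have "\<dots> \<le> spectral_norm A * euclid_norm (B *\<^sub>v x)"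
    using assms x by (intro euclid_norm_mult_mat_vec_le) auto
  also have "\<dots> \<le> spectral_norm A * (spectral_norm B * euclid_norm x)"
    using assms x by (intro mult_left_mono euclid_norm_mult_mat_vec_le) auto
  finally show "euclid_norm ((A * B) *\<^sub>v x) \<le> spectral_norm A * spectral_norm B * euclid_norm x"
    by (simp add: mult.assoc)
qed (use assms in auto)

lemma frobenius_norm_mult_le_left:
  assumes "A \<in> carrier_mat m n" "B \<in> carrier_mat n k"
  shows "frobenius_norm (A * B) \<le> spectral_norm A * frobenius_norm B"
proof (rule power2_le_imp_le)
  have "(frobenius_norm (A * B))\<^sup>2 = (\<Sum>j<k. (euclid_norm (col (A * B) j))\<^sup>2)"
    using assms by (simp add: frobenius_norm_sq_cols)
  also have "\<dots> = (\<Sum>j<k. (euclid_norm (A *\<^sub>v col B j))\<^sup>2)"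
    by (intro sum.cong refl) (simp only: col_mult2[OF assms] lessThan_iff)
  also have "\<dots> \<le> (\<Sum>j<k. (spectral_norm A * euclid_norm (col B j))\<^sup>2)"
    using assms by (intro sum_mono power_mono euclid_norm_mult_mat_vec_le) auto
  also have "\<dots> = (spectral_norm A * frobenius_norm B)\<^sup>2"
    using assms by (simp add: frobenius_norm_sq_cols power_mult_distrib flip: sum_distrib_left)
  finally show "(frobenius_norm (A * B))\<^sup>2 \<le> (spectral_norm A * frobenius_norm B)\<^sup>2" .
qed auto

lemma frobenius_norm_mult_le_right:
  assumes "A \<in> carrier_mat m n" "B \<in> carrier_mat n k"
  shows "frobenius_norm (A * B) \<le> frobenius_norm A * spectral_norm B"
proof -
  have "frobenius_norm (A * B) = frobenius_norm (B\<^sup>T * A\<^sup>T)"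
    using assms by (metis frobenius_norm_transpose transpose_mult)
  also have "\<dots> \<le> spectral_norm (B\<^sup>T) * frobenius_norm (A\<^sup>T)"
    using assms by (intro frobenius_norm_mult_le_left[of _ k n]) auto
  also have "\<dots> \<le> spectral_norm B * frobenius_norm A"
    using spectral_norm_transpose_le[OF assms(2)] by (simp add: mult_right_mono)
  finally show ?thesis by (simp add: mult.commute)
qed

lemma frobenius_norm_mult_le:
  assumes "A \<in> carrier_mat m n" "B \<in> carrier_mat n k"
  shows "frobenius_norm (A * B) \<le> frobenius_norm A * frobenius_norm B"
  using frobenius_norm_mult_le_left[OF assms] spectral_norm_le_frobenius[of A]
  by (meson frobenius_norm_nonneg mult_right_mono order_trans)

lemma mat_inv:
  assumes "A \<in> carrier_mat n n" "invertible_mat A"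
  shows "A * mat_inv A = 1\<^sub>m n" "mat_inv A * A = 1\<^sub>m n" "mat_inv A \<in> carrier_mat n n"
proof -
  obtain B where B: "A * B = 1\<^sub>m n" "B * A = 1\<^sub>m (dim_row B)"
    using assms by (auto simp: invertible_mat_def inverts_mat_def)
  have "dim_row B = n" using B assms
    by (metis carrier_matD(2) index_mult_mat(3) index_one_mat(3))
  moreover have "dim_col B = n" using B assms
    by (metis index_mult_mat(3) index_one_mat(3))
  ultimately have "B \<in> carrier_mat n n" by auto
  then have "A \<in> Units (ring_mat TYPE(real) n ())"
    using B assms unfolding Units_def by (auto simp: ring_mat_simps)
  then obtain C where "mat_inverse A = Some C" using mat_inverse(1)[OF assms(1)] by fastforce
  from mat_inverse(2)[OF assms(1) this] this
  show "A * mat_inv A = 1\<^sub>m n" "mat_inv A * A = 1\<^sub>m n" "mat_inv A \<in> carrier_mat n n"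
    by (auto simp: mat_inv_def)
qed

lemma frobenius_norm_eq_0_iff:
  assumes "A \<in> carrier_mat m n"
  shows "frobenius_norm A = 0 \<longleftrightarrow> A = 0\<^sub>m m n"
proof
  assume "frobenius_norm A = 0"
  then have "A $$ (i, j) = 0" if "i < m" "j < n" for i j
    using frobenius_norm_eq_0D[of A i j] that assms by auto
  then show "A = 0\<^sub>m m n" using assms by (intro eq_matI) auto
qed (simp add: frobenius_norm_def)

lemma euclid_norm_mono:
  assumes "v \<in> carrier_vec n" "w \<in> carrier_vec n" "\<And>i. i < n \<Longrightarrow> \<bar>v $ i\<bar> \<le> \<bar>w $ i\<bar>"
  shows "euclid_norm v \<le> euclid_norm w"
proof (rule power2_le_imp_le)
  show "(euclid_norm v)\<^sup>2 \<le> (euclid_norm w)\<^sup>2"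
    using assms unfolding euclid_norm_sq by (auto intro!: sum_mono simp: abs_le_square_iff)
qed simp

lemma frobenius_norm_mono:
  assumes "A \<in> carrier_mat m n" "B \<in> carrier_mat m n"
    "\<And>i j. i < m \<Longrightarrow> j < n \<Longrightarrow> \<bar>A $$ (i, j)\<bar> \<le> \<bar>B $$ (i, j)\<bar>"
  shows "frobenius_norm A \<le> frobenius_norm B"
proof (rule power2_le_imp_le)
  show "(frobenius_norm A)\<^sup>2 \<le> (frobenius_norm B)\<^sup>2"
    using assms unfolding frobenius_norm_sq by (auto intro!: sum_mono simp: abs_le_square_iff)
qed simp

lemma frobenius_norm_smult: "frobenius_norm (c \<cdot>\<^sub>m A) = \<bar>c\<bar> * frobenius_norm A"
proof (rule power2_eq_imp_eq)
  show "(frobenius_norm (c \<cdot>\<^sub>m A))\<^sup>2 = (\<bar>c\<bar> * frobenius_norm A)\<^sup>2"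
    by (simp add: frobenius_norm_sq power_mult_distrib sum_distrib_left)
qed auto

lemma mult_mat_vec_index:
  assumes "A \<in> carrier_mat m n" "y \<in> carrier_vec n" "i < m"
  shows "(A *\<^sub>v y) $ i = (\<Sum>l<n. A $$ (i, l) * y $ l)"
  using assms by (simp add: scalar_prod_def lessThan_atLeast0)

lemma mult_mat_index:
  assumes "A \<in> carrier_mat m n" "B \<in> carrier_mat n k" "i < m" "l < k"
  shows "(A * B) $$ (i, l) = (\<Sum>j<n. A $$ (i, j) * B $$ (j, l))"
  using assms by (simp add: scalar_prod_def lessThan_atLeast0)

lemma spectral_norm_pos:
  assumes A: "A \<in> carrier_mat n n" "invertible_mat A" and n: "0 < n"
  shows "0 < spectral_norm A"
proof -
  note Ai = mat_inv[OF A]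
  let ?x = "unit_vec n 0 :: real vec"
  have x: "?x \<in> carrier_vec n" by simp
  have "?x \<noteq> 0\<^sub>v n"
  proof
    assume eq: "?x = 0\<^sub>v n"
    have "?x $ 0 = 1" using n by simp
    then show False unfolding eq using n by simp
  qed
  then have "euclid_norm ?x \<noteq> 0" unfolding euclid_norm_eq_0_iff[OF x] .
  then have pos: "0 < euclid_norm ?x" using euclid_norm_nonneg[of ?x] by linarith
  have "?x = mat_inv A *\<^sub>v (A *\<^sub>v ?x)"
  proof -
    have "mat_inv A *\<^sub>v (A *\<^sub>v ?x) = (mat_inv A * A) *\<^sub>v ?x"
      by (rule assoc_mult_mat_vec[OF Ai(3) A(1) x, symmetric])
    then show ?thesis unfolding Ai(2) one_mult_mat_vec[OF x] by (rule sym)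
  qed
  then have "euclid_norm ?x = euclid_norm (mat_inv A *\<^sub>v (A *\<^sub>v ?x))" by (rule arg_cong)
  also have "\<dots> \<le> spectral_norm (mat_inv A) * euclid_norm (A *\<^sub>v ?x)"
    by (rule euclid_norm_mult_mat_vec_le[OF Ai(3) mult_mat_vec_carrier[OF A(1) x]])
  also have "\<dots> \<le> spectral_norm (mat_inv A) * (spectral_norm A * euclid_norm ?x)"
    by (rule mult_left_mono[OF euclid_norm_mult_mat_vec_le[OF A(1) x]]) simp
  finally have le: "euclid_norm ?x \<le> spectral_norm (mat_inv A) * (spectral_norm A * euclid_norm ?x)" .
  have "spectral_norm A \<noteq> 0"
  proof
    assume "spectral_norm A = 0"
    with le pos show False by simp
  qed
  then show ?thesis using spectral_norm_nonneg[of A] by linarith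
qed

section \<open>Extremal vectors of quadratic forms\<close>

text \<open>A box is a product of compact intervals. The functions stand for the entries of vectors and
  matrices, whose types carry no topology of their own.\<close>

lemma compact_box:
  fixes c :: real
  shows "compact {f :: 'i \<Rightarrow> real. (\<forall>i\<in>I. \<bar>f i\<bar> \<le> c) \<and> (\<forall>i. i \<notin> I \<longrightarrow> f i = 0)}"
proof -
  have "{f :: 'i \<Rightarrow> real. (\<forall>i\<in>I. \<bar>f i\<bar> \<le> c) \<and> (\<forall>i. i \<notin> I \<longrightarrow> f i = 0)} =
      PiE UNIV (\<lambda>i. if i \<in> I then {-c..c} else {0})"
    by (auto simp: PiE_def Pi_def abs_le_iff split: if_splits)
  moreover have "compactin (product_topology (\<lambda>i :: 'i. euclideanreal) UNIV)
      (PiE UNIV (\<lambda>i. if i \<in> I then {-c..c} else {0}))"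
    by (subst compactin_PiE) auto
  ultimately show ?thesis by (simp add: euclidean_product_topology)
qed

text \<open>The first order condition at an extremum: with \<open>a \<noteq> 0\<close> the linear term would dominate near 0.\<close>

lemma linear_term_zero:
  fixes a c :: real
  assumes "\<And>s. 0 \<le> 2 * s * a + s\<^sup>2 * c"
  shows "a = 0"
proof (rule ccontr)
  assume a: "a \<noteq> 0"
  define d where "d = \<bar>c\<bar> + 1"
  have d: "d > 0" "c < d" by (auto simp: d_def)
  have "2 * (- a / d) * a + (- a / d)\<^sup>2 * c = (a / d)\<^sup>2 * (c - 2 * d)"
    using d by (simp add: power2_eq_square field_simps)
  also have "\<dots> < 0" using a d by (intro mult_pos_neg) auto
  finally show False using assms[of "- a / d"] by simp
qed

text \<open>A symmetric form attains its minimum on the unit sphere of \<open>v\<^sup>\<bottom>\<close>, and the minimizer is an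
  eigenvector: its residual is orthogonal to \<open>v\<^sup>\<bottom>\<close> by the first order condition, and lies
  in \<open>v\<^sup>\<bottom>\<close> because \<open>v\<close> is in the kernel. The choice \<open>v = 0\<close> gives the smallest eigenvalue.\<close>

lemma min_eigenvector_orthogonal:
  fixes B :: "real mat"
  assumes B: "B \<in> carrier_mat n n" "B\<^sup>T = B" and v: "v \<in> carrier_vec n" "B *\<^sub>v v = 0\<^sub>v n"
    and x0: "x0 \<in> carrier_vec n" "x0 \<noteq> 0\<^sub>v n" "v \<bullet> x0 = 0"
  obtains e x where "x \<in> carrier_vec n" "x \<noteq> 0\<^sub>v n" "v \<bullet> x = 0" "B *\<^sub>v x = e \<cdot>\<^sub>v x"
    "\<And>y. y \<in> carrier_vec n \<Longrightarrow> v \<bullet> y = 0 \<Longrightarrow> e * (y \<bullet> y) \<le> y \<bullet> (B *\<^sub>v y)"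
proof -
  define Sph where "Sph = {f :: nat \<Rightarrow> real. (\<forall>i\<in>{..<n}. \<bar>f i\<bar> \<le> 1) \<and> (\<forall>i. i \<notin> {..<n} \<longrightarrow> f i = 0)}
      \<inter> {f. (\<Sum>i<n. f i * f i) = 1} \<inter> {f. (\<Sum>i<n. v $ i * f i) = 0}"
  define q where "q f = (\<Sum>i<n. \<Sum>j<n. f i * (B $$ (i, j) * f j))" for f :: "nat \<Rightarrow> real"
  have sp: "vec n f \<bullet> vec n f = (\<Sum>i<n. f i * f i)" "v \<bullet> vec n f = (\<Sum>i<n. v $ i * f i)"
    "vec n f \<bullet> (B *\<^sub>v vec n f) = q f" for f
    using B v by (auto simp: scalar_prod_def q_def lessThan_atLeast0 sum_distrib_left intro!: sum.cong)
  have "compact Sph"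
    unfolding Sph_def
    by (intro compact_Int_closed compact_box closed_Collect_eq continuous_intros) auto
  have inS: "\<exists>f \<in> Sph. (1 / euclid_norm y) \<cdot>\<^sub>v y = vec n f"
    if y: "y \<in> carrier_vec n" "y \<noteq> 0\<^sub>v n" "v \<bullet> y = 0" for y
  proof -
    let ?u = "(1 / euclid_norm y) \<cdot>\<^sub>v y"
    let ?f = "\<lambda>i. if i < n then ?u $ i else 0"
    have pos: "euclid_norm y > 0" using y euclid_norm_eq_0_iff[OF y(1)] by (simp add: less_le)
    have eq: "?u = vec n ?f" using y by (intro eq_vecI) auto
    have one: "euclid_norm ?u = 1" using pos by (simp add: euclid_norm_smult)
    have "\<bar>?f i\<bar> \<le> 1" if "i < n" for i
    proof -
      have "\<bar>?f i\<bar> \<le> L2_set (\<lambda>i. \<bar>?u $ i\<bar>) {..<n}"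
        using member_le_L2_set[of "{..<n}" i "\<lambda>i. \<bar>?u $ i\<bar>"] that by auto
      also have "\<dots> = euclid_norm ?u" using y by (simp add: euclid_norm_L2_set L2_set_def power_divide)
      finally show ?thesis using one by simp
    qed
    moreover have "(\<Sum>i<n. ?f i * ?f i) = 1"
      using one euclid_norm_sq_scalar[of ?u] unfolding sp(1)[symmetric] eq[symmetric] by (metis power_one)
    moreover have "(\<Sum>i<n. v $ i * ?f i) = 0"
      using y v unfolding sp(2)[symmetric] eq[symmetric] by simp
    ultimately have "?f \<in> Sph" by (auto simp: Sph_def)
    then show ?thesis using eq by blast
  qed
  have "Sph \<noteq> {}" using inS[OF x0] by auto
  moreover have "continuous_on Sph q"
    unfolding q_def by (intro continuous_intros continuous_on_subset[OF continuous_on_product_coordinates]) auto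
  ultimately obtain f where f: "f \<in> Sph" "\<And>h. h \<in> Sph \<Longrightarrow> q f \<le> q h"
    using continuous_attains_inf[OF \<open>compact Sph\<close>] by blast
  define x where "x = vec n f"
  define e where "e = q f"
  have x: "x \<in> carrier_vec n" by (simp add: x_def)
  have xx: "x \<bullet> x = 1" "v \<bullet> x = 0" "x \<bullet> (B *\<^sub>v x) = e"
    using f(1) unfolding x_def e_def sp by (auto simp: Sph_def)
  have xn0: "x \<noteq> 0\<^sub>v n" using xx(1) by auto
  have low: "e * (y \<bullet> y) \<le> y \<bullet> (B *\<^sub>v y)" if y: "y \<in> carrier_vec n" "v \<bullet> y = 0" for y
  proof (cases "y = 0\<^sub>v n")
    case True
    then show ?thesis using B by simp
  next
    case False
    from inS[OF y(1) this y(2)] obtain h where h: "h \<in> Sph" "(1 / euclid_norm y) \<cdot>\<^sub>v y = vec n h" by auto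
    have pos: "euclid_norm y > 0" using y False euclid_norm_eq_0_iff[OF y(1)] by (simp add: less_le)
    have "e \<le> vec n h \<bullet> (B *\<^sub>v vec n h)" using f(2)[OF h(1)] unfolding e_def sp .
    also have "\<dots> = (1 / euclid_norm y)\<^sup>2 * (y \<bullet> (B *\<^sub>v y))"
      unfolding h(2)[symmetric] using y B by (simp add: mult_mat_vec power2_eq_square)
    finally have "e * (euclid_norm y)\<^sup>2 \<le> y \<bullet> (B *\<^sub>v y)"
      using pos by (simp add: field_simps power2_eq_square)
    then show ?thesis by (simp add: euclid_norm_sq_scalar)
  qed
  define r where "r = B *\<^sub>v x - e \<cdot>\<^sub>v x"
  have r: "r \<in> carrier_vec n" using B x by (auto simp: r_def)
  have Bx: "B *\<^sub>v x \<in> carrier_vec n" "B *\<^sub>v r \<in> carrier_vec n" using B x r by auto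
  have vr: "v \<bullet> r = 0"
  proof -
    have "v \<bullet> (B *\<^sub>v x) = 0"
      using scalar_prod_mult_mat_vec[OF B(1) x v(1)] B v x by simp
    then show ?thesis using Bx x v xx by (simp add: r_def scalar_prod_minus_distrib[of _ n])
  qed
  have sym: "r \<bullet> (B *\<^sub>v x) = x \<bullet> (B *\<^sub>v r)"
    using scalar_prod_mult_mat_vec[OF B(1) x r] B x r Bx comm_scalar_prod[of x n "B *\<^sub>v r"] by simp
  have "r \<bullet> (B *\<^sub>v x) - e * (r \<bullet> x) = 0"
  proof (rule linear_term_zero)
    fix s :: real
    let ?y = "x + s \<cdot>\<^sub>v r"
    have "v \<bullet> ?y = 0" using x r v xx vr by (simp add: scalar_prod_add_distrib[of _ n])
    from low[OF _ this] have "e * (?y \<bullet> ?y) \<le> ?y \<bullet> (B *\<^sub>v ?y)" using x r by auto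
    moreover have "?y \<bullet> ?y = x \<bullet> x + 2 * s * (r \<bullet> x) + s\<^sup>2 * (r \<bullet> r)"
      using x r comm_scalar_prod[OF x r]
      by (simp add: scalar_prod_add_distrib[of _ n] add_scalar_prod_distrib[of _ n] power2_eq_square algebra_simps)
    moreover have "?y \<bullet> (B *\<^sub>v ?y) = x \<bullet> (B *\<^sub>v x) + 2 * s * (r \<bullet> (B *\<^sub>v x)) + s\<^sup>2 * (r \<bullet> (B *\<^sub>v r))"
      using x r Bx B sym
      by (simp add: scalar_prod_add_distrib[of _ n] add_scalar_prod_distrib[of _ n] power2_eq_square
          mult_add_distrib_mat_vec[of _ n n] mult_mat_vec[of _ n n] algebra_simps)
    ultimately show "0 \<le> 2 * s * (r \<bullet> (B *\<^sub>v x) - e * (r \<bullet> x)) + s\<^sup>2 * (r \<bullet> (B *\<^sub>v r) - e * (r \<bullet> r))"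
      using xx by (simp add: algebra_simps)
  qed
  then have "r \<bullet> r = 0"
    using r x Bx by (subst (2) r_def) (simp add: scalar_prod_minus_distrib[of _ n])
  then have "euclid_norm r = 0" by (simp add: euclid_norm_def)
  then have "r = 0\<^sub>v n" using r euclid_norm_eq_0_iff by blast
  have "B *\<^sub>v x = r + e \<cdot>\<^sub>v x" unfolding r_def using Bx(1) B x by (intro eq_vecI) auto
  then have "B *\<^sub>v x = e \<cdot>\<^sub>v x" using \<open>r = 0\<^sub>v n\<close> x by simp
  then show thesis using that x xn0 xx low by blast
qed

lemma min_eigenvector:
  fixes B :: "real mat"
  assumes B: "B \<in> carrier_mat n n" "B\<^sup>T = B" and n: "0 < n"
  obtains e x where "x \<in> carrier_vec n" "x \<noteq> 0\<^sub>v n" "B *\<^sub>v x = e \<cdot>\<^sub>v x"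
    "\<And>y. y \<in> carrier_vec n \<Longrightarrow> e * (y \<bullet> y) \<le> y \<bullet> (B *\<^sub>v y)"
proof -
  have "unit_vec n 0 \<noteq> (0\<^sub>v n :: real vec)" using n
    by (metis index_unit_vec(1) index_zero_vec(1) zero_neq_one)
  moreover have "B *\<^sub>v 0\<^sub>v n = 0\<^sub>v n" using B by (intro eq_vecI) auto
  ultimately show thesis
    using min_eigenvector_orthogonal[OF B zero_carrier_vec _ unit_vec_carrier, of 0 thesis] that
    by auto
qed

lemma finite_singular_values: "finite (singular_values M)"
proof -
  let ?B = "M\<^sup>T * M"
  have B: "?B \<in> carrier_mat (dim_col M) (dim_col M)" by auto
  have "char_poly ?B \<noteq> 0" using degree_monic_char_poly[OF B] by auto
  then have "finite {e. poly (char_poly ?B) e = 0}" by (rule poly_roots_finite)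
  then have "finite {e. eigenvalue ?B e}" using eigenvalue_root_char_poly[OF B] by simp
  moreover have "singular_values M = sqrt ` {e. eigenvalue ?B e}" by (auto simp: singular_values_def)
  ultimately show ?thesis by simp
qed

lemma scalar_prod_gram:
  assumes "M \<in> carrier_mat r q" "x \<in> carrier_vec q"
  shows "x \<bullet> ((M\<^sup>T * M) *\<^sub>v x) = (euclid_norm (M *\<^sub>v x))\<^sup>2"
proof -
  have "x \<bullet> ((M\<^sup>T * M) *\<^sub>v x) = x \<bullet> (M\<^sup>T *\<^sub>v (M *\<^sub>v x))"
    using assms by (simp add: assoc_mult_mat_vec[of _ q r _ q])
  also have "\<dots> = (M *\<^sub>v x) \<bullet> (M *\<^sub>v x)"
    using assms by (subst scalar_prod_mult_mat_vec[of _ q r]) auto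
  finally show ?thesis by (simp add: euclid_norm_sq_scalar)
qed

lemma euclid_norm_isometry:
  assumes "U \<in> carrier_mat m n" "U\<^sup>T * U = 1\<^sub>m n" "y \<in> carrier_vec n"
  shows "euclid_norm (U *\<^sub>v y) = euclid_norm y"
proof -
  have "(euclid_norm (U *\<^sub>v y))\<^sup>2 = y \<bullet> ((U\<^sup>T * U) *\<^sub>v y)"
    by (rule scalar_prod_gram[OF assms(1,3), symmetric])
  also have "\<dots> = (euclid_norm y)\<^sup>2" using assms by (simp add: euclid_norm_sq_scalar)
  finally show ?thesis by (simp add: power2_eq_iff_nonneg)
qed

lemma gram_eigenvector_singular_value:
  assumes M: "M \<in> carrier_mat r q" and x: "x \<in> carrier_vec q" "x \<noteq> 0\<^sub>v q"
    and e: "(M\<^sup>T * M) *\<^sub>v x = e \<cdot>\<^sub>v x"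
  shows "sqrt e \<in> singular_values M" "e * (euclid_norm x)\<^sup>2 = (euclid_norm (M *\<^sub>v x))\<^sup>2" "0 \<le> e"
proof -
  show "sqrt e \<in> singular_values M"
    using assms by (auto simp: singular_values_def eigenvalue_def eigenvector_def)
  show 1: "e * (euclid_norm x)\<^sup>2 = (euclid_norm (M *\<^sub>v x))\<^sup>2"
    using scalar_prod_gram[OF M x(1)] x by (simp add: e euclid_norm_sq_scalar)
  have "(euclid_norm x)\<^sup>2 > 0" using x euclid_norm_eq_0_iff[OF x(1)] by simp
  then show "0 \<le> e" using 1 by (metis not_less mult_neg_pos zero_le_power2)
qed

text \<open>The smallest eigenvalue of the Gram matrix is the minimum of its Rayleigh quotient.\<close>

lemma sigma_min_mult_le:
  assumes M: "M \<in> carrier_mat r q" and q: "0 < q" and y: "y \<in> carrier_vec q"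
  shows "sigma_min M * euclid_norm y \<le> euclid_norm (M *\<^sub>v y)"
proof -
  let ?B = "M\<^sup>T * M"
  have B: "?B \<in> carrier_mat q q" "?B\<^sup>T = ?B" using M by (auto simp: transpose_mult[of _ q r])
  from min_eigenvector[OF B q] obtain e x where x: "x \<in> carrier_vec q" "x \<noteq> 0\<^sub>v q"
    "?B *\<^sub>v x = e \<cdot>\<^sub>v x" and low: "\<And>y. y \<in> carrier_vec q \<Longrightarrow> e * (y \<bullet> y) \<le> y \<bullet> (?B *\<^sub>v y)" by metis
  note e = gram_eigenvector_singular_value[OF M x]
  have "sigma_min M \<le> sqrt e"
    unfolding sigma_min_def using e(1) finite_singular_values by (intro Min_le) auto
  then have "sigma_min M * euclid_norm y \<le> sqrt e * euclid_norm y" by (rule mult_right_mono) simp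
  also have "\<dots> = sqrt (e * (y \<bullet> y))"
    by (simp add: real_sqrt_mult euclid_norm_def)
  also have "\<dots> \<le> sqrt ((euclid_norm (M *\<^sub>v y))\<^sup>2)"
    by (rule real_sqrt_le_mono) (use low[OF y] scalar_prod_gram[OF M y] in simp)
  finally show ?thesis by simp
qed

text \<open>If \<open>v\<close> spans the kernel, the minimum of the Gram form on the unit sphere of \<open>v\<^sup>\<bottom>\<close> is a
  nonzero eigenvalue.\<close>

lemma sigma_min_nonzero_mult_le:
  assumes M: "M \<in> carrier_mat r q" and v: "v \<in> carrier_vec q" "M *\<^sub>v v = 0\<^sub>v r"
    and ker: "\<And>x. x \<in> carrier_vec q \<Longrightarrow> M *\<^sub>v x = 0\<^sub>v r \<Longrightarrow> v \<bullet> x = 0 \<Longrightarrow> x = 0\<^sub>v q"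
    and y: "y \<in> carrier_vec q" "v \<bullet> y = 0"
  shows "sigma_min_nonzero M * euclid_norm y \<le> euclid_norm (M *\<^sub>v y)"
proof (cases "y = 0\<^sub>v q")
  case False
  let ?B = "M\<^sup>T * M"
  have B: "?B \<in> carrier_mat q q" "?B\<^sup>T = ?B" using M by (auto simp: transpose_mult[of _ q r])
  have Bv: "?B *\<^sub>v v = 0\<^sub>v q" using M v
    by (simp add: assoc_mult_mat_vec[of _ q r _ q]) (intro eq_vecI, auto)
  from min_eigenvector_orthogonal[OF B v(1) Bv y(1) False y(2)] obtain e x
    where x: "x \<in> carrier_vec q" "x \<noteq> 0\<^sub>v q" "?B *\<^sub>v x = e \<cdot>\<^sub>v x" and vx: "v \<bullet> x = 0"
      and low: "\<And>y. y \<in> carrier_vec q \<Longrightarrow> v \<bullet> y = 0 \<Longrightarrow> e * (y \<bullet> y) \<le> y \<bullet> (?B *\<^sub>v y)" by metis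
  note e = gram_eigenvector_singular_value[OF M x]
  have "e \<noteq> 0"
  proof
    assume "e = 0"
    then have "euclid_norm (M *\<^sub>v x) = 0" using e by simp
    then have "M *\<^sub>v x = 0\<^sub>v r"
      using M euclid_norm_eq_0_iff[OF mult_mat_vec_carrier[OF M x(1)]] by simp
    then show False using ker x vx by blast
  qed
  then have "sigma_min_nonzero M \<le> sqrt e"
    unfolding sigma_min_nonzero_def using e(1) finite_singular_values by (intro Min_le) auto
  then have "sigma_min_nonzero M * euclid_norm y \<le> sqrt e * euclid_norm y" by (rule mult_right_mono) simp
  also have "\<dots> = sqrt (e * (y \<bullet> y))"
    by (simp add: real_sqrt_mult euclid_norm_def)
  also have "\<dots> \<le> sqrt ((euclid_norm (M *\<^sub>v y))\<^sup>2)"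
    by (rule real_sqrt_le_mono) (use low[OF y] scalar_prod_gram[OF M y(1)] in simp)
  finally show ?thesis by simp
qed (use M in simp)

section \<open>Families with one-dimensional solution space\<close>

text \<open>Reading off a matrix from the vector of its entries is a surjective linear map.\<close>

lemma fin_dim_module_mat:
  "vectorspace.fin_dim class_ring (module_mat TYPE(real) q q)"
proof -
  interpret M: vectorspace class_ring "module_mat TYPE(real) q q" by (rule matrix_vs)
  interpret W: vec_space "TYPE(real)" "q * q" .
  define T where "T v = mat q q (\<lambda>(i, j). v $ (i + j * q))" for v :: "real vec"
  have idx: "i + j * q < q * q" if "i < q" "j < q" for i j
  proof -
    have "i + j * q < Suc j * q" using that by simp
    also have "\<dots> \<le> q * q" using that by (intro mult_right_mono) auto
    finally show ?thesis .
  qed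
  interpret L: linear_map class_ring W.V "module_mat TYPE(real) q q" T
  proof (unfold_locales, goal_cases)
    case 1
    show ?case
      by (auto simp: module_hom_def T_def module_vec_simps module_mat_simps class_ring_simps idx intro!: eq_matI)
  qed
  have "T ` carrier W.V = carrier (module_mat TYPE(real) q q)"
  proof (intro equalityI subsetI)
    fix X assume X: "X \<in> carrier (module_mat TYPE(real) q q)"
    have X': "X \<in> carrier_mat q q" using X by (simp add: module_mat_simps)
    have "T (vec_cols X) = X"
      using X' idx by (intro eq_matI) (auto simp: T_def vec_cols_def div_mult_self3)
    moreover have "vec_cols X \<in> carrier_vec (q * q)" using X' by (auto simp: vec_cols_def)
    ultimately show "X \<in> T ` carrier W.V"
      by (metis image_eqI module_vec_simps(3))
  qed (auto simp: T_def module_mat_simps)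
  then show ?thesis by (rule L.surj_fin_dim[OF W.fin_dim])
qed

text \<open>The dimension is the least size of a finite generating set, so its value is informative only once
  such a set exists. A linearly independent subset of maximal size is one.\<close>

lemma fin_dim_N_space:
  assumes B: "\<And>i. i < m \<Longrightarrow> B i \<in> carrier_mat q q"
  shows "vectorspace.fin_dim class_ring ((module_mat TYPE(real) q q)\<lparr>carrier := N_space q m B\<rparr>)"
proof -
  interpret M: vectorspace class_ring "module_mat TYPE(real) q q" by (rule matrix_vs)
  let ?U = "(module_mat TYPE(real) q q)\<lparr>carrier := N_space q m B\<rparr>"
  interpret U: vectorspace class_ring ?U by (rule vectorspace_N_space[OF B])
  have sub: "submodule class_ring (N_space q m B) (module_mat TYPE(real) q q)"
  proof (unfold_locales, goal_cases)
    case 1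
    then show ?case by (auto simp: N_space_def module_mat_simps)
  next
    case (2 v w)
    then show ?case using U.M.a_closed[of v w] by simp
  next
    case 3
    then show ?case using U.M.zero_closed by simp
  next
    case (4 c v)
    then show ?case using U.smult_closed[of c v] by simp
  qed
  have bound: "finite A \<and> card A \<le> M.dim" if "A \<subseteq> carrier ?U \<and> U.lin_indpt A" for A
  proof -
    have A: "A \<subseteq> N_space q m B" using that by simp
    have "M.lin_indpt A"
      using M.span_li_not_depend(2)[OF A sub] that by simp
    moreover have "A \<subseteq> carrier (module_mat TYPE(real) q q)" using A by (auto simp: N_space_def module_mat_simps)
    ultimately show ?thesis using M.li_le_dim[OF fin_dim_module_mat] by simp
  qed
  have "\<exists>A. finite A \<and> maximal A (\<lambda>A. A \<subseteq> carrier ?U \<and> U.lin_indpt A)"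
    by (rule maximal_exists[OF bound, where B = "{}"]) (auto simp: U.lin_dep_def)
  then obtain A where "finite A" "maximal A (\<lambda>A. A \<subseteq> carrier ?U \<and> U.lin_indpt A)" by blast
  then show ?thesis using U.max_li_is_basis unfolding U.basis_def U.fin_dim_def by blast
qed

lemma one_in_N_space:
  assumes B: "\<And>i. i < m \<Longrightarrow> B i \<in> carrier_mat q q"
  shows "1\<^sub>m q \<in> N_space q m B"
proof -
  have "B i * 1\<^sub>m q - (1\<^sub>m q)\<^sup>T * B i = 0\<^sub>m q q" if "i < m" for i
    using B[OF that] by (simp add: transpose_one)
  then show ?thesis by (simp add: N_space_def)
qed

text \<open>The identity always solves the equations, so it spans a one-dimensional solution space.\<close>

lemma N_space_scalar:
  assumes B: "\<And>i. i < m \<Longrightarrow> B i \<in> carrier_mat q q" and dim: "N_dim q m B = 1"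
    and q: "0 < q" and Z: "Z \<in> N_space q m B"
  obtains c where "Z = c \<cdot>\<^sub>m 1\<^sub>m q"
proof -
  let ?U = "(module_mat TYPE(real) q q)\<lparr>carrier := N_space q m B\<rparr>"
  interpret U: vectorspace class_ring ?U by (rule vectorspace_N_space[OF B])
  have one: "1\<^sub>m q \<in> carrier ?U" using one_in_N_space[OF B] by simp
  have lc: "U.lincomb a {1\<^sub>m q} = a (1\<^sub>m q) \<cdot>\<^sub>m 1\<^sub>m q" for a
    using one U.lincomb_insert[of "{}" a "1\<^sub>m q"] U.smult_closed[of "a (1\<^sub>m q)" "1\<^sub>m q"]
    by (auto simp: U.lincomb_def module_mat_simps class_ring_simps)
  have "U.lin_indpt {1\<^sub>m q}"
  proof (rule U.finite_lin_indpt2)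
    fix a assume a: "U.lincomb a {1\<^sub>m q} = \<zero>\<^bsub>?U\<^esub>"
    have "a (1\<^sub>m q) \<cdot>\<^sub>m 1\<^sub>m q = (0\<^sub>m q q :: real mat)"
      using a unfolding lc by (simp add: module_mat_simps)
    from arg_cong[OF this, of "\<lambda>X. X $$ (0, 0)"] have "a (1\<^sub>m q) = 0" using q by simp
    then show "\<forall>v\<in>{1\<^sub>m q}. a v = \<zero>\<^bsub>class_ring\<^esub>" by (simp add: class_ring_simps)
  qed (use one in auto)
  moreover have "U.dim = 1" using dim by (simp add: N_dim_def)
  ultimately have "U.basis {1\<^sub>m q}"
    using one by (intro U.dim_li_is_basis fin_dim_N_space[OF B]) auto
  then have "Z \<in> U.span {1\<^sub>m q}" using Z by (simp add: U.basis_def)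
  then obtain a where "Z = U.lincomb a {1\<^sub>m q}"
    using one by (subst (asm) U.finite_span) auto
  then show thesis using that lc by blast
qed

section \<open>Block indices\<close>

text \<open>The block that contains position \<open>i\<close>. In terms of this labelling, being block diagonal is a
  condition on single entries, and most of the argument can do without submatrices.\<close>

fun blk :: "nat list \<Rightarrow> nat \<Rightarrow> nat" where
  "blk [] i = 0"
| "blk (k # ks) i = (if i < k then 0 else Suc (blk ks (i - k)))"

abbreviation offset :: "nat list \<Rightarrow> nat \<Rightarrow> nat" where
  "offset ns j \<equiv> sum_list (take j ns)"

lemma blk_offset: "j < length ns \<Longrightarrow> a < ns ! j \<Longrightarrow> blk ns (offset ns j + a) = j"
proof (induction ns arbitrary: j)
  case (Cons k ks)
  then show ?case by (cases j) auto
qed auto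

lemma offset_add_less: "j < length ns \<Longrightarrow> a < ns ! j \<Longrightarrow> offset ns j + a < sum_list ns"
proof (induction ns arbitrary: j)
  case (Cons k ks)
  then show ?case by (cases j) auto
qed auto

lemma blk_less: "i < sum_list ns \<Longrightarrow> blk ns i < length ns"
proof (induction ns arbitrary: i)
  case (Cons k ks)
  then show ?case using Cons.IH[of "i - k"] by auto
qed auto

lemma block_position:
  "i < sum_list ns \<Longrightarrow> \<exists>a<ns ! blk ns i. i = offset ns (blk ns i) + a"
proof (induction ns arbitrary: i)
  case (Cons k ks)
  show ?case
  proof (cases "i < k")
    case False
    then have "i - k < sum_list ks" using Cons.prems by auto
    from Cons.IH[OF this] False show ?thesis by auto
  qed auto
qed auto

lemma sum_blocks:
  fixes h :: "nat \<Rightarrow> 'a :: comm_monoid_add"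
  shows "(\<Sum>i<sum_list ns. h i) = (\<Sum>j<length ns. \<Sum>a<ns ! j. h (offset ns j + a))"
proof (induction ns arbitrary: h)
  case (Cons k ks)
  have "(\<Sum>i<sum_list (k # ks). h i) = (\<Sum>i<k. h i) + (\<Sum>i=k..<k + sum_list ks. h i)"
    using sum.atLeastLessThan_concat[of 0 k "k + sum_list ks" h] by (simp add: lessThan_atLeast0)
  also have "(\<Sum>i=k..<k + sum_list ks. h i) = (\<Sum>i<sum_list ks. h (k + i))"
    using sum.shift_bounds_nat_ivl[of h 0 k "sum_list ks"] by (simp add: lessThan_atLeast0 add.commute)
  also have "\<dots> = (\<Sum>j<length ks. \<Sum>a<ks ! j. h (k + (offset ks j + a)))"
    by (rule Cons.IH)
  finally show ?case by (simp add: sum.lessThan_Suc_shift add.assoc del: sum.lessThan_Suc)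
qed auto

lemma sum_one_block:
  fixes h :: "nat \<Rightarrow> 'a :: comm_monoid_add"
  assumes "j < length ns"
  shows "(\<Sum>i<sum_list ns. if blk ns i = j then h i else 0) = (\<Sum>a<ns ! j. h (offset ns j + a))"
proof -
  have "(\<Sum>i<sum_list ns. if blk ns i = j then h i else 0) =
      (\<Sum>k<length ns. \<Sum>a<ns ! k. if blk ns (offset ns k + a) = j then h (offset ns k + a) else 0)"
    by (rule sum_blocks)
  also have "\<dots> = (\<Sum>k<length ns. if k = j then (\<Sum>a<ns ! k. h (offset ns k + a)) else 0)"
    by (intro sum.cong refl) (auto simp: blk_offset)
  also have "\<dots> = (\<Sum>a<ns ! j. h (offset ns j + a))" using assms by simp
  finally show ?thesis .
qed

text \<open>All block diagonal matrices of the statement have blocks cut out of one function of the global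
  positions, so this gives their entries.\<close>

lemma diag_block_mat_blk:
  "diag_block_mat (map (\<lambda>j. mat (ns ! j) (ns ! j) (\<lambda>(a, c). f (offset ns j + a) (offset ns j + c)))
     [0..<length ns]) =
   (mat (sum_list ns) (sum_list ns) (\<lambda>(i, l). if blk ns i = blk ns l then f i l else 0) :: real mat)"
proof (induction ns arbitrary: f)
  case Nil
  show ?case by (intro eq_matI) auto
next
  case (Cons k ks)
  have up: "[0..<length (k # ks)] = 0 # map Suc [0..<length ks]"
    by (simp add: upt_conv_Cons map_Suc_upt del: upt_Suc)
  have "diag_block_mat (map (\<lambda>j. mat ((k # ks) ! j) ((k # ks) ! j)
      (\<lambda>(a, c). f (offset (k # ks) j + a) (offset (k # ks) j + c))) [0..<length (k # ks)]) =
     diag_block_mat (mat k k (\<lambda>(a, c). f a c) # map (\<lambda>j. mat (ks ! j) (ks ! j)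
       (\<lambda>(a, c). f (k + (offset ks j + a)) (k + (offset ks j + c)))) [0..<length ks])"
    unfolding up by (simp add: comp_def add.assoc)
  also have "\<dots> = (let B = mat (sum_list ks) (sum_list ks)
        (\<lambda>(i, l). if blk ks i = blk ks l then f (k + i) (k + l) else 0)
      in four_block_mat (mat k k (\<lambda>(a, c). f a c)) (0\<^sub>m k (dim_col B)) (0\<^sub>m (dim_row B) k) B)"
    unfolding diag_block_mat.simps Cons.IH[of "\<lambda>i l. f (k + i) (k + l)"] by simp
  also have "\<dots> = mat (sum_list (k # ks)) (sum_list (k # ks))
      (\<lambda>(i, l). if blk (k # ks) i = blk (k # ks) l then f i l else 0)"
    by (intro eq_matI) (auto simp: Let_def)
  finally show ?case .
qed

lemma Bdiag_blk:
  "Bdiag ns A = mat (sum_list ns) (sum_list ns) (\<lambda>(i, l). if blk ns i = blk ns l then A $$ (i, l) else 0)"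
  unfolding Bdiag_def block_def
  using diag_block_mat_blk[of ns "\<lambda>i l. A $$ (i, l)"] by simp

lemma block_diagonal_iff:
  "A \<in> block_diagonal ns \<longleftrightarrow> A \<in> carrier_mat (sum_list ns) (sum_list ns) \<and>
     (\<forall>i<sum_list ns. \<forall>l<sum_list ns. blk ns i \<noteq> blk ns l \<longrightarrow> A $$ (i, l) = 0)"
proof
  assume "A \<in> block_diagonal ns"
  then have "A \<in> carrier_mat (sum_list ns) (sum_list ns)" "A = Bdiag ns A"
    by (auto simp: block_diagonal_def)
  moreover have "Bdiag ns A $$ (i, l) = 0"
    if "i < sum_list ns" "l < sum_list ns" "blk ns i \<noteq> blk ns l" for i l
    using that by (simp add: Bdiag_blk)
  ultimately show "A \<in> carrier_mat (sum_list ns) (sum_list ns) \<and>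
     (\<forall>i<sum_list ns. \<forall>l<sum_list ns. blk ns i \<noteq> blk ns l \<longrightarrow> A $$ (i, l) = 0)"
    by metis
next
  assume "A \<in> carrier_mat (sum_list ns) (sum_list ns) \<and>
     (\<forall>i<sum_list ns. \<forall>l<sum_list ns. blk ns i \<noteq> blk ns l \<longrightarrow> A $$ (i, l) = 0)"
  then show "A \<in> block_diagonal ns"
    unfolding block_diagonal_def Bdiag_blk by (auto intro!: eq_matI)
qed

lemma diag_block_scalars:
  "diag_block_mat (map (\<lambda>j. \<gamma> j \<cdot>\<^sub>m 1\<^sub>m (ns ! j)) [0..<length ns]) =
   (mat (sum_list ns) (sum_list ns) (\<lambda>(i, l). if i = l then \<gamma> (blk ns i) else 0) :: real mat)"
proof -
  have eq: "map (\<lambda>j. \<gamma> j \<cdot>\<^sub>m 1\<^sub>m (ns ! j)) [0..<length ns] =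
      map (\<lambda>j. mat (ns ! j) (ns ! j) (\<lambda>(a, c).
        if offset ns j + a = offset ns j + c then \<gamma> (blk ns (offset ns j + a)) else 0)) [0..<length ns]"
    by (intro map_cong refl eq_matI) (auto simp: blk_offset)
  then show ?thesis
    unfolding eq diag_block_mat_blk[of ns "\<lambda>i l. if i = l then \<gamma> (blk ns i) else 0"]
    by (auto intro!: eq_matI)
qed

lemma block_carrier [simp, intro]: "block ns A j k \<in> carrier_mat (ns ! j) (ns ! k)"
  by (simp add: block_def)

lemma block_index:
  "a < ns ! j \<Longrightarrow> c < ns ! k \<Longrightarrow> block ns A j k $$ (a, c) = A $$ (offset ns j + a, offset ns k + c)"
  by (simp add: block_def)

lemma block_mult_left:
  assumes D: "D \<in> block_diagonal ns" and Z: "Z \<in> carrier_mat (sum_list ns) (sum_list ns)"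
    and jk: "j < length ns" "k < length ns"
  shows "block ns (D * Z) j k = block ns D j j * block ns Z j k"
proof (rule eq_matI)
  fix a c assume "a < dim_row (block ns D j j * block ns Z j k)" "c < dim_col (block ns D j j * block ns Z j k)"
  then have a: "a < ns ! j" and c: "c < ns ! k" by (auto simp: block_def)
  let ?N = "sum_list ns" and ?r = "offset ns j + a" and ?s = "offset ns k + c"
  have rs: "?r < ?N" "?s < ?N" using offset_add_less a c jk by auto
  have DN: "D \<in> carrier_mat ?N ?N" using D by (simp add: block_diagonal_iff)
  have "block ns (D * Z) j k $$ (a, c) = (\<Sum>i<?N. D $$ (?r, i) * Z $$ (i, ?s))"
    using a c rs DN Z by (simp add: block_index scalar_prod_def lessThan_atLeast0)
  also have "\<dots> = (\<Sum>i<?N. if blk ns i = j then D $$ (?r, i) * Z $$ (i, ?s) else 0)"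
    using D rs(1) jk a by (intro sum.cong refl) (auto simp: block_diagonal_iff blk_offset)
  also have "\<dots> = (\<Sum>b<ns ! j. D $$ (?r, offset ns j + b) * Z $$ (offset ns j + b, ?s))"
    by (rule sum_one_block[OF jk(1)])
  also have "\<dots> = (block ns D j j * block ns Z j k) $$ (a, c)"
    using a c by (simp add: block_def scalar_prod_def lessThan_atLeast0)
  finally show "block ns (D * Z) j k $$ (a, c) = (block ns D j j * block ns Z j k) $$ (a, c)" .
qed (auto simp: block_def)

lemma block_transpose:
  assumes "A \<in> carrier_mat (sum_list ns) (sum_list ns)" "j < length ns" "k < length ns"
  shows "block ns (A\<^sup>T) j k = (block ns A k j)\<^sup>T"
  using assms offset_add_less by (intro eq_matI) (auto simp: block_def)

lemma block_diagonal_transpose: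
  "D \<in> block_diagonal ns \<Longrightarrow> D\<^sup>T \<in> block_diagonal ns"
  by (auto simp: block_diagonal_iff)

lemma block_minus:
  assumes "A \<in> carrier_mat (sum_list ns) (sum_list ns)" "B \<in> carrier_mat (sum_list ns) (sum_list ns)"
    "j < length ns" "k < length ns"
  shows "block ns (A - B) j k = block ns A j k - block ns B j k"
  using assms offset_add_less by (intro eq_matI) (auto simp: block_def)

lemma block_mult_transpose:
  assumes D: "D \<in> block_diagonal ns" and Z: "Z \<in> carrier_mat (sum_list ns) (sum_list ns)"
    and jk: "j < length ns" "k < length ns"
  shows "block ns (Z\<^sup>T * D) j k = (block ns Z k j)\<^sup>T * block ns D k k"
proof -
  have DN: "D \<in> carrier_mat (sum_list ns) (sum_list ns)" using D by (simp add: block_diagonal_iff)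
  have "block ns (Z\<^sup>T * D) j k = (block ns (D\<^sup>T * Z) k j)\<^sup>T"
    using DN Z jk by (subst block_transpose[symmetric]) (auto simp: transpose_mult[of _ "sum_list ns" "sum_list ns"])
  also have "\<dots> = (block ns (D\<^sup>T) k k * block ns Z k j)\<^sup>T"
    using block_mult_left[OF block_diagonal_transpose[OF D] Z jk(2,1)] by simp
  also have "\<dots> = (block ns Z k j)\<^sup>T * (block ns (D\<^sup>T) k k)\<^sup>T"
    by (rule transpose_mult) auto
  also have "(block ns (D\<^sup>T) k k)\<^sup>T = block ns D k k"
    using block_transpose[OF DN jk(2,2)] by simp
  finally show ?thesis .
qed

lemma frobenius_norm_sq_block:
  "(frobenius_norm (block ns A j k))\<^sup>2 =
     (\<Sum>a<ns ! j. \<Sum>c<ns ! k. (A $$ (offset ns j + a, offset ns k + c))\<^sup>2)"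
  by (simp add: frobenius_norm_sq block_def)

lemma sum_blocks2:
  fixes h :: "nat \<Rightarrow> nat \<Rightarrow> real"
  shows "(\<Sum>i<sum_list ns. \<Sum>l<sum_list ns. h i l) =
    (\<Sum>j<length ns. \<Sum>k<length ns. \<Sum>a<ns ! j. \<Sum>c<ns ! k. h (offset ns j + a) (offset ns k + c))"
  unfolding sum_blocks[of _ ns] by (intro sum.cong refl sum.swap)

lemma frobenius_norm_sq_blocks:
  assumes "A \<in> carrier_mat (sum_list ns) (sum_list ns)"
  shows "(frobenius_norm A)\<^sup>2 = (\<Sum>j<length ns. \<Sum>k<length ns. (frobenius_norm (block ns A j k))\<^sup>2)"
  using assms unfolding frobenius_norm_sq_block by (simp add: frobenius_norm_sq sum_blocks2)

section \<open>The matrices of the two moduli\<close>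

lemma stack_rows_carrier:
  assumes "\<And>M. M \<in> set Ms \<Longrightarrow> dim_col M = q"
  shows "stack_rows q Ms \<in> carrier_mat (sum_list (map dim_row Ms)) q"
  using assms
proof (induction Ms)
  case (Cons M Ms)
  have "dim_col M = q" by (rule Cons.prems) simp
  then have "M \<in> carrier_mat (dim_row M) q" by (intro carrier_matI) simp_all
  moreover have "stack_rows q Ms \<in> carrier_mat (sum_list (map dim_row Ms)) q"
    by (rule Cons.IH) (use Cons.prems in simp)
  ultimately have "M @\<^sub>r stack_rows q Ms \<in> carrier_mat (dim_row M + sum_list (map dim_row Ms)) q"
    by (rule carrier_append_rows)
  then show ?case by (simp add: stack_rows_def)
qed (auto simp: stack_rows_def)

lemma euclid_norm_append:
  "(euclid_norm (v @\<^sub>v w))\<^sup>2 = (euclid_norm v)\<^sup>2 + (euclid_norm w)\<^sup>2"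
  unfolding euclid_norm_sq_scalar
  by (rule scalar_prod_append[of v "dim_vec v" w "dim_vec w"]) auto

lemma euclid_norm_stack_rows:
  assumes "\<And>M. M \<in> set Ms \<Longrightarrow> dim_col M = q" "x \<in> carrier_vec q"
  shows "(euclid_norm (stack_rows q Ms *\<^sub>v x))\<^sup>2 = (\<Sum>M\<leftarrow>Ms. (euclid_norm (M *\<^sub>v x))\<^sup>2)"
  using assms
proof (induction Ms)
  case Nil
  then show ?case by (simp add: stack_rows_def euclid_norm_sq)
next
  case (Cons M Ms)
  have "stack_rows q (M # Ms) *\<^sub>v x = (M *\<^sub>v x) @\<^sub>v (stack_rows q Ms *\<^sub>v x)"
  proof -
    have "dim_col M = q" by (rule Cons.prems) simp
    then have "M \<in> carrier_mat (dim_row M) q" by (intro carrier_matI) simp_all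
    moreover have "stack_rows q Ms \<in> carrier_mat (sum_list (map dim_row Ms)) q"
      by (rule stack_rows_carrier) (use Cons.prems in simp)
    ultimately have "(M @\<^sub>r stack_rows q Ms) *\<^sub>v x = (M *\<^sub>v x) @\<^sub>v (stack_rows q Ms *\<^sub>v x)"
      using Cons.prems(2) by (rule mat_mult_append)
    then show ?thesis by (simp add: stack_rows_def)
  qed
  then show ?case using Cons by (simp add: euclid_norm_append)
qed

lemma vec_cols_carrier [simp, intro]: "X \<in> carrier_mat p q \<Longrightarrow> vec_cols X \<in> carrier_vec (p * q)"
  by (auto simp: vec_cols_def)

lemma sum_mod_div:
  fixes f :: "nat \<Rightarrow> nat \<Rightarrow> 'a :: comm_monoid_add"
  shows "(\<Sum>s<p * q. f (s mod p) (s div p)) = (\<Sum>l<q. \<Sum>k<p. f k l)"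
proof -
  have "(\<Sum>s<p * q. f (s mod p) (s div p)) =
      (\<Sum>l<q. \<Sum>s\<in>{l * p..<l * p + p}. f (s mod p) (s div p))"
    using sum.nat_group[of "\<lambda>s. f (s mod p) (s div p)" p q] by (simp add: mult.commute)
  also have "\<dots> = (\<Sum>l<q. \<Sum>k<p. f k l)"
  proof (rule sum.cong[OF refl])
    fix l
    have "(\<Sum>s\<in>{l * p..<l * p + p}. f (s mod p) (s div p)) =
        (\<Sum>k\<in>{0..<p}. f ((k + l * p) mod p) ((k + l * p) div p))"
      using sum.shift_bounds_nat_ivl[of "\<lambda>s. f (s mod p) (s div p)" 0 "l * p" p] by (simp add: add.commute)
    also have "\<dots> = (\<Sum>k<p. f k l)"
      by (intro sum.cong) auto
    finally show "(\<Sum>s\<in>{l * p..<l * p + p}. f (s mod p) (s div p)) = (\<Sum>k<p. f k l)" .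
  qed
  finally show ?thesis .
qed

lemma euclid_norm_vec_cols: "euclid_norm (vec_cols X) = frobenius_norm X"
proof -
  have "(euclid_norm (vec_cols X))\<^sup>2 =
      (\<Sum>r<dim_row X * dim_col X. (X $$ (r mod dim_row X, r div dim_row X))\<^sup>2)"
    by (simp add: euclid_norm_sq vec_cols_def)
  also have "\<dots> = (\<Sum>l<dim_col X. \<Sum>k<dim_row X. (X $$ (k, l))\<^sup>2)"
    by (rule sum_mod_div)
  also have "\<dots> = (frobenius_norm X)\<^sup>2"
    unfolding frobenius_norm_sq by (rule sum.swap)
  finally show ?thesis by (simp add: power2_eq_iff_nonneg)
qed

lemma mod_div_less:
  assumes "r < p * (q :: nat)"
  shows "r mod p < p" "r div p < q"
proof -
  have "0 < p" using assms by (cases p) auto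
  then show "r mod p < p" by simp
  show "r div p < q" using assms by (simp add: less_mult_imp_div_less mult.commute)
qed

lemma kron_mult_vec_cols:
  assumes A: "A \<in> carrier_mat q' q" and B: "B \<in> carrier_mat p' p" and X: "X \<in> carrier_mat p q"
  shows "(A \<otimes>\<^sub>K B) *\<^sub>v vec_cols X = vec_cols (B * X * A\<^sup>T)"
proof (rule eq_vecI)
  fix r assume "r < dim_vec (vec_cols (B * X * A\<^sup>T))"
  then have r: "r < p' * q'" using A B X by (simp add: vec_cols_def)
  note rr = mod_div_less[OF r]
  have "((A \<otimes>\<^sub>K B) *\<^sub>v vec_cols X) $ r =
      (\<Sum>s<p * q. A $$ (r div p', s div p) * B $$ (r mod p', s mod p) * X $$ (s mod p, s div p))"
    using A B X r
    by (auto simp: kron_def vec_cols_def scalar_prod_def mult.commute lessThan_atLeast0 intro!: sum.cong)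
  also have "\<dots> = (\<Sum>l<q. \<Sum>k<p. A $$ (r div p', l) * B $$ (r mod p', k) * X $$ (k, l))"
    by (rule sum_mod_div[of "\<lambda>k l. A $$ (r div p', l) * B $$ (r mod p', k) * X $$ (k, l)"])
  also have "\<dots> = (\<Sum>l<q. (B * X) $$ (r mod p', l) * A $$ (r div p', l))"
    using A B X rr
    by (auto simp: scalar_prod_def lessThan_atLeast0 sum_distrib_right sum_distrib_left mult_ac intro!: sum.cong)
  also have "\<dots> = row (B * X) (r mod p') \<bullet> row A (r div p')"
    using A B X rr by (simp add: scalar_prod_def[of "row (B * X) _"] lessThan_atLeast0 del: row_mult)
  also have "row A (r div p') = col (A\<^sup>T) (r div p')"
    using A rr by simp
  also have "row (B * X) (r mod p') \<bullet> col (A\<^sup>T) (r div p') = (B * X * A\<^sup>T) $$ (r mod p', r div p')"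
    by (rule index_mult_mat(1)[symmetric]) (use A B X rr in auto)
  also have "\<dots> = vec_cols (B * X * A\<^sup>T) $ r"
    using A B X r by (simp add: vec_cols_def)
  finally show "((A \<otimes>\<^sub>K B) *\<^sub>v vec_cols X) $ r = vec_cols (B * X * A\<^sup>T) $ r" .
qed (use A B X in \<open>auto simp: kron_def vec_cols_def\<close>)

lemma vec_cols_add:
  assumes "X \<in> carrier_mat p q" "Y \<in> carrier_mat p q"
  shows "vec_cols X + vec_cols Y = vec_cols (X + Y)"
  using assms by (intro eq_vecI) (auto simp: vec_cols_def mod_div_less)

lemma vec_cols_minus:
  assumes "X \<in> carrier_mat p q" "Y \<in> carrier_mat p q"
  shows "vec_cols X - vec_cols Y = vec_cols (X - Y)"
  using assms by (intro eq_vecI) (auto simp: vec_cols_def mod_div_less)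

lemma kron_carrier [simp]:
  "A \<in> carrier_mat a b \<Longrightarrow> B \<in> carrier_mat c d \<Longrightarrow> A \<otimes>\<^sub>K B \<in> carrier_mat (a * c) (b * d)"
  by (auto simp: kron_def)

text \<open>The two block rows are the vectorized Sylvester residuals of the pair \<open>(X, Y)\<close> for the
  coefficients \<open>(B\<^sub>i, C\<^sub>i)\<close> and for their transposes.\<close>

lemma euclid_norm_G_off:
  assumes B: "\<And>i. i < m \<Longrightarrow> B i \<in> carrier_mat p p" and C: "\<And>i. i < m \<Longrightarrow> C i \<in> carrier_mat q q"
    and X: "X \<in> carrier_mat p q" and Y: "Y \<in> carrier_mat p q"
  shows "(euclid_norm (G_off m p q B C *\<^sub>v (vec_cols X @\<^sub>v vec_cols Y)))\<^sup>2 =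
    (\<Sum>i<m. (frobenius_norm (B i * X + Y * C i))\<^sup>2 + (frobenius_norm ((B i)\<^sup>T * X + Y * (C i)\<^sup>T))\<^sup>2)"
proof -
  let ?M = "\<lambda>i. four_block_mat (1\<^sub>m q \<otimes>\<^sub>K B i) ((C i)\<^sup>T \<otimes>\<^sub>K 1\<^sub>m p) (1\<^sub>m q \<otimes>\<^sub>K (B i)\<^sup>T) (C i \<otimes>\<^sub>K 1\<^sub>m p)"
  have carr: "1\<^sub>m q \<otimes>\<^sub>K B i \<in> carrier_mat (q * p) (p * q)" "(C i)\<^sup>T \<otimes>\<^sub>K 1\<^sub>m p \<in> carrier_mat (q * p) (p * q)"
    "1\<^sub>m q \<otimes>\<^sub>K (B i)\<^sup>T \<in> carrier_mat (q * p) (p * q)" "C i \<otimes>\<^sub>K 1\<^sub>m p \<in> carrier_mat (q * p) (p * q)"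
    if "i < m" for i
    using B[OF that] C[OF that] by (auto simp: kron_def)
  have dims: "dim_col M = 2 * p * q" if M: "M \<in> set (map ?M [0..<m])" for M
  proof -
    obtain i where i: "i < m" "M = ?M i" using M by auto
    have "dim_row (B i) = p" "dim_col (B i) = p" "dim_row (C i) = q" "dim_col (C i) = q"
      using B[OF i(1)] C[OF i(1)] by auto
    then have "dim_col M = q * p + q * p" unfolding i(2) kron_def by simp
    also have "\<dots> = 2 * p * q" by (simp only: mult_2 mult.commute[of q p] distrib_right)
    finally show ?thesis .
  qed
  have x: "vec_cols X @\<^sub>v vec_cols Y \<in> carrier_vec (2 * p * q)"
  proof -
    have "vec_cols X @\<^sub>v vec_cols Y \<in> carrier_vec (p * q + p * q)"
      by (intro append_carrier_vec vec_cols_carrier X Y)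
    also have "p * q + p * q = 2 * p * q" by (simp only: mult_2 distrib_right)
    finally show ?thesis .
  qed
  have one: "(euclid_norm (?M i *\<^sub>v (vec_cols X @\<^sub>v vec_cols Y)))\<^sup>2 =
      (frobenius_norm (B i * X + Y * C i))\<^sup>2 + (frobenius_norm ((B i)\<^sup>T * X + Y * (C i)\<^sup>T))\<^sup>2" if i: "i < m" for i
  proof -
    note b = B[OF i] and c = C[OF i]
    have "?M i *\<^sub>v (vec_cols X @\<^sub>v vec_cols Y) =
       ((1\<^sub>m q \<otimes>\<^sub>K B i) *\<^sub>v vec_cols X + ((C i)\<^sup>T \<otimes>\<^sub>K 1\<^sub>m p) *\<^sub>v vec_cols Y) @\<^sub>v
       ((1\<^sub>m q \<otimes>\<^sub>K (B i)\<^sup>T) *\<^sub>v vec_cols X + (C i \<otimes>\<^sub>K 1\<^sub>m p) *\<^sub>v vec_cols Y)"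
      by (rule four_block_mat_mult_vec[OF carr[OF i]]) (use X Y in auto)
    also have "(1\<^sub>m q \<otimes>\<^sub>K B i) *\<^sub>v vec_cols X = vec_cols (B i * X)"
      using b X by (subst kron_mult_vec_cols) (auto simp: transpose_one)
    also have "((C i)\<^sup>T \<otimes>\<^sub>K 1\<^sub>m p) *\<^sub>v vec_cols Y = vec_cols (Y * C i)"
      using c Y by (subst kron_mult_vec_cols[of _ q q]) auto
    also have "(1\<^sub>m q \<otimes>\<^sub>K (B i)\<^sup>T) *\<^sub>v vec_cols X = vec_cols ((B i)\<^sup>T * X)"
      using b X by (subst kron_mult_vec_cols[of _ q q _ p p]) (auto simp: transpose_one)
    also have "(C i \<otimes>\<^sub>K 1\<^sub>m p) *\<^sub>v vec_cols Y = vec_cols (Y * (C i)\<^sup>T)"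
      using c Y by (subst kron_mult_vec_cols[of _ q q]) auto
    finally show ?thesis
      using b c X Y by (simp add: vec_cols_add[of _ p q] euclid_norm_append euclid_norm_vec_cols)
  qed
  have "(euclid_norm (G_off m p q B C *\<^sub>v (vec_cols X @\<^sub>v vec_cols Y)))\<^sup>2 =
      (\<Sum>M\<leftarrow>map ?M [0..<m]. (euclid_norm (M *\<^sub>v (vec_cols X @\<^sub>v vec_cols Y)))\<^sup>2)"
    unfolding G_off_def by (rule euclid_norm_stack_rows[OF dims x])
  also have "\<dots> = (\<Sum>i<m. (euclid_norm (?M i *\<^sub>v (vec_cols X @\<^sub>v vec_cols Y)))\<^sup>2)"
    by (simp add: comp_def sum_list_distinct_conv_sum_set lessThan_atLeast0)
  also have "\<dots> = (\<Sum>i<m. (frobenius_norm (B i * X + Y * C i))\<^sup>2 + (frobenius_norm ((B i)\<^sup>T * X + Y * (C i)\<^sup>T))\<^sup>2)"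
    by (intro sum.cong refl one) auto
  finally show ?thesis .
qed

lemma sigma_min_G_off_le:
  assumes B: "\<And>i. i < m \<Longrightarrow> B i \<in> carrier_mat p p" and C: "\<And>i. i < m \<Longrightarrow> C i \<in> carrier_mat q q"
    and X: "X \<in> carrier_mat p q" and Y: "Y \<in> carrier_mat p q" and pq: "0 < p" "0 < q"
    and \<omega>: "0 \<le> \<omega>" "\<omega> \<le> sigma_min (G_off m p q B C)"
  shows "\<omega>\<^sup>2 * ((frobenius_norm X)\<^sup>2 + (frobenius_norm Y)\<^sup>2) \<le>
    (\<Sum>i<m. (frobenius_norm (B i * X + Y * C i))\<^sup>2 + (frobenius_norm ((B i)\<^sup>T * X + Y * (C i)\<^sup>T))\<^sup>2)"
proof -
  let ?M = "\<lambda>i. four_block_mat (1\<^sub>m q \<otimes>\<^sub>K B i) ((C i)\<^sup>T \<otimes>\<^sub>K 1\<^sub>m p) (1\<^sub>m q \<otimes>\<^sub>K (B i)\<^sup>T) (C i \<otimes>\<^sub>K 1\<^sub>m p)"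
  let ?x = "vec_cols X @\<^sub>v vec_cols Y" and ?G = "G_off m p q B C"
  have dims: "dim_col M = 2 * p * q" if M: "M \<in> set (map ?M [0..<m])" for M
  proof -
    obtain i where i: "i < m" "M = ?M i" using M by auto
    have "dim_row (B i) = p" "dim_col (B i) = p" "dim_row (C i) = q" "dim_col (C i) = q"
      using B[OF i(1)] C[OF i(1)] by auto
    then have "dim_col M = q * p + q * p" unfolding i(2) kron_def by simp
    also have "\<dots> = 2 * p * q" by (simp only: mult_2 mult.commute[of q p] distrib_right)
    finally show ?thesis .
  qed
  have G: "?G \<in> carrier_mat (sum_list (map dim_row (map ?M [0..<m]))) (2 * p * q)"
    unfolding G_off_def by (rule stack_rows_carrier[OF dims])
  have x: "?x \<in> carrier_vec (2 * p * q)"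
  proof -
    have "vec_cols X @\<^sub>v vec_cols Y \<in> carrier_vec (p * q + p * q)"
      by (intro append_carrier_vec vec_cols_carrier X Y)
    also have "p * q + p * q = 2 * p * q" by (simp only: mult_2 distrib_right)
    finally show ?thesis .
  qed
  have "\<omega> * euclid_norm ?x \<le> sigma_min ?G * euclid_norm ?x"
    by (rule mult_right_mono[OF \<omega>(2)]) simp
  also have "\<dots> \<le> euclid_norm (?G *\<^sub>v ?x)"
    by (rule sigma_min_mult_le[OF G _ x]) (use pq in simp)
  finally have "(\<omega> * euclid_norm ?x)\<^sup>2 \<le> (euclid_norm (?G *\<^sub>v ?x))\<^sup>2"
    by (rule power_mono) (use \<omega> in simp)
  also have "\<dots> = (\<Sum>i<m. (frobenius_norm (B i * X + Y * C i))\<^sup>2 + (frobenius_norm ((B i)\<^sup>T * X + Y * (C i)\<^sup>T))\<^sup>2)"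
    by (rule euclid_norm_G_off[OF B C X Y])
  finally show ?thesis
    by (simp add: power_mult_distrib euclid_norm_append euclid_norm_vec_cols)
qed

lemma perfect_shuffle_carrier: "perfect_shuffle q \<in> carrier_mat (q * q) (q * q)"
  by (simp add: perfect_shuffle_def)

lemma G_diag_carrier:
  assumes B: "\<And>i. i < m \<Longrightarrow> B i \<in> carrier_mat q q"
  obtains r where "G_diag m q B \<in> carrier_mat r (q * q)"
proof -
  have "dim_col M = q * q"
    if "M \<in> set (map (\<lambda>i. 1\<^sub>m q \<otimes>\<^sub>K B i - ((B i)\<^sup>T \<otimes>\<^sub>K 1\<^sub>m q) * perfect_shuffle q) [0..<m])" for M
    using that by (auto simp: perfect_shuffle_def)
  from stack_rows_carrier[OF this] show thesis by (rule that[unfolded G_diag_def])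
qed

text \<open>The perfect shuffle turns \<open>vec Z\<close> into \<open>vec Z\<^sup>T\<close>, so the second term is \<open>vec (Z\<^sup>T B\<^sub>i)\<close>.\<close>

lemma euclid_norm_G_diag:
  assumes B: "\<And>i. i < m \<Longrightarrow> B i \<in> carrier_mat q q" and Z: "Z \<in> carrier_mat q q"
  shows "(euclid_norm (G_diag m q B *\<^sub>v vec_cols Z))\<^sup>2 =
    (\<Sum>i<m. (frobenius_norm (B i * Z - Z\<^sup>T * B i))\<^sup>2)"
proof -
  let ?M = "\<lambda>i. 1\<^sub>m q \<otimes>\<^sub>K B i - ((B i)\<^sup>T \<otimes>\<^sub>K 1\<^sub>m q) * perfect_shuffle q"
  have dims: "dim_col M = q * q" if M: "M \<in> set (map ?M [0..<m])" for M
    using M by (auto simp: perfect_shuffle_def)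
  have z: "vec_cols Z \<in> carrier_vec (q * q)" using Z by auto
  have sh: "perfect_shuffle q *\<^sub>v vec_cols Z = vec_cols (Z\<^sup>T)"
    using perfect_shuffle_vec_cols[of "Z\<^sup>T" q] Z by simp
  have one: "euclid_norm (?M i *\<^sub>v vec_cols Z) = frobenius_norm (B i * Z - Z\<^sup>T * B i)" if i: "i < m" for i
  proof -
    note b = B[OF i]
    have K: "(B i)\<^sup>T \<otimes>\<^sub>K 1\<^sub>m q \<in> carrier_mat (q * q) (q * q)" "1\<^sub>m q \<otimes>\<^sub>K B i \<in> carrier_mat (q * q) (q * q)"
      using b by auto
    have "?M i *\<^sub>v vec_cols Z = (1\<^sub>m q \<otimes>\<^sub>K B i) *\<^sub>v vec_cols Z - ((B i)\<^sup>T \<otimes>\<^sub>K 1\<^sub>m q) *\<^sub>v (perfect_shuffle q *\<^sub>v vec_cols Z)"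
      using K z perfect_shuffle_carrier[of q]
      by (subst minus_mult_distrib_mat_vec[of _ "q * q" "q * q"]) (auto simp: assoc_mult_mat_vec[of _ "q * q" "q * q" _ "q * q"])
    also have "\<dots> = vec_cols (B i * Z) - vec_cols (Z\<^sup>T * B i)"
      unfolding sh using b Z by (subst (1 2) kron_mult_vec_cols[of _ q q _ q q]) (auto simp: transpose_one)
    also have "\<dots> = vec_cols (B i * Z - Z\<^sup>T * B i)"
      using b Z by (intro vec_cols_minus[of _ q q]) auto
    finally show ?thesis by (simp add: euclid_norm_vec_cols)
  qed
  have "(euclid_norm (G_diag m q B *\<^sub>v vec_cols Z))\<^sup>2 =
      (\<Sum>M\<leftarrow>map ?M [0..<m]. (euclid_norm (M *\<^sub>v vec_cols Z))\<^sup>2)"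
    unfolding G_diag_def by (rule euclid_norm_stack_rows[OF dims z])
  also have "\<dots> = (\<Sum>i<m. (euclid_norm (?M i *\<^sub>v vec_cols Z))\<^sup>2)"
    by (simp add: comp_def sum_list_distinct_conv_sum_set lessThan_atLeast0)
  also have "\<dots> = (\<Sum>i<m. (frobenius_norm (B i * Z - Z\<^sup>T * B i))\<^sup>2)"
    using one by simp
  finally show ?thesis .
qed

lemma vec_cols_surj:
  assumes "x \<in> carrier_vec (q * q)"
  obtains X where "X \<in> carrier_mat q q" "x = vec_cols X"
proof
  let ?X = "mat q q (\<lambda>(i, j). x $ (i + j * q))"
  show "?X \<in> carrier_mat q q" by simp
  show "x = vec_cols ?X"
    using assms by (intro eq_vecI) (auto simp: vec_cols_def mod_div_less)
qed

lemma vec_cols_one_scalar_prod: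
  assumes "X \<in> carrier_mat q q"
  shows "vec_cols (1\<^sub>m q) \<bullet> vec_cols X = (\<Sum>k<q. X $$ (k, k))"
proof -
  have "vec_cols (1\<^sub>m q) \<bullet> vec_cols X =
      (\<Sum>s<q * q. (if s mod q = s div q then 1 else 0) * X $$ (s mod q, s div q))"
    using assms by (auto simp: scalar_prod_def vec_cols_def lessThan_atLeast0 mod_div_less intro!: sum.cong)
  also have "\<dots> = (\<Sum>l<q. \<Sum>k<q. (if k = l then 1 else 0) * X $$ (k, l))"
    by (rule sum_mod_div[of "\<lambda>k l. (if k = l then 1 else 0) * X $$ (k, l)"])
  also have "\<dots> = (\<Sum>k<q. X $$ (k, k))"
    by (intro sum.cong refl) (simp add: if_distrib[of "\<lambda>c. c * _"] cong: if_cong)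
  finally show ?thesis .
qed

text \<open>The kernel is spanned by the identity, and \<open>Z - \<mu> I\<close> is the component of \<open>Z\<close> orthogonal to it.\<close>

lemma sigma_min_nonzero_G_diag_le:
  assumes B: "\<And>i. i < m \<Longrightarrow> B i \<in> carrier_mat q q" and Z: "Z \<in> carrier_mat q q"
    and dim: "N_dim q m B = 1" and q: "0 < q"
    and \<omega>: "0 \<le> \<omega>" "\<omega> \<le> sigma_min_nonzero (G_diag m q B)"
    and \<mu>: "\<mu> = (\<Sum>k<q. Z $$ (k, k)) / real q"
  shows "\<omega>\<^sup>2 * (frobenius_norm (Z - \<mu> \<cdot>\<^sub>m 1\<^sub>m q))\<^sup>2 \<le> (\<Sum>i<m. (frobenius_norm (B i * Z - Z\<^sup>T * B i))\<^sup>2)"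
proof -
  let ?G = "G_diag m q B" and ?Y = "Z - \<mu> \<cdot>\<^sub>m 1\<^sub>m q"
  let ?v = "vec_cols (1\<^sub>m q :: real mat)"
  obtain r where G: "?G \<in> carrier_mat r (q * q)"
    using G_diag_carrier[where B = B and m = m and q = q] B by blast
  have v: "?v \<in> carrier_vec (q * q)" by auto
  have zero_iff: "?G *\<^sub>v vec_cols X = 0\<^sub>v r \<longleftrightarrow> X \<in> N_space q m B" if X: "X \<in> carrier_mat q q" for X
  proof -
    have "?G *\<^sub>v vec_cols X = 0\<^sub>v r \<longleftrightarrow> (euclid_norm (?G *\<^sub>v vec_cols X))\<^sup>2 = 0"
      using euclid_norm_eq_0_iff[OF mult_mat_vec_carrier[OF G, of "vec_cols X"]] X by simp
    also have "(euclid_norm (?G *\<^sub>v vec_cols X))\<^sup>2 = (\<Sum>i<m. (frobenius_norm (B i * X - X\<^sup>T * B i))\<^sup>2)"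
      by (rule euclid_norm_G_diag[OF B X])
    also have "\<dots> = 0 \<longleftrightarrow> (\<forall>i<m. frobenius_norm (B i * X - X\<^sup>T * B i) = 0)"
      by (subst sum_nonneg_eq_0_iff) auto
    also have "\<dots> \<longleftrightarrow> (\<forall>i<m. B i * X - X\<^sup>T * B i = 0\<^sub>m q q)"
    proof (intro all_cong1 imp_cong refl)
      fix i assume "i < m"
      have "B i * X - X\<^sup>T * B i \<in> carrier_mat q q" using B[OF \<open>i < m\<close>] X by auto
      then show "frobenius_norm (B i * X - X\<^sup>T * B i) = 0 \<longleftrightarrow> B i * X - X\<^sup>T * B i = 0\<^sub>m q q"
        by (rule frobenius_norm_eq_0_iff)
    qed
    finally show ?thesis using X by (simp add: N_space_def)
  qed
  have Y: "?Y \<in> carrier_mat q q" using Z by auto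
  have Gv: "?G *\<^sub>v ?v = 0\<^sub>v r" using zero_iff one_in_N_space[OF B] by simp
  have vY: "?v \<bullet> vec_cols ?Y = 0"
    unfolding vec_cols_one_scalar_prod[OF Y] using Z q by (simp add: \<mu> sum_subtractf)
  have ker: "x = 0\<^sub>v (q * q)" if x: "x \<in> carrier_vec (q * q)" "?G *\<^sub>v x = 0\<^sub>v r" "?v \<bullet> x = 0" for x
  proof -
    obtain X where X: "X \<in> carrier_mat q q" "x = vec_cols X" using vec_cols_surj x(1) by blast
    then have "X \<in> N_space q m B" using x zero_iff by simp
    then obtain c where c: "X = c \<cdot>\<^sub>m 1\<^sub>m q" using N_space_scalar[OF B dim q] by blast
    have "c * real q = 0" using x(3) unfolding X(2) vec_cols_one_scalar_prod[OF X(1)] by (auto simp: c)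
    then have "c = 0" using q by simp
    then show ?thesis unfolding X(2) c by (intro eq_vecI) (auto simp: vec_cols_def mod_div_less)
  qed
  have "\<omega> * euclid_norm (vec_cols ?Y) \<le> sigma_min_nonzero ?G * euclid_norm (vec_cols ?Y)"
    by (rule mult_right_mono[OF \<omega>(2)]) simp
  also have "\<dots> \<le> euclid_norm (?G *\<^sub>v vec_cols ?Y)"
    by (rule sigma_min_nonzero_mult_le[OF G v Gv ker _ vY]) (use Y in auto)
  finally have "(\<omega> * euclid_norm (vec_cols ?Y))\<^sup>2 \<le> (euclid_norm (?G *\<^sub>v vec_cols ?Y))\<^sup>2"
    by (rule power_mono) (use \<omega> in simp)
  also have "?G *\<^sub>v vec_cols ?Y = ?G *\<^sub>v vec_cols Z"
  proof -
    have "vec_cols ?Y = vec_cols Z - \<mu> \<cdot>\<^sub>v ?v"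
      using Z by (intro eq_vecI) (auto simp: vec_cols_def mod_div_less)
    then have "?G *\<^sub>v vec_cols ?Y = ?G *\<^sub>v vec_cols Z - \<mu> \<cdot>\<^sub>v (?G *\<^sub>v ?v)"
      using G Z v by (simp add: mult_minus_distrib_mat_vec[of _ r "q * q"] mult_mat_vec[of _ r "q * q"])
    then show ?thesis unfolding Gv using G Z by auto
  qed
  also have "(euclid_norm (?G *\<^sub>v vec_cols Z))\<^sup>2 = (\<Sum>i<m. (frobenius_norm (B i * Z - Z\<^sup>T * B i))\<^sup>2)"
    by (rule euclid_norm_G_diag[OF B Z])
  finally show ?thesis by (simp add: power_mult_distrib euclid_norm_vec_cols)
qed

section \<open>The mean eigenvalue of a nearly scalar matrix\<close>

text \<open>A Schur form is similar to \<open>A\<close> and has the eigenvalues on its diagonal, and the trace is invariant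
  under similarity.\<close>

lemma sum_list_diag_similar:
  fixes A :: "complex mat"
  assumes A: "A \<in> carrier_mat q q" and cp: "char_poly A = (\<Prod>a\<leftarrow>es. [:- a, 1:])"
  shows "sum_list es = (\<Sum>i<q. A $$ (i, i))"
proof -
  obtain B P R where sd: "schur_decomposition A es = (B, P, R)" by (cases "schur_decomposition A es")
  from schur_decomposition[OF A cp sd] have sim: "similar_mat_wit A B P R" and es: "diag_mat B = es" by auto
  from similar_mat_witD2[OF A sim] have B: "B \<in> carrier_mat q q" "P \<in> carrier_mat q q" "R \<in> carrier_mat q q"
    and AB: "A = P * B * R" and RP: "R * P = 1\<^sub>m q" by auto
  have tr: "(\<Sum>i<q. (X * Y) $$ (i, i)) = (\<Sum>i<q. (Y * X) $$ (i, i))"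
    if "X \<in> carrier_mat q q" "Y \<in> carrier_mat q q" for X Y :: "complex mat"
    using that by (simp add: scalar_prod_def lessThan_atLeast0) (subst sum.swap, simp add: mult.commute)
  have "(\<Sum>i<q. A $$ (i, i)) = (\<Sum>i<q. (R * (P * B)) $$ (i, i))"
    unfolding AB using B by (intro tr) auto
  also have "R * (P * B) = B"
    using assoc_mult_mat[OF B(3) B(2) B(1)] left_mult_one_mat[OF B(1)] by (simp add: RP)
  also have "(\<Sum>i<q. B $$ (i, i)) = sum_list es"
    unfolding es[symmetric] diag_mat_def using B by (simp add: sum_list_distinct_conv_sum_set lessThan_atLeast0)
  finally show ?thesis by simp
qed

text \<open>Eigenvectors \<open>x, y\<close> of different eigenvalues give orthogonal vectors \<open>x\<close> and
  \<open>w = y - c x\<close>, \<open>c = \<langle>y, x\<rangle> / |x|\<^sup>2\<close>, whose Rayleigh quotients are the two eigenvalues. Their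
  difference is the inner product of \<open>A\<close> with \<open>u u\<^sup>* - v v\<^sup>*\<close>, of norm \<open>\<surd>2\<close>, for the normalized vectors.\<close>

lemma eigenvalue_distance_le:
  fixes A :: "complex mat"
  assumes A: "A \<in> carrier_mat q q" and x: "eigenvector A x e1" and y: "eigenvector A y e2" and ne: "e1 \<noteq> e2"
  shows "(cmod (e1 - e2))\<^sup>2 \<le> 2 * (\<Sum>i<q. \<Sum>j<q. (cmod (A $$ (i, j)))\<^sup>2)"
proof -
  have xc: "x \<in> carrier_vec q" "x \<noteq> 0\<^sub>v q" and yc: "y \<in> carrier_vec q" "y \<noteq> 0\<^sub>v q"
    using x y A by (auto simp: eigenvector_def)
  define ip where "ip f h = (\<Sum>i<q. f i * cnj (h i))" for f h :: "nat \<Rightarrow> complex"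
  define Af where "Af f i = (\<Sum>j<q. A $$ (i, j) * f j)" for f :: "nat \<Rightarrow> complex" and i
  define X where "X i = x $ i" for i
  define c where "c = ip (\<lambda>i. y $ i) X / ip X X"
  define W where "W i = y $ i - c * X i" for i
  have AX: "Af X i = e1 * X i" if "i < q" for i
  proof -
    have "(A *\<^sub>v x) $ i = (e1 \<cdot>\<^sub>v x) $ i" using x by (simp add: eigenvector_def)
    then show ?thesis using that A xc by (simp add: Af_def X_def scalar_prod_def lessThan_atLeast0)
  qed
  have Ay: "Af (\<lambda>i. y $ i) i = e2 * y $ i" if "i < q" for i
  proof -
    have "(A *\<^sub>v y) $ i = (e2 \<cdot>\<^sub>v y) $ i" using y by (simp add: eigenvector_def)
    then show ?thesis using that A yc by (simp add: Af_def scalar_prod_def lessThan_atLeast0)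
  qed
  have AW: "Af W i = e2 * W i + (e2 - e1) * c * X i" if "i < q" for i
  proof -
    have "Af W i = Af (\<lambda>i. y $ i) i - c * Af X i"
      by (simp add: Af_def W_def algebra_simps sum_subtractf sum_distrib_left)
    then show ?thesis using AX[OF that] Ay[OF that] by (simp add: W_def algebra_simps)
  qed
  define nx nw where "nx = (\<Sum>i<q. (cmod (X i))\<^sup>2)" and "nw = (\<Sum>i<q. (cmod (W i))\<^sup>2)"
  have ipn: "ip f f = of_real (\<Sum>i<q. (cmod (f i))\<^sup>2)" for f
    by (simp add: ip_def complex_norm_square[symmetric])
  have nx: "nx > 0"
  proof -
    obtain i where "i < q" "x $ i \<noteq> 0" using xc by (metis eq_vecI carrier_vecD index_zero_vec)
    then have "0 < (cmod (X i))\<^sup>2" "(cmod (X i))\<^sup>2 \<le> nx"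
      unfolding nx_def by (auto simp: X_def intro!: member_le_sum)
    then show ?thesis by (rule less_le_trans)
  qed
  have WX: "ip W X = 0"
  proof -
    have "ip W X = ip (\<lambda>i. y $ i) X - c * ip X X"
      by (simp add: ip_def W_def algebra_simps sum_subtractf sum_distrib_left)
    then show ?thesis using nx by (simp add: c_def ipn nx_def[symmetric])
  qed
  then have XW: "ip X W = 0"
  proof -
    have "ip X W = cnj (ip W X)" by (simp add: ip_def mult.commute)
    then show ?thesis using WX by simp
  qed
  have nw: "nw > 0"
  proof (rule ccontr)
    assume "\<not> nw > 0"
    then have "nw = 0" unfolding nw_def by (metis less_le sum_nonneg zero_le_power2)
    then have W0: "W i = 0" if "i < q" for i using that unfolding nw_def by (simp add: sum_nonneg_eq_0_iff)
    then have "Af W i = 0" for i unfolding Af_def by simp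
    then have "c * X i = 0" if "i < q" for i using AW[OF that] W0[OF that] ne by simp
    then have "y $ i = 0" if "i < q" for i using W0[OF that] that by (simp add: W_def)
    then show False using yc by (metis eq_vecI carrier_vecD index_zero_vec)
  qed
  have R1: "(\<Sum>i<q. \<Sum>j<q. A $$ (i, j) * (X j * cnj (X i))) = e1 * nx"
  proof -
    have "(\<Sum>i<q. \<Sum>j<q. A $$ (i, j) * (X j * cnj (X i))) = (\<Sum>i<q. Af X i * cnj (X i))"
      by (simp add: Af_def sum_distrib_right mult.assoc)
    also have "\<dots> = e1 * ip X X" using AX by (simp add: ip_def sum_distrib_left mult.assoc)
    finally show ?thesis by (simp add: ipn nx_def)
  qed
  have R2: "(\<Sum>i<q. \<Sum>j<q. A $$ (i, j) * (W j * cnj (W i))) = e2 * nw"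
  proof -
    have "(\<Sum>i<q. \<Sum>j<q. A $$ (i, j) * (W j * cnj (W i))) = (\<Sum>i<q. Af W i * cnj (W i))"
      by (simp add: Af_def sum_distrib_right mult.assoc)
    also have "\<dots> = e2 * ip W W + (e2 - e1) * c * ip X W"
      using AW by (simp add: ip_def sum_distrib_left distrib_right sum.distrib mult.assoc)
    finally show ?thesis using XW by (simp add: ipn nw_def)
  qed
  define G where "G i j = of_real nw * (X j * cnj (X i)) - of_real nx * (W j * cnj (W i))" for i j
  have "(e1 - e2) * of_real (nx * nw) = (\<Sum>i<q. \<Sum>j<q. A $$ (i, j) * G i j)"
  proof -
    have "(\<Sum>i<q. \<Sum>j<q. A $$ (i, j) * G i j) =
      of_real nw * (\<Sum>i<q. \<Sum>j<q. A $$ (i, j) * (X j * cnj (X i))) -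
      of_real nx * (\<Sum>i<q. \<Sum>j<q. A $$ (i, j) * (W j * cnj (W i)))"
      unfolding sum_distrib_left sum_subtractf[symmetric] by (simp add: G_def algebra_simps)
    then show ?thesis unfolding R1 R2 by (simp add: algebra_simps)
  qed
  then have eq: "(e1 - e2) * of_real (nx * nw) = (\<Sum>p\<in>{..<q} \<times> {..<q}. A $$ p * G (fst p) (snd p))"
    by (simp add: sum.cartesian_product case_prod_unfold)
  have "cmod (e1 - e2) * (nx * nw) = cmod ((e1 - e2) * of_real (nx * nw))"
    unfolding norm_mult norm_of_real using nx nw by simp
  also have "\<dots> = cmod (\<Sum>p\<in>{..<q} \<times> {..<q}. A $$ p * G (fst p) (snd p))" unfolding eq ..
  also have "\<dots> \<le> (\<Sum>p\<in>{..<q} \<times> {..<q}. \<bar>cmod (A $$ p)\<bar> * \<bar>cmod (G (fst p) (snd p))\<bar>)"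
    by (rule order_trans[OF norm_sum]) (simp add: norm_mult)
  also have "\<dots> \<le> L2_set (\<lambda>p. cmod (A $$ p)) ({..<q} \<times> {..<q}) * L2_set (\<lambda>p. cmod (G (fst p) (snd p))) ({..<q} \<times> {..<q})"
    by (rule L2_set_mult_ineq)
  finally have "(cmod (e1 - e2) * (nx * nw))\<^sup>2 \<le>
      (L2_set (\<lambda>p. cmod (A $$ p)) ({..<q} \<times> {..<q}) * L2_set (\<lambda>p. cmod (G (fst p) (snd p))) ({..<q} \<times> {..<q}))\<^sup>2"
    by (rule power_mono) (use nx nw in auto)
  also have "\<dots> = (\<Sum>i<q. \<Sum>j<q. (cmod (A $$ (i, j)))\<^sup>2) * (\<Sum>i<q. \<Sum>j<q. (cmod (G i j))\<^sup>2)"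
    by (simp add: L2_set_def power_mult_distrib sum_nonneg sum.cartesian_product case_prod_unfold)
  also have "(\<Sum>i<q. \<Sum>j<q. (cmod (G i j))\<^sup>2) = 2 * (nx * nw)\<^sup>2"
  proof -
    have prod: "(\<Sum>i<q. \<Sum>j<q. f j * h i) = sum f {..<q} * sum h {..<q}" for f h :: "nat \<Rightarrow> complex"
      unfolding sum_product by (rule sum.swap)
    have "complex_of_real (\<Sum>i<q. \<Sum>j<q. (cmod (G i j))\<^sup>2) = (\<Sum>i<q. \<Sum>j<q. G i j * cnj (G i j))"
      by (simp add: complex_norm_square[symmetric])
    also have "\<dots> = (\<Sum>i<q. \<Sum>j<q. of_real nw * of_real nw * ((X j * cnj (X j)) * (X i * cnj (X i)))
        + of_real nx * of_real nx * ((W j * cnj (W j)) * (W i * cnj (W i)))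
        - of_real nw * of_real nx * ((X j * cnj (W j)) * (W i * cnj (X i)))
        - of_real nw * of_real nx * ((W j * cnj (X j)) * (X i * cnj (W i))))"
      by (intro sum.cong refl) (simp add: G_def algebra_simps)
    also have "\<dots> = of_real nw * of_real nw * (ip X X * ip X X) + of_real nx * of_real nx * (ip W W * ip W W)
        - of_real nw * of_real nx * (ip X W * ip W X) - of_real nw * of_real nx * (ip W X * ip X W)"
      by (simp only: sum.distrib sum_subtractf sum_distrib_left[symmetric] prod ip_def)
    also have "\<dots> = of_real (2 * (nx * nw)\<^sup>2)"
      unfolding WX XW ipn nx_def[symmetric] nw_def[symmetric] by (simp add: power2_eq_square)
    finally show ?thesis unfolding of_real_eq_iff .
  qed
  finally have "(cmod (e1 - e2))\<^sup>2 * (nx * nw)\<^sup>2 \<le> (2 * (\<Sum>i<q. \<Sum>j<q. (cmod (A $$ (i, j)))\<^sup>2)) * (nx * nw)\<^sup>2"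
    by (simp add: power_mult_distrib mult_ac)
  then show ?thesis using nx nw by (subst (asm) mult_le_cancel_right) auto
qed

text \<open>All eigenvalues of \<open>B\<close> lie close to the points \<open>\<gamma>\<^sub>k\<close> and close to each other, hence close to
  one and the same \<open>\<gamma>\<^sub>k\<close>; so does their mean.\<close>

lemma mean_eigenvalue_near:
  fixes B :: "real mat" and \<gamma> :: "nat \<Rightarrow> real"
  assumes B: "B \<in> carrier_mat q q" and q: "0 < q" and \<mu>: "\<mu> = (\<Sum>k<q. B $$ (k, k)) / real q"
    and near: "\<And>\<sigma> \<omega> a c. a \<in> carrier_vec q \<Longrightarrow> c \<in> carrier_vec q \<Longrightarrow> a \<noteq> 0\<^sub>v q \<or> c \<noteq> 0\<^sub>v q \<Longrightarrow>
      B *\<^sub>v a = \<sigma> \<cdot>\<^sub>v a - \<omega> \<cdot>\<^sub>v c \<Longrightarrow> B *\<^sub>v c = \<omega> \<cdot>\<^sub>v a + \<sigma> \<cdot>\<^sub>v c \<Longrightarrow>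
      \<exists>k<t. (\<gamma> k - \<sigma>)\<^sup>2 + \<omega>\<^sup>2 \<le> \<rho>\<^sup>2" and \<rho>: "0 \<le> \<rho>"
    and g: "\<And>k l. k < t \<Longrightarrow> l < t \<Longrightarrow> k \<noteq> l \<Longrightarrow> g \<le> \<bar>\<gamma> k - \<gamma> l\<bar>"
    and close: "sqrt 2 * frobenius_norm (B - \<mu> \<cdot>\<^sub>m 1\<^sub>m q) + 2 * \<rho> < g"
  shows "\<exists>k<t. \<bar>\<mu> - \<gamma> k\<bar> \<le> \<rho>"
proof -
  define A where "A = map_mat complex_of_real B"
  have A: "A \<in> carrier_mat q q" using B by (simp add: A_def)
  obtain es where es: "char_poly A = (\<Prod>a\<leftarrow>es. [:- a, 1:])" "length es = q"
    using char_poly_factorized[OF A] by blast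
  have ev: "\<exists>x. eigenvector A x e" if "e \<in> set es" for e
  proof -
    have "poly (char_poly A) e = 0" unfolding es(1) using that by (induction es) (auto simp: poly_prod_list)
    then show ?thesis using eigenvalue_root_char_poly[OF A] by (simp add: eigenvalue_def)
  qed
  have loc: "\<exists>k<t. cmod (e - of_real (\<gamma> k)) \<le> \<rho>" if "e \<in> set es" for e
  proof -
    obtain x where x: "eigenvector A x e" using ev[OF \<open>e \<in> set es\<close>] by blast
    have xc: "x \<in> carrier_vec q" "x \<noteq> 0\<^sub>v q" "A *\<^sub>v x = e \<cdot>\<^sub>v x" using x A by (auto simp: eigenvector_def)
    define a c where "a = vec q (\<lambda>i. Re (x $ i))" and "c = vec q (\<lambda>i. Im (x $ i))"
    have Ax: "(\<Sum>j<q. of_real (B $$ (i, j)) * x $ j) = e * x $ i" if "i < q" for i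
      using arg_cong[OF xc(3), of "\<lambda>v. v $ i"] that A B xc(1)
      by (simp add: scalar_prod_def lessThan_atLeast0 A_def)
    have "B *\<^sub>v a = Re e \<cdot>\<^sub>v a - Im e \<cdot>\<^sub>v c"
      using B arg_cong[OF Ax, of _ Re]
      by (intro eq_vecI) (auto simp: a_def c_def scalar_prod_def lessThan_atLeast0)
    moreover have "B *\<^sub>v c = Im e \<cdot>\<^sub>v a + Re e \<cdot>\<^sub>v c"
      using B arg_cong[OF Ax, of _ Im]
      by (intro eq_vecI) (auto simp: a_def c_def scalar_prod_def lessThan_atLeast0)
    moreover have "a \<noteq> 0\<^sub>v q \<or> c \<noteq> 0\<^sub>v q"
    proof (rule ccontr)
      assume "\<not> ?thesis"
      then have z: "a = 0\<^sub>v q" "c = 0\<^sub>v q" by auto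
      have "x $ i = 0" if "i < q" for i
        using arg_cong[OF z(1), of "\<lambda>v. v $ i"] arg_cong[OF z(2), of "\<lambda>v. v $ i"] that
        by (simp add: a_def c_def complex_eq_iff)
      then show False using xc by (metis eq_vecI carrier_vecD index_zero_vec)
    qed
    ultimately obtain k where k: "k < t" "(\<gamma> k - Re e)\<^sup>2 + (Im e)\<^sup>2 \<le> \<rho>\<^sup>2"
      using near[of a c] by (auto simp: a_def c_def)
    have "(cmod (e - of_real (\<gamma> k)))\<^sup>2 = (\<gamma> k - Re e)\<^sup>2 + (Im e)\<^sup>2"
      unfolding cmod_power2 power2_commute[of "\<gamma> k"] by simp
    with k(2) have "(cmod (e - of_real (\<gamma> k)))\<^sup>2 \<le> \<rho>\<^sup>2" by (simp only:)
    then have "cmod (e - of_real (\<gamma> k)) \<le> \<rho>" by (rule power2_le_imp_le[OF _ \<rho>])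
    then show ?thesis using k(1) by blast
  qed
  have dist: "cmod (e - f) \<le> sqrt 2 * frobenius_norm (B - \<mu> \<cdot>\<^sub>m 1\<^sub>m q)" if ef: "e \<in> set es" "f \<in> set es" for e f
  proof (cases "e = f")
    case False
    obtain x y where x: "eigenvector A x e" and y: "eigenvector A y f" using ev ef by blast
    let ?A = "A - of_real \<mu> \<cdot>\<^sub>m 1\<^sub>m q"
    have sh: "eigenvector ?A x (e - of_real \<mu>)" if "eigenvector A x e" for x e
    proof -
      have x: "x \<in> carrier_vec q" "x \<noteq> 0\<^sub>v q" "A *\<^sub>v x = e \<cdot>\<^sub>v x" using that A by (auto simp: eigenvector_def)
      have "?A *\<^sub>v x = A *\<^sub>v x - (of_real \<mu> \<cdot>\<^sub>m 1\<^sub>m q) *\<^sub>v x"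
        by (rule minus_mult_distrib_mat_vec[of _ q q]) (use A x in auto)
      also have "(of_real \<mu> \<cdot>\<^sub>m 1\<^sub>m q) *\<^sub>v x = of_real \<mu> \<cdot>\<^sub>v x"
        using x by (intro eq_vecI) auto
      also have "A *\<^sub>v x - of_real \<mu> \<cdot>\<^sub>v x = (e - of_real \<mu>) \<cdot>\<^sub>v x"
        unfolding x(3) using x(1) by (intro eq_vecI) (auto simp: algebra_simps)
      finally show ?thesis using x A by (simp add: eigenvector_def)
    qed
    have A': "?A \<in> carrier_mat q q" using A by (intro minus_carrier_mat) auto
    have "(cmod (e - f))\<^sup>2 \<le> 2 * (\<Sum>i<q. \<Sum>j<q. (cmod (?A $$ (i, j)))\<^sup>2)"
      using eigenvalue_distance_le[OF A' sh[OF x] sh[OF y]] False by simp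
    also have "(\<Sum>i<q. \<Sum>j<q. (cmod (?A $$ (i, j)))\<^sup>2) = (frobenius_norm (B - \<mu> \<cdot>\<^sub>m 1\<^sub>m q))\<^sup>2"
      unfolding frobenius_norm_sq using B by (auto simp: A_def cmod_power2 intro!: sum.cong)
    also have "2 * \<dots> = (sqrt 2 * frobenius_norm (B - \<mu> \<cdot>\<^sub>m 1\<^sub>m q))\<^sup>2" by (simp add: power_mult_distrib)
    finally show ?thesis by (rule power2_le_imp_le) simp
  qed simp
  obtain e0 where e0: "e0 \<in> set es" using es(2) q by (cases es) auto
  then obtain k where k: "k < t" "cmod (e0 - of_real (\<gamma> k)) \<le> \<rho>" using loc by blast
  have all: "cmod (e - of_real (\<gamma> k)) \<le> \<rho>" if e: "e \<in> set es" for e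
  proof -
    obtain l where l: "l < t" "cmod (e - of_real (\<gamma> l)) \<le> \<rho>" using loc[OF e] by blast
    have "k = l"
    proof (rule ccontr)
      assume "k \<noteq> l"
      have "g \<le> \<bar>\<gamma> k - \<gamma> l\<bar>" by (rule g) fact+
      also have "\<dots> = cmod (of_real (\<gamma> k) - of_real (\<gamma> l))" by (metis norm_of_real of_real_diff)
      also have "of_real (\<gamma> k) - of_real (\<gamma> l) = (e0 - e) + (e - of_real (\<gamma> l)) - (e0 - of_real (\<gamma> k))" by simp
      also have "cmod \<dots> \<le> cmod (e0 - e) + cmod (e - of_real (\<gamma> l)) + cmod (e0 - of_real (\<gamma> k))"
        by (meson add_right_mono norm_triangle_ineq norm_triangle_ineq4 order_trans)
      also have "\<dots> < g" using dist[OF e0 e] l(2) k(2) close by simp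
      finally show False by simp
    qed
    then show ?thesis using l by simp
  qed
  have "sum_list es = of_real (\<Sum>i<q. B $$ (i, i))"
    unfolding sum_list_diag_similar[OF A es(1)] using B by (simp add: A_def)
  then have "of_real (real q * (\<mu> - \<gamma> k)) = sum_list es - of_nat (length es) * of_real (\<gamma> k)"
    using q by (simp add: \<mu> es(2) field_simps)
  also have "\<dots> = (\<Sum>e\<leftarrow>es. e - of_real (\<gamma> k))"
    by (simp add: sum_list_subtractf sum_list_triv)
  finally have "real q * \<bar>\<mu> - \<gamma> k\<bar> = cmod (\<Sum>e\<leftarrow>es. e - of_real (\<gamma> k))"
    by (metis abs_mult abs_of_nat norm_of_real)
  also have "\<dots> \<le> (\<Sum>e\<leftarrow>es. cmod (e - of_real (\<gamma> k)))"
    by (induction es) (auto intro: norm_triangle_le)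
  also have "\<dots> \<le> (\<Sum>e\<leftarrow>es. \<rho>)"
    using all by (intro sum_list_mono) auto
  also have "\<dots> = real q * \<rho>" by (simp add: sum_list_triv es(2))
  finally have "\<bar>\<mu> - \<gamma> k\<bar> \<le> \<rho>" using q by simp
  then show ?thesis using k(1) by blast
qed

section \<open>Perturbation of a block diagonal similarity\<close>

text \<open>The inequality \<open>p \<le> \<eta> (1 + p\<^sup>2)\<close> excludes the interval between \<open>\<tau>\<close> and \<open>1 / \<tau>\<close> as
  soon as \<open>\<eta> \<le> \<tau> / (1 + \<tau>\<^sup>2)\<close>. Applied to the best constant \<open>p\<close> in \<open>f \<le> p h\<close>,
  this turns the crude bound \<open>f \<le> h\<close> into a sharp one.\<close>

lemma quadratic_bootstrap:
  fixes f h :: "'a \<Rightarrow> real"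
  assumes h: "\<And>y. y \<in> S \<Longrightarrow> 0 \<le> h y" and crude: "\<And>y. y \<in> S \<Longrightarrow> f y \<le> h y"
    and step: "\<And>p. 0 \<le> p \<Longrightarrow> (\<And>y. y \<in> S \<Longrightarrow> f y \<le> p * h y) \<Longrightarrow>
      (\<And>y. y \<in> S \<Longrightarrow> f y \<le> \<eta> * (1 + p\<^sup>2) * h y)"
    and \<eta>: "0 \<le> \<eta>" "\<eta> * (1 + \<tau>\<^sup>2) \<le> \<tau>" and \<tau>: "0 \<le> \<tau>" "\<tau> < 1" and y: "y \<in> S"
  shows "f y \<le> \<eta> * (1 + \<tau>\<^sup>2) * h y"
proof -
  define P where "P = {p. 0 \<le> p \<and> (\<forall>y\<in>S. f y \<le> p * h y)}"
  define p where "p = Inf P"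
  have one: "1 \<in> P" using crude by (simp add: P_def)
  have bdd: "bdd_below P" by (rule bdd_belowI[of _ 0]) (simp add: P_def)
  have ne: "P \<noteq> {}" using one by blast
  have p0: "0 \<le> p" unfolding p_def by (rule cInf_greatest[OF ne]) (auto simp: P_def)
  have p1: "p \<le> 1" unfolding p_def by (rule cInf_lower[OF one bdd])
  have pP: "f y \<le> p * h y" if "y \<in> S" for y
  proof (cases "h y = 0")
    case True
    then show ?thesis using crude[OF that] by simp
  next
    case False
    then have pos: "0 < h y" using h[OF that] by simp
    have "f y / h y \<le> p"
      unfolding p_def by (rule cInf_greatest[OF ne]) (use pos that in \<open>auto simp: P_def field_simps\<close>)
    then show ?thesis using pos by (simp add: field_simps)
  qed
  have "\<eta> * (1 + p\<^sup>2) \<in> P" using step[OF p0 pP] \<eta> by (auto simp: P_def)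
  then have le: "p \<le> \<eta> * (1 + p\<^sup>2)" unfolding p_def by (rule cInf_lower[OF _ bdd])
  have "p \<le> \<tau>"
  proof (rule ccontr)
    assume "\<not> p \<le> \<tau>"
    then have gt: "\<tau> < p" by simp
    have "p * (1 + \<tau>\<^sup>2) \<le> \<eta> * (1 + p\<^sup>2) * (1 + \<tau>\<^sup>2)" by (rule mult_right_mono[OF le]) simp
    also have "\<dots> \<le> \<tau> * (1 + p\<^sup>2)"
      using mult_right_mono[OF \<eta>(2), of "1 + p\<^sup>2"] by (simp add: mult_ac)
    finally have "(p - \<tau>) * (1 - p * \<tau>) \<le> 0" by (simp add: algebra_simps power2_eq_square)
    moreover have "p * \<tau> < 1"
      using mult_mono[OF p1 order_refl[of \<tau>]] \<tau> by simp
    ultimately show False using gt by (simp add: mult_le_0_iff)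
  qed
  have "f y \<le> \<tau> * h y" if "y \<in> S" for y
    using pP[OF that] mult_right_mono[OF \<open>p \<le> \<tau>\<close> h[OF that]] by linarith
  from step[OF \<tau>(1) this y] show ?thesis .
qed

text \<open>The setting \<open>\<Gamma> V = V (M + F)\<close>, where \<open>\<Gamma>\<close> is diagonal with the entry \<open>\<gamma>\<close> of the block at each
  position, \<open>M\<close> is block diagonal and \<open>F\<close> is a perturbation. The function \<open>b\<close> assigns to each
  position its block.\<close>

locale block_perturbation =
  fixes n t :: nat and b :: "nat \<Rightarrow> nat" and \<gamma> :: "nat \<Rightarrow> real" and V Q M F :: "real mat"
  assumes carr: "V \<in> carrier_mat n n" "Q \<in> carrier_mat n n" "M \<in> carrier_mat n n" "F \<in> carrier_mat n n"
    and left_inverse: "Q * V = 1\<^sub>m n"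
    and label: "\<And>i. i < n \<Longrightarrow> b i < t"
    and M_block: "\<And>i l. i < n \<Longrightarrow> l < n \<Longrightarrow> b i \<noteq> b l \<Longrightarrow> M $$ (i, l) = 0"
    and residual: "\<And>i l. i < n \<Longrightarrow> l < n \<Longrightarrow>
      \<gamma> (b i) * V $$ (i, l) = (V * M) $$ (i, l) + (V * F) $$ (i, l)"
begin

text \<open>A bound for the size of \<open>V F y\<close> relative to that of \<open>V y\<close>: the condition number of \<open>V\<close> times the
  size of \<open>F\<close>.\<close>

definition K :: real where "K = spectral_norm V * spectral_norm Q * frobenius_norm F"

lemma K_nonneg: "0 \<le> K" by (simp add: K_def)

lemma residual_vec:
  assumes y: "y \<in> carrier_vec n" and i: "i < n"
  shows "\<gamma> (b i) * (V *\<^sub>v y) $ i = (V *\<^sub>v (M *\<^sub>v y)) $ i + (V *\<^sub>v (F *\<^sub>v y)) $ i"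
proof -
  have VM: "V * M \<in> carrier_mat n n" "V * F \<in> carrier_mat n n" using carr by auto
  have "\<gamma> (b i) * (V *\<^sub>v y) $ i = (\<Sum>l<n. \<gamma> (b i) * V $$ (i, l) * y $ l)"
    unfolding mult_mat_vec_index[OF carr(1) y i] by (simp add: sum_distrib_left mult_ac)
  also have "\<dots> = (\<Sum>l<n. (V * M) $$ (i, l) * y $ l + (V * F) $$ (i, l) * y $ l)"
    by (intro sum.cong refl) (simp only: residual i lessThan_iff distrib_right)
  also have "\<dots> = ((V * M) *\<^sub>v y) $ i + ((V * F) *\<^sub>v y) $ i"
    unfolding mult_mat_vec_index[OF VM(1) y i] mult_mat_vec_index[OF VM(2) y i] by (simp add: sum.distrib)
  finally show ?thesis
    unfolding assoc_mult_mat_vec[OF carr(1) carr(3) y] assoc_mult_mat_vec[OF carr(1) carr(4) y] .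
qed

lemma norm_le:
  assumes y: "y \<in> carrier_vec n"
  shows "euclid_norm y \<le> spectral_norm Q * euclid_norm (V *\<^sub>v y)"
proof -
  have "y = Q *\<^sub>v (V *\<^sub>v y)"
    using assoc_mult_mat_vec[OF carr(2) carr(1) y] y by (simp add: left_inverse)
  then show ?thesis using euclid_norm_mult_mat_vec_le[of Q n n "V *\<^sub>v y"] carr y by simp
qed

lemma VF_le:
  assumes y: "y \<in> carrier_vec n"
  shows "euclid_norm (V *\<^sub>v (F *\<^sub>v y)) \<le> K * euclid_norm (V *\<^sub>v y)"
proof -
  have "euclid_norm (V *\<^sub>v (F *\<^sub>v y)) \<le> spectral_norm V * euclid_norm (F *\<^sub>v y)"
    using carr y by (intro euclid_norm_mult_mat_vec_le) auto
  also have "\<dots> \<le> spectral_norm V * (frobenius_norm F * euclid_norm y)"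
    using carr y by (intro mult_left_mono euclid_norm_mult_mat_vec_le_frobenius) auto
  also have "\<dots> \<le> spectral_norm V * (frobenius_norm F * (spectral_norm Q * euclid_norm (V *\<^sub>v y)))"
    by (intro mult_left_mono norm_le y) auto
  finally show ?thesis by (simp add: K_def mult_ac)
qed

text \<open>A Bauer--Fike argument: for an eigenvector \<open>x\<close> of \<open>M\<close> the vector \<open>V x\<close> satisfies
  \<open>(\<Gamma> - \<lambda>) V x = V F x\<close>, where \<open>\<Gamma>\<close> is diagonal. The pair \<open>(a, c)\<close> is the real form of a complex
  eigenvector \<open>a + \<i> c\<close> with eigenvalue \<open>\<sigma> + \<i> \<omega>\<close>.\<close>

lemma eigenvalue_near_label:
  assumes a: "a \<in> carrier_vec n" and c: "c \<in> carrier_vec n" and nz: "a \<noteq> 0\<^sub>v n \<or> c \<noteq> 0\<^sub>v n"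
    and Ma: "M *\<^sub>v a = \<sigma> \<cdot>\<^sub>v a - \<omega> \<cdot>\<^sub>v c" and Mc: "M *\<^sub>v c = \<omega> \<cdot>\<^sub>v a + \<sigma> \<cdot>\<^sub>v c"
  shows "\<exists>k<t. (\<gamma> k - \<sigma>)\<^sup>2 + \<omega>\<^sup>2 \<le> K\<^sup>2"
proof (rule ccontr)
  assume "\<not> ?thesis"
  then have far: "K\<^sup>2 < (\<gamma> k - \<sigma>)\<^sup>2 + \<omega>\<^sup>2" if "k < t" for k using that by force
  define p q u v where "p = V *\<^sub>v a" and "q = V *\<^sub>v c" and "u = V *\<^sub>v (F *\<^sub>v a)" and "v = V *\<^sub>v (F *\<^sub>v c)"
  have dims: "p \<in> carrier_vec n" "q \<in> carrier_vec n" "u \<in> carrier_vec n" "v \<in> carrier_vec n"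
    using carr a c by (auto simp: p_def q_def u_def v_def)
  have VMa: "V *\<^sub>v (M *\<^sub>v a) = \<sigma> \<cdot>\<^sub>v p - \<omega> \<cdot>\<^sub>v q" "V *\<^sub>v (M *\<^sub>v c) = \<omega> \<cdot>\<^sub>v p + \<sigma> \<cdot>\<^sub>v q"
    unfolding Ma Mc p_def q_def using carr a c
    by (simp_all add: mult_minus_distrib_mat_vec[of _ n n] mult_add_distrib_mat_vec[of _ n n] mult_mat_vec[of _ n n])
  have uv: "u $ i = (\<gamma> (b i) - \<sigma>) * p $ i + \<omega> * q $ i" "v $ i = (\<gamma> (b i) - \<sigma>) * q $ i - \<omega> * p $ i"
    if "i < n" for i
    using residual_vec[OF a that] residual_vec[OF c that] dims that
    unfolding VMa p_def[symmetric] q_def[symmetric] u_def[symmetric] v_def[symmetric]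
    by (simp_all add: algebra_simps)
  let ?s = "\<lambda>i. (p $ i)\<^sup>2 + (q $ i)\<^sup>2"
  have sq: "(u $ i)\<^sup>2 + (v $ i)\<^sup>2 = ((\<gamma> (b i) - \<sigma>)\<^sup>2 + \<omega>\<^sup>2) * ?s i" if "i < n" for i
    unfolding uv[OF that] by (simp add: power2_eq_square algebra_simps)
  have sums: "(\<Sum>i<n. ?s i) = (euclid_norm p)\<^sup>2 + (euclid_norm q)\<^sup>2"
    "(\<Sum>i<n. (u $ i)\<^sup>2 + (v $ i)\<^sup>2) = (euclid_norm u)\<^sup>2 + (euclid_norm v)\<^sup>2"
    using dims by (simp_all add: euclid_norm_sq sum.distrib)
  have "\<exists>i<n. 0 < ?s i"
  proof (rule ccontr)
    assume "\<not> ?thesis"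
    then have "?s i = 0" if "i < n" for i using that by (metis not_less order_antisym sum_power2_ge_zero)
    then have "(euclid_norm p)\<^sup>2 + (euclid_norm q)\<^sup>2 = 0" unfolding sums(1)[symmetric] by simp
    then have "euclid_norm p = 0" "euclid_norm q = 0" by (simp_all add: sum_power2_eq_zero_iff)
    then have "euclid_norm a \<le> 0" "euclid_norm c \<le> 0"
      using norm_le[OF a] norm_le[OF c] by (simp_all add: p_def q_def)
    then show False using nz euclid_norm_eq_0_iff[OF a] euclid_norm_eq_0_iff[OF c]
      by (metis euclid_norm_nonneg order_antisym)
  qed
  then obtain i0 where i0: "i0 < n" "0 < ?s i0" by blast
  have "K\<^sup>2 * (\<Sum>i<n. ?s i) = (\<Sum>i<n. K\<^sup>2 * ?s i)" by (rule sum_distrib_left)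
  also have "\<dots> < (\<Sum>i<n. (u $ i)\<^sup>2 + (v $ i)\<^sup>2)"
  proof (rule sum_strict_mono_ex1)
    show "\<forall>i\<in>{..<n}. K\<^sup>2 * ?s i \<le> (u $ i)\<^sup>2 + (v $ i)\<^sup>2"
    proof
      fix i assume "i \<in> {..<n}"
      then have i: "i < n" by simp
      show "K\<^sup>2 * ?s i \<le> (u $ i)\<^sup>2 + (v $ i)\<^sup>2"
        unfolding sq[OF i] by (rule mult_right_mono) (use far[OF label[OF i]] in auto)
    qed
    show "\<exists>i\<in>{..<n}. K\<^sup>2 * ?s i < (u $ i)\<^sup>2 + (v $ i)\<^sup>2"
    proof (rule bexI[of _ i0])
      show "K\<^sup>2 * ?s i0 < (u $ i0)\<^sup>2 + (v $ i0)\<^sup>2"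
        unfolding sq[OF i0(1)] by (rule mult_strict_right_mono[OF far[OF label[OF i0(1)]] i0(2)])
    qed (use i0 in simp)
  qed simp
  also have "\<dots> = (euclid_norm u)\<^sup>2 + (euclid_norm v)\<^sup>2" by (rule sums(2))
  also have "\<dots> \<le> (K * euclid_norm p)\<^sup>2 + (K * euclid_norm q)\<^sup>2"
    using VF_le[OF a] VF_le[OF c] unfolding p_def q_def u_def v_def
    by (intro add_mono power_mono) auto
  also have "\<dots> = K\<^sup>2 * (\<Sum>i<n. ?s i)" unfolding sums by (simp add: power_mult_distrib distrib_left)
  finally show False by simp
qed

end

text \<open>A column block \<open>j\<close> of \<open>V\<close> is matched with the row block \<open>\<pi> j\<close> whose \<open>\<gamma>\<close> is close to the eigenvalues
  of block \<open>j\<close> of \<open>M\<close>. For \<open>F = 0\<close> and exact eigenvalues, \<open>V\<close> would vanish at all other positions.\<close>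

locale matched_block_perturbation = block_perturbation +
  fixes \<pi> :: "nat \<Rightarrow> nat"
  assumes \<pi>_less: "\<And>j. j < t \<Longrightarrow> \<pi> j < t"
begin

definition X :: "real mat" where
  "X = mat n n (\<lambda>(i, l). if b i = \<pi> (b l) then V $$ (i, l) else 0)"

definition Y :: "real mat" where
  "Y = mat n n (\<lambda>(i, l). if b i = \<pi> (b l) then 0 else V $$ (i, l))"

definition supp :: "nat \<Rightarrow> real vec set" where
  "supp j = {y \<in> carrier_vec n. \<forall>i<n. b i \<noteq> j \<longrightarrow> y $ i = 0}"

lemma XY_carrier [simp, intro]: "X \<in> carrier_mat n n" "Y \<in> carrier_mat n n"
  by (simp_all add: X_def Y_def)

lemma V_split:
  assumes y: "y \<in> carrier_vec n"
  shows "V *\<^sub>v y = X *\<^sub>v y + Y *\<^sub>v y"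
proof -
  have "V = X + Y" using carr by (intro eq_matI) (auto simp: X_def Y_def)
  then show ?thesis using add_mult_distrib_mat_vec[OF XY_carrier y] by simp
qed

lemma XY_supp:
  assumes y: "y \<in> supp j" and i: "i < n"
  shows "(X *\<^sub>v y) $ i = (if b i = \<pi> j then (V *\<^sub>v y) $ i else 0)"
    "(Y *\<^sub>v y) $ i = (if b i = \<pi> j then 0 else (V *\<^sub>v y) $ i)"
proof -
  have y': "y \<in> carrier_vec n" and z: "\<And>l. l < n \<Longrightarrow> b l \<noteq> j \<Longrightarrow> y $ l = 0"
    using y by (auto simp: supp_def)
  have "(X *\<^sub>v y) $ i = (\<Sum>l<n. if b i = \<pi> j then V $$ (i, l) * y $ l else 0)"
    unfolding mult_mat_vec_index[OF XY_carrier(1) y' i] using i z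
    by (intro sum.cong refl) (auto simp: X_def)
  then show "(X *\<^sub>v y) $ i = (if b i = \<pi> j then (V *\<^sub>v y) $ i else 0)"
    unfolding mult_mat_vec_index[OF carr(1) y' i] by simp
  have "(Y *\<^sub>v y) $ i = (\<Sum>l<n. if b i = \<pi> j then 0 else V $$ (i, l) * y $ l)"
    unfolding mult_mat_vec_index[OF XY_carrier(2) y' i] using i z
    by (intro sum.cong refl) (auto simp: Y_def)
  then show "(Y *\<^sub>v y) $ i = (if b i = \<pi> j then 0 else (V *\<^sub>v y) $ i)"
    unfolding mult_mat_vec_index[OF carr(1) y' i] by simp
qed

lemma norm_V_supp:
  assumes y: "y \<in> supp j"
  shows "(euclid_norm (V *\<^sub>v y))\<^sup>2 = (euclid_norm (X *\<^sub>v y))\<^sup>2 + (euclid_norm (Y *\<^sub>v y))\<^sup>2"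
proof -
  have "(euclid_norm (V *\<^sub>v y))\<^sup>2 = (\<Sum>i<n. ((V *\<^sub>v y) $ i)\<^sup>2)" using carr by (simp add: euclid_norm_sq)
  also have "\<dots> = (\<Sum>i<n. ((X *\<^sub>v y) $ i)\<^sup>2 + ((Y *\<^sub>v y) $ i)\<^sup>2)"
    by (intro sum.cong refl) (simp only: XY_supp[OF y] lessThan_iff, simp)
  also have "\<dots> = (euclid_norm (X *\<^sub>v y))\<^sup>2 + (euclid_norm (Y *\<^sub>v y))\<^sup>2"
    by (simp only: sum.distrib euclid_norm_sq dim_mult_mat_vec carrier_matD[OF XY_carrier(1)] carrier_matD[OF XY_carrier(2)])
  finally show ?thesis .
qed

text \<open>Outside the matched positions the residual equation is a Sylvester equation for \<open>Y\<close> with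
  separation at least \<open>d - \<nu>\<close>.\<close>

lemma frobenius_norm_Y_le:
  assumes d: "0 \<le> d" "\<And>k j. k < t \<Longrightarrow> j < t \<Longrightarrow> k \<noteq> \<pi> j \<Longrightarrow> d \<le> \<bar>\<gamma> k - \<mu> j\<bar>"
    and \<nu>: "frobenius_norm (M - mat n n (\<lambda>(i, l). if i = l then \<mu> (b l) else 0)) \<le> \<nu>"
  shows "(d - \<nu>) * frobenius_norm Y \<le> spectral_norm V * frobenius_norm F"
proof -
  define N where "N = M - mat n n (\<lambda>(i, l). if i = l then \<mu> (b l) else 0)"
  define T where "T = mat n n (\<lambda>(i, l). if b i = \<pi> (b l) then 0 else (\<gamma> (b i) - \<mu> (b l)) * V $$ (i, l))"
  define H where "H = mat n n (\<lambda>(i, l). if b i = \<pi> (b l) then 0 else (V * F) $$ (i, l))"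
  have N: "N \<in> carrier_mat n n" unfolding N_def by (rule minus_carrier_mat) simp
  have N_block: "N $$ (i, l) = 0" if "i < n" "l < n" "b i \<noteq> b l" for i l
    using that carr M_block by (auto simp: N_def)
  have N_sum: "(\<Sum>j<n. V $$ (i, j) * N $$ (j, l)) = (V * M) $$ (i, l) - \<mu> (b l) * V $$ (i, l)"
    if il: "i < n" "l < n" for i l
  proof -
    have "(\<Sum>j<n. V $$ (i, j) * N $$ (j, l)) =
        (\<Sum>j<n. V $$ (i, j) * M $$ (j, l) - (if j = l then V $$ (i, j) * \<mu> (b l) else 0))"
      using il carr by (intro sum.cong refl) (auto simp: N_def algebra_simps)
    also have "\<dots> = (V * M) $$ (i, l) - \<mu> (b l) * V $$ (i, l)"
      unfolding mult_mat_index[OF carr(1) carr(3) il] using il by (simp add: sum_subtractf)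
    finally show ?thesis .
  qed
  have "T = Y * N + H"
  proof (rule eq_matI)
    fix i l assume "i < dim_row (Y * N + H)" "l < dim_col (Y * N + H)"
    then have il: "i < n" "l < n" by (auto simp: H_def)
    have "(Y * N) $$ (i, l) = (\<Sum>j<n. Y $$ (i, j) * N $$ (j, l))"
      by (rule mult_mat_index[OF XY_carrier(2) N il])
    also have "\<dots> = (\<Sum>j<n. if b i = \<pi> (b l) then 0 else V $$ (i, j) * N $$ (j, l))"
    proof (intro sum.cong refl)
      fix j assume "j \<in> {..<n}"
      then have j: "j < n" by simp
      show "Y $$ (i, j) * N $$ (j, l) = (if b i = \<pi> (b l) then 0 else V $$ (i, j) * N $$ (j, l))"
        using N_block[OF j il(2)] il j by (cases "b j = b l") (auto simp: Y_def)
    qed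
    also have "\<dots> = (if b i = \<pi> (b l) then 0 else (V * M) $$ (i, l) - \<mu> (b l) * V $$ (i, l))"
      unfolding N_sum[OF il, symmetric] by simp
    finally have "(Y * N) $$ (i, l) =
      (if b i = \<pi> (b l) then 0 else (V * M) $$ (i, l) - \<mu> (b l) * V $$ (i, l))" .
    moreover have "(Y * N + H) $$ (i, l) = (Y * N) $$ (i, l) + H $$ (i, l)"
      using il by (intro index_add_mat) (auto simp: H_def)
    ultimately show "T $$ (i, l) = (Y * N + H) $$ (i, l)"
      using il residual[OF il] by (simp add: T_def H_def left_diff_distrib)
  qed (auto simp: T_def H_def)
  have "d * frobenius_norm Y = frobenius_norm (d \<cdot>\<^sub>m Y)"
    using d by (simp add: frobenius_norm_smult)
  also have "\<dots> \<le> frobenius_norm T"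
  proof (rule frobenius_norm_mono[of _ n n])
    fix i l assume il: "i < n" "l < n"
    show "\<bar>(d \<cdot>\<^sub>m Y) $$ (i, l)\<bar> \<le> \<bar>T $$ (i, l)\<bar>"
      using il d(1) d(2)[OF label[OF il(1)] label[OF il(2)]]
      by (auto simp: Y_def T_def abs_mult intro!: mult_right_mono)
  qed (auto simp: T_def)
  also have "\<dots> \<le> frobenius_norm (Y * N) + frobenius_norm H"
    unfolding \<open>T = Y * N + H\<close>
    by (rule frobenius_norm_triangle[OF mult_carrier_mat[OF XY_carrier(2) N]]) (simp add: H_def)
  also have "frobenius_norm (Y * N) \<le> frobenius_norm Y * \<nu>"
    using frobenius_norm_mult_le[OF XY_carrier(2) N] mult_left_mono[OF \<nu>[folded N_def], of "frobenius_norm Y"]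
    by simp
  also have "frobenius_norm H \<le> frobenius_norm (V * F)"
    using carr by (intro frobenius_norm_mono[of _ n n]) (auto simp: H_def simp del: index_mult_mat(1))
  also have "\<dots> \<le> spectral_norm V * frobenius_norm F"
    by (rule frobenius_norm_mult_le_left[OF carr(1) carr(4)])
  finally show ?thesis by (simp add: algebra_simps)
qed

lemma norm_Y_le_V:
  assumes y: "y \<in> carrier_vec n"
  shows "euclid_norm (Y *\<^sub>v y) \<le> (frobenius_norm Y * spectral_norm Q) * euclid_norm (V *\<^sub>v y)"
proof -
  have "euclid_norm (Y *\<^sub>v y) \<le> frobenius_norm Y * euclid_norm y"
    using y by (intro euclid_norm_mult_mat_vec_le_frobenius) auto
  also have "\<dots> \<le> frobenius_norm Y * (spectral_norm Q * euclid_norm (V *\<^sub>v y))"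
    by (intro mult_left_mono norm_le y) auto
  finally show ?thesis by (simp add: mult_ac)
qed

text \<open>If \<open>Y\<close> is small, then \<open>X\<close> is invertible. A nonzero term in the Leibniz expansion of its
  determinant is a permutation along the matched positions, so it moves whole blocks.\<close>

lemma matched_permutation:
  assumes s: "frobenius_norm Y * spectral_norm Q < 1"
  obtains p where "p permutes {..<n}" "\<And>l. l < n \<Longrightarrow> b (p l) = \<pi> (b l)"
proof -
  have "det X \<noteq> 0"
  proof
    assume "det X = 0"
    then obtain y where y: "y \<in> carrier_vec n" "y \<noteq> 0\<^sub>v n" "X *\<^sub>v y = 0\<^sub>v n"
      using det_0_iff_vec_prod_zero[OF XY_carrier(1)] by blast
    have "Y *\<^sub>v y \<in> carrier_vec n" using mult_mat_vec_carrier[OF XY_carrier(2) y(1)] .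
    then have "V *\<^sub>v y = Y *\<^sub>v y" using V_split[OF y(1)] y(3) by simp
    then have "euclid_norm (V *\<^sub>v y) \<le> (frobenius_norm Y * spectral_norm Q) * euclid_norm (V *\<^sub>v y)"
      using norm_Y_le_V[OF y(1)] by simp
    then have "euclid_norm (V *\<^sub>v y) = 0" using s
      by (metis euclid_norm_nonneg less_le mult_less_cancel_right2 not_le)
    then have "euclid_norm y \<le> 0" using norm_le[OF y(1)] by simp
    then show False using y euclid_norm_eq_0_iff[OF y(1)] by (simp add: order_antisym)
  qed
  then obtain q where q: "q permutes {0..<n}" "signof q * (\<Prod>i=0..<n. X $$ (i, q i)) \<noteq> 0"
    unfolding det_def'[OF XY_carrier(1)] by (metis (mono_tags, lifting) mem_Collect_eq sum.not_neutral_contains_not_neutral)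
  have qi: "b i = \<pi> (b (q i))" if "i < n" for i
  proof -
    have "X $$ (i, q i) \<noteq> 0" using q(2) that by auto
    moreover have "q i < n" using permutes_in_image[OF q(1), of i] that by simp
    ultimately show ?thesis using that by (auto simp: X_def split: if_splits)
  qed
  show thesis
  proof
    show "Hilbert_Choice.inv q permutes {..<n}" using permutes_inv[OF q(1)] by (simp add: lessThan_atLeast0)
    fix l assume l: "l < n"
    then have "Hilbert_Choice.inv q l < n" using permutes_in_image[OF permutes_inv[OF q(1)], of l] by simp
    from qi[OF this] show "b (Hilbert_Choice.inv q l) = \<pi> (b l)" using permutes_inverses(1)[OF q(1)] by simp
  qed
qed

text \<open>One step of the bootstrap. For \<open>y\<close> in block \<open>j\<close> put \<open>z = \<gamma>\<^sub>k y - M y\<close> with \<open>k = \<pi> j\<close>. Then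
  \<open>X z\<close> is the part of \<open>V F y\<close> in block \<open>k\<close>, and \<open>(\<Gamma> - \<gamma>\<^sub>k) Y y\<close> is the other part minus \<open>Y z\<close>.\<close>

lemma bootstrap_step:
  assumes g: "\<And>k l. k < t \<Longrightarrow> l < t \<Longrightarrow> k \<noteq> l \<Longrightarrow> g \<le> \<bar>\<gamma> k - \<gamma> l\<bar>" "0 \<le> g"
    and j: "j < t" and p: "0 \<le> p" "\<And>y. y \<in> supp j \<Longrightarrow> euclid_norm (Y *\<^sub>v y) \<le> p * euclid_norm (X *\<^sub>v y)"
    and y: "y \<in> supp j"
  shows "g * euclid_norm (Y *\<^sub>v y) \<le> K * (1 + p\<^sup>2) * euclid_norm (X *\<^sub>v y)"
proof -
  define k where "k = \<pi> j"
  have k: "k < t" using \<pi>_less[OF j] by (simp add: k_def)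
  have y': "y \<in> carrier_vec n" using y by (simp add: supp_def)
  define z where "z = \<gamma> k \<cdot>\<^sub>v y - M *\<^sub>v y"
  define w where "w = V *\<^sub>v (F *\<^sub>v y)"
  define h1 where "h1 = vec n (\<lambda>i. if b i = k then w $ i else 0)"
  define h2 where "h2 = vec n (\<lambda>i. if b i = k then 0 else w $ i)"
  have My: "M *\<^sub>v y \<in> carrier_vec n" using mult_mat_vec_carrier[OF carr(3) y'] .
  have z: "z \<in> supp j"
  proof -
    have "(M *\<^sub>v y) $ i = 0" if i: "i < n" "b i \<noteq> j" for i
      unfolding mult_mat_vec_index[OF carr(3) y' i(1)]
      using y i M_block by (intro sum.neutral) (auto simp: supp_def)
    then show ?thesis using y My carr by (auto simp: supp_def z_def simp del: index_mult_mat_vec)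
  qed
  have z': "z \<in> carrier_vec n" using z by (simp add: supp_def)
  have Vz: "(V *\<^sub>v z) $ i = (\<gamma> k - \<gamma> (b i)) * (V *\<^sub>v y) $ i + w $ i" if i: "i < n" for i
  proof -
    have "V *\<^sub>v z = \<gamma> k \<cdot>\<^sub>v (V *\<^sub>v y) - V *\<^sub>v (M *\<^sub>v y)"
      unfolding z_def using carr y' My
      by (simp add: mult_minus_distrib_mat_vec[of _ n n] mult_mat_vec[of _ n n])
    then have "(V *\<^sub>v z) $ i = \<gamma> k * (V *\<^sub>v y) $ i - (V *\<^sub>v (M *\<^sub>v y)) $ i"
      using i carr y' by (simp del: index_mult_mat_vec)
    then show ?thesis using residual_vec[OF y' i] by (simp add: w_def algebra_simps del: index_mult_mat_vec)
  qed
  have Xz: "X *\<^sub>v z = h1"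
    by (intro eq_vecI)
       (auto simp: XY_supp[OF z] Vz h1_def k_def[symmetric] carrier_matD[OF XY_carrier(1)]
         simp del: index_mult_mat_vec)
  have dims: "h1 \<in> carrier_vec n" "h2 \<in> carrier_vec n" "Y *\<^sub>v z \<in> carrier_vec n" "w \<in> carrier_vec n"
    using carr y' z' mult_mat_vec_carrier[OF XY_carrier(2) z'] by (auto simp: h1_def h2_def w_def)
  have "g * euclid_norm (Y *\<^sub>v y) = euclid_norm (g \<cdot>\<^sub>v (Y *\<^sub>v y))"
    using g(2) by (simp add: euclid_norm_smult)
  also have "\<dots> \<le> euclid_norm (h2 - Y *\<^sub>v z)"
  proof (rule euclid_norm_mono[of _ n])
    fix i assume i: "i < n"
    have e1: "(g \<cdot>\<^sub>v (Y *\<^sub>v y)) $ i = g * (Y *\<^sub>v y) $ i" and e2: "(h2 - Y *\<^sub>v z) $ i = h2 $ i - (Y *\<^sub>v z) $ i"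
      using i by (simp_all add: carrier_matD[OF XY_carrier(2)] h2_def del: index_mult_mat_vec)
    show "\<bar>(g \<cdot>\<^sub>v (Y *\<^sub>v y)) $ i\<bar> \<le> \<bar>(h2 - Y *\<^sub>v z) $ i\<bar>"
    proof (cases "b i = k")
      case True
      then show ?thesis unfolding e1 XY_supp[OF y i] k_def by simp
    next
      case False
      have "(h2 - Y *\<^sub>v z) $ i = (\<gamma> (b i) - \<gamma> k) * (V *\<^sub>v y) $ i"
        unfolding e2 XY_supp[OF z i] Vz[OF i] using False i by (simp add: h2_def k_def[symmetric] algebra_simps)
      moreover have "g \<le> \<bar>\<gamma> (b i) - \<gamma> k\<bar>" using g(1)[OF label[OF i] k False] .
      ultimately show ?thesis unfolding e1 XY_supp[OF y i] using False g(2)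
        by (simp add: k_def[symmetric] abs_mult mult_right_mono del: index_mult_mat_vec)
    qed
  qed (use dims mult_mat_vec_carrier[OF XY_carrier(2) y'] in auto)
  also have "\<dots> \<le> euclid_norm h2 + euclid_norm (Y *\<^sub>v z)"
    using dims by (intro euclid_norm_minus_triangle[of _ n]) auto
  also have "\<dots> \<le> euclid_norm h2 * 1 + euclid_norm h1 * p"
    using p(2)[OF z] unfolding Xz by (simp add: mult.commute)
  also have "\<dots> \<le> sqrt ((euclid_norm h2)\<^sup>2 + (euclid_norm h1)\<^sup>2) * sqrt (1 + p\<^sup>2)"
  proof -
    have "(euclid_norm h2 * 1 + euclid_norm h1 * p)\<^sup>2 \<le> ((euclid_norm h2)\<^sup>2 + (euclid_norm h1)\<^sup>2) * (1 + p\<^sup>2)"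
      using sum_squares_ge_zero[of "euclid_norm h2 * p - euclid_norm h1" 0]
      by (simp add: power2_eq_square algebra_simps)
    from real_sqrt_le_mono[OF this] show ?thesis using p(1) by (simp add: real_sqrt_mult)
  qed
  also have "(euclid_norm h2)\<^sup>2 + (euclid_norm h1)\<^sup>2 = (euclid_norm w)\<^sup>2"
  proof -
    have d: "dim_vec h1 = n" "dim_vec h2 = n" "dim_vec w = n"
      using carr by (simp_all add: h1_def h2_def w_def)
    show ?thesis
      unfolding euclid_norm_sq d sum.distrib[symmetric] by (intro sum.cong refl) (auto simp: h1_def h2_def)
  qed
  also have "sqrt ((euclid_norm w)\<^sup>2) * sqrt (1 + p\<^sup>2) \<le> (K * euclid_norm (V *\<^sub>v y)) * sqrt (1 + p\<^sup>2)"
    using VF_le[OF y'] by (intro mult_right_mono) (simp_all add: w_def)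
  also have "\<dots> \<le> (K * (sqrt (1 + p\<^sup>2) * euclid_norm (X *\<^sub>v y))) * sqrt (1 + p\<^sup>2)"
  proof (intro mult_right_mono mult_left_mono K_nonneg)
    have "(euclid_norm (V *\<^sub>v y))\<^sup>2 \<le> (euclid_norm (X *\<^sub>v y))\<^sup>2 + (p * euclid_norm (X *\<^sub>v y))\<^sup>2"
      unfolding norm_V_supp[OF y] using power_mono[OF p(2)[OF y], of 2] by simp
    also have "\<dots> = (sqrt (1 + p\<^sup>2) * euclid_norm (X *\<^sub>v y))\<^sup>2"
      by (simp add: power_mult_distrib distrib_right)
    finally show "euclid_norm (V *\<^sub>v y) \<le> sqrt (1 + p\<^sup>2) * euclid_norm (X *\<^sub>v y)"
      by (rule power2_le_imp_le) simp
  qed simp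
  also have "\<dots> = K * (1 + p\<^sup>2) * euclid_norm (X *\<^sub>v y)" by simp
  finally show ?thesis .
qed

lemma norm_Y_le_X:
  assumes g: "\<And>k l. k < t \<Longrightarrow> l < t \<Longrightarrow> k \<noteq> l \<Longrightarrow> g \<le> \<bar>\<gamma> k - \<gamma> l\<bar>" "0 < g"
    and s: "2 * (frobenius_norm Y * spectral_norm Q)\<^sup>2 \<le> 1"
    and \<tau>: "0 \<le> \<tau>" "\<tau> < 1" "K * (1 + \<tau>\<^sup>2) \<le> g * \<tau>"
    and j: "j < t" and y: "y \<in> supp j"
  shows "euclid_norm (Y *\<^sub>v y) \<le> (K / g * (1 + \<tau>\<^sup>2)) * euclid_norm (X *\<^sub>v y)"
proof (rule quadratic_bootstrap[where S = "supp j" and f = "\<lambda>y. euclid_norm (Y *\<^sub>v y)"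
      and h = "\<lambda>y. euclid_norm (X *\<^sub>v y)"])
  fix y assume y: "y \<in> supp j"
  then have y': "y \<in> carrier_vec n" by (simp add: supp_def)
  let ?s = "frobenius_norm Y * spectral_norm Q"
  have "(euclid_norm (Y *\<^sub>v y))\<^sup>2 \<le> (?s * euclid_norm (V *\<^sub>v y))\<^sup>2"
    by (rule power_mono[OF norm_Y_le_V[OF y']]) simp
  also have "\<dots> = ?s\<^sup>2 * ((euclid_norm (X *\<^sub>v y))\<^sup>2 + (euclid_norm (Y *\<^sub>v y))\<^sup>2)"
    by (simp add: power_mult_distrib norm_V_supp[OF y])
  also have "\<dots> \<le> (1 / 2) * ((euclid_norm (X *\<^sub>v y))\<^sup>2 + (euclid_norm (Y *\<^sub>v y))\<^sup>2)"
    by (rule mult_right_mono) (use s in auto)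
  finally have "(euclid_norm (Y *\<^sub>v y))\<^sup>2 \<le> (euclid_norm (X *\<^sub>v y))\<^sup>2" by simp
  then show "euclid_norm (Y *\<^sub>v y) \<le> euclid_norm (X *\<^sub>v y)" by (rule power2_le_imp_le) simp
next
  fix p y assume p: "0 \<le> p" "\<And>y. y \<in> supp j \<Longrightarrow> euclid_norm (Y *\<^sub>v y) \<le> p * euclid_norm (X *\<^sub>v y)"
    and y: "y \<in> supp j"
  have "g * euclid_norm (Y *\<^sub>v y) \<le> K * (1 + p\<^sup>2) * euclid_norm (X *\<^sub>v y)"
    by (rule bootstrap_step[OF g(1) _ j p y]) (use g in auto)
  then show "euclid_norm (Y *\<^sub>v y) \<le> K / g * (1 + p\<^sup>2) * euclid_norm (X *\<^sub>v y)"
    using g(2) by (simp add: field_simps)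
qed (use g \<tau> y K_nonneg in \<open>auto simp: field_simps\<close>)

end

section \<open>Block diagonal orthogonal matrices\<close>

definition block_orthogonal :: "nat list \<Rightarrow> real mat set" where
  "block_orthogonal ns = {D \<in> block_diagonal ns. D\<^sup>T * D = 1\<^sub>m (sum_list ns)}"

lemma block_orthogonalD:
  assumes "D \<in> block_orthogonal ns"
  shows "D \<in> block_diagonal ns" "D \<in> carrier_mat (sum_list ns) (sum_list ns)"
    "D\<^sup>T * D = 1\<^sub>m (sum_list ns)" "D * D\<^sup>T = 1\<^sub>m (sum_list ns)"
proof -
  show D: "D \<in> block_diagonal ns" "D\<^sup>T * D = 1\<^sub>m (sum_list ns)" using assms by (auto simp: block_orthogonal_def)
  then show c: "D \<in> carrier_mat (sum_list ns) (sum_list ns)" by (simp add: block_diagonal_iff)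
  show "D * D\<^sup>T = 1\<^sub>m (sum_list ns)"
    by (rule mat_mult_left_right_inverse[OF _ c D(2)]) (use c in simp)
qed

lemma block_diagonal_mult:
  assumes "A \<in> block_diagonal ns" "B \<in> block_diagonal ns"
  shows "A * B \<in> block_diagonal ns"
proof -
  let ?N = "sum_list ns"
  have c: "A \<in> carrier_mat ?N ?N" "B \<in> carrier_mat ?N ?N" using assms by (auto simp: block_diagonal_iff)
  have "(A * B) $$ (i, l) = 0" if il: "i < ?N" "l < ?N" "blk ns i \<noteq> blk ns l" for i l
    unfolding mult_mat_index[OF c il(1,2)]
  proof (rule sum.neutral, rule ballI)
    fix j assume "j \<in> {..<?N}"
    then show "A $$ (i, j) * B $$ (j, l) = 0"
      using assms il by (cases "blk ns i = blk ns j") (auto simp: block_diagonal_iff)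
  qed
  then show ?thesis using c by (simp add: block_diagonal_iff del: index_mult_mat(1))
qed

lemma one_block_orthogonal: "1\<^sub>m (sum_list ns) \<in> block_orthogonal ns"
  by (auto simp: block_orthogonal_def block_diagonal_iff transpose_one)

lemma block_orthogonal_mult:
  assumes "A \<in> block_orthogonal ns" "B \<in> block_orthogonal ns"
  shows "A * B \<in> block_orthogonal ns"
proof -
  let ?N = "sum_list ns"
  note A = block_orthogonalD[OF assms(1)] and B = block_orthogonalD[OF assms(2)]
  have AT: "A\<^sup>T \<in> carrier_mat ?N ?N" "B\<^sup>T \<in> carrier_mat ?N ?N" using A B by auto
  have "(A * B)\<^sup>T * (A * B) = B\<^sup>T * (A\<^sup>T * (A * B))"
    unfolding transpose_mult[OF A(2) B(2)]
    by (rule assoc_mult_mat[OF AT(2,1)]) (use A B in auto)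
  also have "A\<^sup>T * (A * B) = B"
    using assoc_mult_mat[OF AT(1) A(2) B(2)] left_mult_one_mat[OF B(2)] by (simp add: A(3))
  finally show ?thesis
    using block_diagonal_mult[OF A(1) B(1)] B(3) by (simp add: block_orthogonal_def)
qed

text \<open>The block diagonal orthogonal matrices form a compact set, so Lipschitz functions attain their
  minimum there.\<close>

lemma block_orthogonal_minimum:
  fixes f :: "real mat \<Rightarrow> real"
  assumes lip: "\<And>A B. A \<in> carrier_mat (sum_list ns) (sum_list ns) \<Longrightarrow> B \<in> carrier_mat (sum_list ns) (sum_list ns) \<Longrightarrow>
      \<bar>f A - f B\<bar> \<le> L * frobenius_norm (A - B)"
  obtains U where "U \<in> block_orthogonal ns" "\<And>D. D \<in> block_orthogonal ns \<Longrightarrow> f U \<le> f D"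
proof -
  let ?N = "sum_list ns"
  let ?I = "{..<?N} \<times> {..<?N}"
  define O1 where "O1 = {h :: nat \<times> nat \<Rightarrow> real. (\<forall>p\<in>?I. \<bar>h p\<bar> \<le> 1) \<and> (\<forall>p. p \<notin> ?I \<longrightarrow> h p = 0)}"
  define O2 where "O2 = {h :: nat \<times> nat \<Rightarrow> real. \<forall>i l. i < ?N \<and> l < ?N \<longrightarrow>
      (\<Sum>k<?N. h (k, i) * h (k, l)) = (if i = l then 1 else 0)}"
  define O3 where "O3 = {h :: nat \<times> nat \<Rightarrow> real. \<forall>i l. i < ?N \<and> l < ?N \<and> blk ns i \<noteq> blk ns l \<longrightarrow> h (i, l) = 0}"
  let ?m = "\<lambda>h. mat ?N ?N h :: real mat"
  have "closed O2" "closed O3"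
    unfolding O2_def O3_def
    by (intro closed_Collect_all closed_Collect_imp open_Collect_const closed_Collect_eq continuous_intros continuous_on_product_coordinates)+
  then have comp: "compact (O1 \<inter> O2 \<inter> O3)"
    using compact_box[of ?I 1] unfolding O1_def by (intro compact_Int_closed)
  have orth_iff: "?m h \<in> block_orthogonal ns \<longleftrightarrow> h \<in> O2 \<inter> O3" for h
  proof -
    have "(?m h)\<^sup>T * ?m h = 1\<^sub>m ?N \<longleftrightarrow> h \<in> O2"
    proof -
      have e: "((?m h)\<^sup>T * ?m h) $$ (i, l) = (\<Sum>k<?N. h (k, i) * h (k, l))" if "i < ?N" "l < ?N" for i l
        using that by (simp add: scalar_prod_def lessThan_atLeast0)
      show ?thesis
      proof
        assume eq: "(?m h)\<^sup>T * ?m h = 1\<^sub>m ?N"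
        show "h \<in> O2" unfolding O2_def using e unfolding eq by simp
      next
        assume "h \<in> O2"
        then show "(?m h)\<^sup>T * ?m h = 1\<^sub>m ?N"
          by (intro eq_matI) (simp_all add: O2_def e del: index_mult_mat(1))
      qed
    qed
    then show ?thesis by (auto simp: block_orthogonal_def block_diagonal_iff O3_def)
  qed
  have rep: "\<exists>h \<in> O1 \<inter> O2 \<inter> O3. D = ?m h" if D: "D \<in> block_orthogonal ns" for D
  proof -
    note d = block_orthogonalD[OF D]
    define h where "h p = (if p \<in> ?I then D $$ p else 0)" for p
    have Dh: "D = ?m h" using d(2) by (intro eq_matI) (auto simp: h_def)
    have "\<bar>h p\<bar> \<le> 1" if p: "p \<in> ?I" for p
    proof -
      obtain i l where il: "p = (i, l)" "i < ?N" "l < ?N" using p by auto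
      have "(\<Sum>k<?N. h (k, l) * h (k, l)) = 1" using orth_iff[of h] D il unfolding Dh[symmetric] by (auto simp: O2_def)
      moreover have "h p * h p \<le> (\<Sum>k<?N. h (k, l) * h (k, l))"
        unfolding il(1) by (rule member_le_sum) (use il in auto)
      ultimately have "(h p)\<^sup>2 \<le> 1" by (simp add: power2_eq_square)
      then show ?thesis by (simp add: abs_square_le_1)
    qed
    then have "h \<in> O1" by (auto simp: O1_def h_def)
    then show ?thesis using orth_iff[of h] D Dh by auto
  qed
  have cont: "continuous_on (O1 \<inter> O2 \<inter> O3) (\<lambda>h. f (?m h))"
    unfolding continuous_on_def
  proof
    fix h0
    have "((\<lambda>h. L * sqrt (\<Sum>i<?N. \<Sum>j<?N. (h (i, j) - h0 (i, j))\<^sup>2)) \<longlongrightarrow>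
        L * sqrt (\<Sum>i<?N. \<Sum>j<?N. (h0 (i, j) - h0 (i, j))\<^sup>2)) (at h0 within (O1 \<inter> O2 \<inter> O3))"
    proof (intro tendsto_intros)
      fix p :: "nat \<times> nat"
      have "continuous_on UNIV (\<lambda>h :: nat \<times> nat \<Rightarrow> real. h p)" by simp
      then show "((\<lambda>h. h p) \<longlongrightarrow> h0 p) (at h0 within (O1 \<inter> O2 \<inter> O3))"
        using continuous_on_subset unfolding continuous_on_def
        by (meson UNIV_I tendsto_within_subset top_greatest)
    qed
    then have lim: "((\<lambda>h. L * sqrt (\<Sum>i<?N. \<Sum>j<?N. (h (i, j) - h0 (i, j))\<^sup>2)) \<longlongrightarrow> 0) (at h0 within (O1 \<inter> O2 \<inter> O3))"
      by simp
    have bound: "norm (f (?m h) - f (?m h0)) \<le> L * sqrt (\<Sum>i<?N. \<Sum>j<?N. (h (i, j) - h0 (i, j))\<^sup>2)" for h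
      using lip[of "?m h" "?m h0"] by (simp add: frobenius_norm_def)
    show "((\<lambda>h. f (?m h)) \<longlongrightarrow> f (?m h0)) (at h0 within (O1 \<inter> O2 \<inter> O3))"
    proof (rule LIM_zero_cancel, rule tendsto_0_le[OF lim, of _ 1], rule always_eventually, rule allI)
      fix h
      show "norm (f (?m h) - f (?m h0)) \<le> norm (L * sqrt (\<Sum>i<?N. \<Sum>j<?N. (h (i, j) - h0 (i, j))\<^sup>2)) * 1"
        using bound[of h] abs_ge_self order_trans unfolding real_norm_def mult_1_right by blast
    qed
  qed
  have "O1 \<inter> O2 \<inter> O3 \<noteq> {}" using rep[OF one_block_orthogonal] by blast
  then obtain h where h: "h \<in> O1 \<inter> O2 \<inter> O3" "\<And>h'. h' \<in> O1 \<inter> O2 \<inter> O3 \<Longrightarrow> f (?m h) \<le> f (?m h')"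
    using continuous_attains_inf[OF comp _ cont] by blast
  show thesis
  proof
    show "?m h \<in> block_orthogonal ns" using orth_iff h by blast
    show "f (?m h) \<le> f D" if "D \<in> block_orthogonal ns" for D using rep[OF that] h(2) by auto
  qed
qed

section \<open>Polar factor\<close>

definition reflection :: "nat \<Rightarrow> real vec \<Rightarrow> real mat" where
  "reflection n v = mat n n (\<lambda>(i, j). (if i = j then 1 else 0) - 2 * (v $ i * v $ j))"

lemma reflection_mult:
  assumes "u \<in> carrier_vec n" "v \<in> carrier_vec n"
  shows "reflection n u * reflection n v = mat n n (\<lambda>(i, j). (if i = j then 1 else 0)
    - 2 * (u $ i * u $ j) - 2 * (v $ i * v $ j) + 4 * (u \<bullet> v) * (u $ i * v $ j))"
proof (rule eq_matI)
  fix i j assume "i < dim_row (mat n n (\<lambda>(i, j). (if i = j then 1 else 0)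
    - 2 * (u $ i * u $ j) - 2 * (v $ i * v $ j) + 4 * (u \<bullet> v) * (u $ i * v $ j)))"
    "j < dim_col (mat n n (\<lambda>(i, j). (if i = j then 1 else 0)
    - 2 * (u $ i * u $ j) - 2 * (v $ i * v $ j) + 4 * (u \<bullet> v) * (u $ i * v $ j)))"
  then have ij: "i < n" "j < n" by auto
  have "(reflection n u * reflection n v) $$ (i, j) =
      (\<Sum>k<n. ((if i = k then 1 else 0) - 2 * (u $ i * u $ k)) * ((if k = j then 1 else 0) - 2 * (v $ k * v $ j)))"
    using ij by (simp add: reflection_def scalar_prod_def lessThan_atLeast0)
  also have "\<dots> = (\<Sum>k<n. (if k = i then (if k = j then 1 else 0) - 2 * (v $ k * v $ j) else 0)
      - (if k = j then 2 * (u $ i * u $ k) else 0) + 4 * (u $ k * v $ k) * (u $ i * v $ j))"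
    by (intro sum.cong refl) (auto simp: algebra_simps)
  also have "\<dots> = (if i = j then 1 else 0) - 2 * (v $ i * v $ j) - 2 * (u $ i * u $ j)
      + 4 * (\<Sum>k<n. u $ k * v $ k) * (u $ i * v $ j)"
    using ij by (simp add: sum.distrib sum_subtractf sum_distrib_left sum_distrib_right)
  finally show "(reflection n u * reflection n v) $$ (i, j) = mat n n (\<lambda>(i, j). (if i = j then 1 else 0)
    - 2 * (u $ i * u $ j) - 2 * (v $ i * v $ j) + 4 * (u \<bullet> v) * (u $ i * v $ j)) $$ (i, j)"
    using ij assms by (simp add: scalar_prod_def lessThan_atLeast0)
qed (auto simp: reflection_def)

lemma reflection_block_orthogonal:
  assumes v: "v \<in> carrier_vec (sum_list ns)" "v \<bullet> v = 1"
    and supp: "\<And>i. i < sum_list ns \<Longrightarrow> blk ns i \<noteq> k \<Longrightarrow> v $ i = 0"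
  shows "reflection (sum_list ns) v \<in> block_orthogonal ns"
proof -
  let ?N = "sum_list ns"
  have sym: "(reflection ?N v)\<^sup>T = reflection ?N v"
    by (intro eq_matI) (auto simp: reflection_def mult.commute)
  have "(reflection ?N v)\<^sup>T * reflection ?N v = 1\<^sub>m ?N"
    unfolding sym reflection_mult[OF v(1) v(1)] v(2) by (intro eq_matI) auto
  moreover have "reflection ?N v $$ (i, l) = 0" if il: "i < ?N" "l < ?N" "blk ns i \<noteq> blk ns l" for i l
  proof -
    have "v $ i = 0 \<or> v $ l = 0" using il supp by metis
    then show ?thesis using il by (auto simp: reflection_def)
  qed
  moreover have "reflection ?N v \<in> carrier_mat ?N ?N" by (simp add: reflection_def)
  ultimately show ?thesis by (simp add: block_orthogonal_def block_diagonal_iff)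
qed

lemma sum_two_points:
  fixes f :: "nat \<Rightarrow> real"
  assumes "i < n" "j < n" "i \<noteq> j"
  shows "(\<Sum>k<n. (if k = i then c else if k = j then s else 0) * f k) = c * f i + s * f j"
proof -
  have "(\<Sum>k<n. (if k = i then c else if k = j then s else 0) * f k) =
      (\<Sum>k<n. (if k = i then c * f k else 0) + (if k = j then s * f k else 0))"
    using assms by (intro sum.cong) auto
  then show ?thesis using assms by (simp add: sum.distrib)
qed

text \<open>Maximizing \<open>\<langle>U, X\<rangle>\<close> over the block diagonal orthogonal matrices makes \<open>H = U\<^sup>T X\<close> symmetric and
  positive semidefinite on each block: one reflection gives \<open>v \<bullet> H v \<ge> 0\<close>, and a product of two
  nearby reflections is a small rotation, whose first order term is the antisymmetric part.\<close>

lemma block_polar: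
  assumes X: "X \<in> block_diagonal ns"
  obtains U where "U \<in> block_orthogonal ns" "(U\<^sup>T * X)\<^sup>T = U\<^sup>T * X"
    "\<And>v k. v \<in> carrier_vec (sum_list ns) \<Longrightarrow> (\<And>i. i < sum_list ns \<Longrightarrow> blk ns i \<noteq> k \<Longrightarrow> v $ i = 0) \<Longrightarrow>
       0 \<le> v \<bullet> ((U\<^sup>T * X) *\<^sub>v v)"
proof -
  let ?N = "sum_list ns"
  have Xc: "X \<in> carrier_mat ?N ?N" using X by (simp add: block_diagonal_iff)
  define ip where "ip A B = (\<Sum>i<?N. \<Sum>j<?N. A $$ (i, j) * B $$ (i, j))" for A B :: "real mat"
  have lip: "\<bar>- ip A X - - ip B X\<bar> \<le> frobenius_norm X * frobenius_norm (A - B)"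
    if AB: "A \<in> carrier_mat ?N ?N" "B \<in> carrier_mat ?N ?N" for A B
  proof -
    let ?I = "{..<?N} \<times> {..<?N}"
    have "- ip A X - - ip B X = (\<Sum>p\<in>?I. - ((A - B) $$ p * X $$ p))"
      using AB unfolding ip_def sum_negf[symmetric] sum_subtractf[symmetric] sum.cartesian_product
      by (intro sum.cong refl) (auto simp: algebra_simps)
    also have "\<bar>\<dots>\<bar> \<le> (\<Sum>p\<in>?I. \<bar>(A - B) $$ p\<bar> * \<bar>X $$ p\<bar>)"
      by (rule order_trans[OF sum_abs]) (simp add: abs_mult)
    also have "\<dots> \<le> L2_set (\<lambda>p. (A - B) $$ p) ?I * L2_set (\<lambda>p. X $$ p) ?I"
      by (rule L2_set_mult_ineq)
    also have "\<dots> = frobenius_norm X * frobenius_norm (A - B)"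
      using AB Xc by (simp add: frobenius_norm_L2_set case_prod_unfold)
    finally show ?thesis .
  qed
  obtain U where U: "U \<in> block_orthogonal ns" and max: "\<And>D. D \<in> block_orthogonal ns \<Longrightarrow> - ip U X \<le> - ip D X"
    using block_orthogonal_minimum[of ns "\<lambda>A. - ip A X" "frobenius_norm X", OF lip] by metis
  note u = block_orthogonalD[OF U]
  define H where "H = U\<^sup>T * X"
  have Hc: "H \<in> carrier_mat ?N ?N" using u Xc by (simp add: H_def)
  have Hbd: "H \<in> block_diagonal ns"
    unfolding H_def by (rule block_diagonal_mult[OF block_diagonal_transpose[OF u(1)] X])
  have ip_mult: "ip (U * R) X = ip R H" if R: "R \<in> carrier_mat ?N ?N" for R
  proof -
    have "ip (U * R) X = (\<Sum>i<?N. \<Sum>j<?N. \<Sum>k<?N. U $$ (i, k) * R $$ (k, j) * X $$ (i, j))"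
      unfolding ip_def using u(2) R
      by (intro sum.cong refl) (simp only: mult_mat_index lessThan_iff sum_distrib_right)
    also have "\<dots> = (\<Sum>k<?N. \<Sum>j<?N. \<Sum>i<?N. U $$ (i, k) * R $$ (k, j) * X $$ (i, j))"
      by (subst sum.swap, subst (2) sum.swap, subst sum.swap) (rule refl)
    also have "\<dots> = ip R H"
    proof -
      have UT: "U\<^sup>T \<in> carrier_mat ?N ?N" using u by simp
      show ?thesis unfolding ip_def H_def
      proof (intro sum.cong refl)
        fix k j assume "k \<in> {..<?N}" "j \<in> {..<?N}"
        then have kj: "k < ?N" "j < ?N" by auto
        show "(\<Sum>i<?N. U $$ (i, k) * R $$ (k, j) * X $$ (i, j)) = R $$ (k, j) * (U\<^sup>T * X) $$ (k, j)"
          unfolding mult_mat_index[OF UT Xc kj] sum_distrib_left using u(2) kj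
          by (intro sum.cong refl) auto
      qed
    qed
    finally show ?thesis .
  qed
  have "ip U X = ip (1\<^sub>m ?N) H" using ip_mult[of "1\<^sub>m ?N"] u(2) by simp
  then have opt: "ip R H \<le> ip (1\<^sub>m ?N) H" if "R \<in> block_orthogonal ns" for R
    using max[OF block_orthogonal_mult[OF U that]] ip_mult[OF block_orthogonalD(2)[OF that]] by simp
  have quad: "v \<bullet> (H *\<^sub>v w) = (\<Sum>i<?N. \<Sum>j<?N. v $ i * w $ j * H $$ (i, j))"
    if "v \<in> carrier_vec ?N" "w \<in> carrier_vec ?N" for v w
    using that Hc by (auto simp: scalar_prod_def lessThan_atLeast0 sum_distrib_left mult_ac intro!: sum.cong)
  have one_refl: "0 \<le> v \<bullet> (H *\<^sub>v v)"
    if v: "v \<in> carrier_vec ?N" "v \<bullet> v = 1" "\<And>i. i < ?N \<Longrightarrow> blk ns i \<noteq> k \<Longrightarrow> v $ i = 0" for v k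
  proof -
    have "ip (reflection ?N v) H = (\<Sum>i<?N. \<Sum>j<?N. 1\<^sub>m ?N $$ (i, j) * H $$ (i, j) - 2 * (v $ i * v $ j * H $$ (i, j)))"
      unfolding ip_def by (intro sum.cong refl) (auto simp: reflection_def algebra_simps)
    also have "\<dots> = ip (1\<^sub>m ?N) H - 2 * (v \<bullet> (H *\<^sub>v v))"
      unfolding quad[OF v(1) v(1)] by (simp add: ip_def sum_subtractf sum_distrib_left)
    finally have "ip (reflection ?N v) H = ip (1\<^sub>m ?N) H - 2 * (v \<bullet> (H *\<^sub>v v))" .
    moreover have "reflection ?N v \<in> block_orthogonal ns"
      by (rule reflection_block_orthogonal[where k = k]) (use v in auto)
    ultimately show ?thesis using opt[of "reflection ?N v"] by simp
  qed
  have two_refl: "2 * (v \<bullet> w) * (v \<bullet> (H *\<^sub>v w)) \<le> v \<bullet> (H *\<^sub>v v) + w \<bullet> (H *\<^sub>v w)"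
    if v: "v \<in> carrier_vec ?N" "v \<bullet> v = 1" "\<And>i. i < ?N \<Longrightarrow> blk ns i \<noteq> k \<Longrightarrow> v $ i = 0"
      and w: "w \<in> carrier_vec ?N" "w \<bullet> w = 1" "\<And>i. i < ?N \<Longrightarrow> blk ns i \<noteq> k \<Longrightarrow> w $ i = 0" for v w k
  proof -
    have "ip (reflection ?N v * reflection ?N w) H = (\<Sum>i<?N. \<Sum>j<?N. 1\<^sub>m ?N $$ (i, j) * H $$ (i, j)
        - 2 * (v $ i * v $ j * H $$ (i, j)) - 2 * (w $ i * w $ j * H $$ (i, j))
        + 4 * (v \<bullet> w) * (v $ i * w $ j * H $$ (i, j)))"
      unfolding ip_def reflection_mult[OF v(1) w(1)] by (intro sum.cong refl) (auto simp: algebra_simps)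
    also have "\<dots> = ip (1\<^sub>m ?N) H - 2 * (v \<bullet> (H *\<^sub>v v)) - 2 * (w \<bullet> (H *\<^sub>v w)) + 4 * (v \<bullet> w) * (v \<bullet> (H *\<^sub>v w))"
      unfolding quad[OF v(1) v(1)] quad[OF w(1) w(1)] quad[OF v(1) w(1)]
      by (simp add: ip_def sum_subtractf sum.distrib sum_distrib_left)
    finally have "ip (reflection ?N v * reflection ?N w) H = ip (1\<^sub>m ?N) H - 2 * (v \<bullet> (H *\<^sub>v v))
        - 2 * (w \<bullet> (H *\<^sub>v w)) + 4 * (v \<bullet> w) * (v \<bullet> (H *\<^sub>v w))" .
    moreover have "reflection ?N v \<in> block_orthogonal ns" "reflection ?N w \<in> block_orthogonal ns"
      by (rule reflection_block_orthogonal[where k = k]; use v w in auto)+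
    ultimately show ?thesis
      using opt[OF block_orthogonal_mult, of "reflection ?N v" "reflection ?N w"] by simp
  qed
  have sym: "H $$ (j, i) = H $$ (i, j)" if ij: "i < ?N" "j < ?N" for i j
  proof (cases "i = j \<or> blk ns i \<noteq> blk ns j")
    case True
    then show ?thesis using Hbd ij by (auto simp: block_diagonal_iff)
  next
    case False
    then have ne: "i \<noteq> j" and b: "blk ns j = blk ns i" by auto
    have "(H $$ (j, i) - H $$ (i, j)) / 2 = 0"
    proof (rule linear_term_zero)
      fix x :: real
      define d where "d = sqrt (1 + x\<^sup>2)"
      have d: "d > 0" "d\<^sup>2 = 1 + x\<^sup>2" by (auto simp: d_def add_pos_nonneg)
      define c s where "c = 1 / d" and "s = x / d"
      \<comment> \<open>\<open>v\<close> is the unit vector at \<open>i\<close>, written in the form of \<open>w\<close>; and \<open>w\<close> is \<open>v\<close> turned towards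
        the unit vector at \<open>j\<close> by the angle with tangent \<open>x\<close>.\<close>
      define v where "v = vec ?N (\<lambda>k. if k = i then (1 :: real) else if k = j then 0 else 0)"
      define w where "w = vec ?N (\<lambda>k. if k = i then c else if k = j then s else 0)"
      have "c\<^sup>2 + s\<^sup>2 = (1 + x\<^sup>2) / d\<^sup>2" by (simp add: c_def s_def power_divide add_divide_distrib)
      then have cs: "c\<^sup>2 + s\<^sup>2 = 1" unfolding d(2)[symmetric] using d(1) by simp
      have pair: "vec ?N (\<lambda>k. if k = i then a else if k = j then e else 0) \<bullet>
          vec ?N (\<lambda>k. if k = i then a' else if k = j then e' else 0) = a * a' + e * e'" for a e a' e' :: real
      proof -
        have "vec ?N (\<lambda>k. if k = i then a else if k = j then e else 0) \<bullet>
          vec ?N (\<lambda>k. if k = i then a' else if k = j then e' else 0) =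
          (\<Sum>k<?N. (if k = i then a else if k = j then e else 0) * (if k = i then a' else if k = j then e' else 0))"
          by (auto simp: scalar_prod_def lessThan_atLeast0 intro!: sum.cong)
        also have "\<dots> = a * a' + e * e'" unfolding sum_two_points[OF ij ne] using ne by simp
        finally show ?thesis .
      qed
      have Hpair: "vec ?N (\<lambda>k. if k = i then a else if k = j then e else 0) \<bullet>
          (H *\<^sub>v vec ?N (\<lambda>k. if k = i then a' else if k = j then e' else 0)) =
          a * (a' * H $$ (i, i) + e' * H $$ (i, j)) + e * (a' * H $$ (j, i) + e' * H $$ (j, j))" for a e a' e' :: real
      proof -
        have "vec ?N (\<lambda>k. if k = i then a else if k = j then e else 0) \<bullet>
          (H *\<^sub>v vec ?N (\<lambda>k. if k = i then a' else if k = j then e' else 0)) =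
          (\<Sum>k<?N. (if k = i then a else if k = j then e else 0) *
            (\<Sum>l<?N. (if l = i then a' else if l = j then e' else 0) * H $$ (k, l)))"
          by (subst quad) (auto simp: sum_distrib_left mult_ac intro!: sum.cong)
        also have "\<dots> = (\<Sum>k<?N. (if k = i then a else if k = j then e else 0) * (a' * H $$ (k, i) + e' * H $$ (k, j)))"
          by (simp only: sum_two_points[OF ij ne, of a' e'])
        also have "\<dots> = a * (a' * H $$ (i, i) + e' * H $$ (i, j)) + e * (a' * H $$ (j, i) + e' * H $$ (j, j))"
          by (rule sum_two_points[OF ij ne])
        finally show ?thesis .
      qed
      have "2 * (v \<bullet> w) * (v \<bullet> (H *\<^sub>v w)) \<le> v \<bullet> (H *\<^sub>v v) + w \<bullet> (H *\<^sub>v w)"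
      proof (rule two_refl[where k = "blk ns i"])
        show "v \<bullet> v = 1" unfolding v_def pair by simp
        show "w \<bullet> w = 1" unfolding w_def pair using cs by (simp add: power2_eq_square)
      qed (use b in \<open>auto simp: v_def w_def\<close>)
      then have "2 * c * (c * H $$ (i, i) + s * H $$ (i, j)) \<le>
          H $$ (i, i) + (c * (c * H $$ (i, i) + s * H $$ (i, j)) + s * (c * H $$ (j, i) + s * H $$ (j, j)))"
        unfolding v_def w_def pair Hpair by simp
      moreover have "H $$ (i, i) = (c\<^sup>2 + s\<^sup>2) * H $$ (i, i)" using cs by simp
      ultimately have "0 \<le> s\<^sup>2 * (H $$ (i, i) + H $$ (j, j)) + c * s * (H $$ (j, i) - H $$ (i, j))"
        by (simp add: algebra_simps power2_eq_square)
      then have "0 \<le> d\<^sup>2 * (s\<^sup>2 * (H $$ (i, i) + H $$ (j, j)) + c * s * (H $$ (j, i) - H $$ (i, j)))"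
        by (intro mult_nonneg_nonneg) auto
      also have "\<dots> = 2 * x * ((H $$ (j, i) - H $$ (i, j)) / 2) + x\<^sup>2 * (H $$ (i, i) + H $$ (j, j))"
        using d(1) by (simp add: c_def s_def power2_eq_square field_simps)
      finally show "0 \<le> 2 * x * ((H $$ (j, i) - H $$ (i, j)) / 2) + x\<^sup>2 * (H $$ (i, i) + H $$ (j, j))" .
    qed
    then show ?thesis by simp
  qed
  have HT: "H\<^sup>T = H" using Hc sym by (intro eq_matI) auto
  have psd: "0 \<le> v \<bullet> (H *\<^sub>v v)"
    if v: "v \<in> carrier_vec ?N" "\<And>i. i < ?N \<Longrightarrow> blk ns i \<noteq> k \<Longrightarrow> v $ i = 0" for v k
  proof (cases "v = 0\<^sub>v ?N")
    case True
    then show ?thesis using Hc by simp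
  next
    case False
    then have pos: "0 < euclid_norm v" using euclid_norm_eq_0_iff[OF v(1)] by (simp add: less_le)
    let ?u = "(1 / euclid_norm v) \<cdot>\<^sub>v v"
    have "euclid_norm ?u = 1" unfolding euclid_norm_smult using pos by simp
    then have "?u \<bullet> ?u = 1" unfolding euclid_norm_sq_scalar[symmetric] by simp
    then have "0 \<le> ?u \<bullet> (H *\<^sub>v ?u)" by (intro one_refl[where k = k]) (use v in auto)
    also have "\<dots> = (1 / euclid_norm v)\<^sup>2 * (v \<bullet> (H *\<^sub>v v))"
      using v Hc by (simp add: mult_mat_vec[OF Hc] power2_eq_square)
    finally show ?thesis using pos by (simp add: zero_le_mult_iff)
  qed
  show thesis using that[OF U] HT psd unfolding H_def by blast
qed

text \<open>For symmetric \<open>S\<close> the bound is attained at an eigenvector of \<open>S\<^sup>2\<close>, and then \<open>S\<close> itself has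
  an eigenvector with eigenvalue \<open>\<plusminus>\<lambda>\<close>.\<close>

lemma symmetric_norm_le:
  fixes S :: "real mat"
  assumes S: "S \<in> carrier_mat n n" "S\<^sup>T = S" and c: "0 \<le> c"
    and ev: "\<And>x e. x \<in> carrier_vec n \<Longrightarrow> x \<noteq> 0\<^sub>v n \<Longrightarrow> S *\<^sub>v x = e \<cdot>\<^sub>v x \<Longrightarrow> \<bar>e\<bar> \<le> c"
    and y: "y \<in> carrier_vec n"
  shows "euclid_norm (S *\<^sub>v y) \<le> c * euclid_norm y"
proof (cases "n = 0")
  case True
  then show ?thesis using S y by (simp add: euclid_norm_L2_set)
next
  case False
  define B where "B = - (S\<^sup>T * S)"
  have SS: "S\<^sup>T * S \<in> carrier_mat n n" using S by simp
  have B: "B \<in> carrier_mat n n" "B\<^sup>T = B" using S(1)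
    by (auto simp: B_def transpose_uminus transpose_mult[of _ n n])
  have Bv: "B *\<^sub>v z = - ((S\<^sup>T * S) *\<^sub>v z)" if "z \<in> carrier_vec n" for z
    unfolding B_def using that SS by (intro uminus_mult_mat_vec) auto
  obtain e x where x: "x \<in> carrier_vec n" "x \<noteq> 0\<^sub>v n" "B *\<^sub>v x = e \<cdot>\<^sub>v x"
    and low: "\<And>y. y \<in> carrier_vec n \<Longrightarrow> e * (y \<bullet> y) \<le> y \<bullet> (B *\<^sub>v y)"
    using min_eigenvector[OF B] False by blast
  have upper: "(euclid_norm (S *\<^sub>v z))\<^sup>2 \<le> - e * (euclid_norm z)\<^sup>2" if z: "z \<in> carrier_vec n" for z
  proof -
    have SSz: "(S\<^sup>T * S) *\<^sub>v z \<in> carrier_vec n" using SS z by (rule mult_mat_vec_carrier)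
    have "e * (z \<bullet> z) \<le> - (z \<bullet> ((S\<^sup>T * S) *\<^sub>v z))"
    proof -
      have "z \<bullet> - ((S\<^sup>T * S) *\<^sub>v z) = - (z \<bullet> ((S\<^sup>T * S) *\<^sub>v z))"
        by (rule scalar_prod_uminus_right) (use z S in simp)
      then show ?thesis using low[OF z] unfolding Bv[OF z] by simp
    qed
    then show ?thesis unfolding scalar_prod_gram[OF S(1) z] euclid_norm_sq_scalar[of z] by simp
  qed
  have SSx: "(S\<^sup>T * S) *\<^sub>v x = (- e) \<cdot>\<^sub>v x"
  proof -
    have "(S\<^sup>T * S) *\<^sub>v x = - (B *\<^sub>v x)" unfolding Bv[OF x(1)] by simp
    then show ?thesis unfolding x(3) by auto
  qed
  from gram_eigenvector_singular_value(3)[OF S(1) x(1,2) SSx] have e: "0 \<le> - e" .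
  define l where "l = sqrt (- e)"
  have l: "0 \<le> l" "l * l = - e" using e by (auto simp: l_def)
  have Sx: "S *\<^sub>v x \<in> carrier_vec n" using S x by auto
  have SSx': "S *\<^sub>v (S *\<^sub>v x) = (l * l) \<cdot>\<^sub>v x"
    using SSx assoc_mult_mat_vec[OF S(1) S(1) x(1)] unfolding S(2) l(2) by simp
  have "l \<le> c"
  proof (cases "S *\<^sub>v x + l \<cdot>\<^sub>v x = 0\<^sub>v n")
    case True
    have "S *\<^sub>v x = (- l) \<cdot>\<^sub>v x"
    proof (rule eq_vecI)
      fix i assume "i < dim_vec ((- l) \<cdot>\<^sub>v x)"
      then have i: "i < n" using x by simp
      have "(S *\<^sub>v x) $ i + l * x $ i = 0" using arg_cong[OF True, of "\<lambda>v. v $ i"] i x Sx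
        by (simp del: index_mult_mat_vec)
      then show "(S *\<^sub>v x) $ i = ((- l) \<cdot>\<^sub>v x) $ i" using i x by (simp del: index_mult_mat_vec)
    qed (use S x in auto)
    from ev[OF x(1,2) this] show ?thesis using l by simp
  next
    case False
    have "S *\<^sub>v (S *\<^sub>v x + l \<cdot>\<^sub>v x) = l \<cdot>\<^sub>v (S *\<^sub>v x + l \<cdot>\<^sub>v x)"
      using S x Sx SSx'
      by (simp add: mult_add_distrib_mat_vec[OF S(1)] mult_mat_vec[OF S(1)] smult_add_distrib_vec[of _ n] smult_smult_assoc
          comm_add_vec[of _ n])
    from ev[OF _ False this] show ?thesis using l x Sx by auto
  qed
  have "(euclid_norm (S *\<^sub>v y))\<^sup>2 \<le> (l * euclid_norm y)\<^sup>2"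
    using upper[OF y] unfolding l(2)[symmetric] by (simp add: power2_eq_square mult_ac)
  then have "euclid_norm (S *\<^sub>v y) \<le> l * euclid_norm y" by (rule power2_le_imp_le) (use l in simp)
  also have "\<dots> \<le> c * euclid_norm y" by (rule mult_right_mono[OF \<open>l \<le> c\<close>]) simp
  finally show ?thesis .
qed

text \<open>For the polar factor \<open>U\<close> the matrix \<open>S = U\<^sup>T X - I\<close> is symmetric, so it suffices to bound its
  eigenvalues. An eigenvector is first cut down to one block, where \<open>U\<^sup>T X\<close> is known to be positive
  semidefinite; there \<open>\<parallel>X z\<parallel> = (1 + l) \<parallel>z\<parallel>\<close> with \<open>1 + l \<ge> 0\<close>, so the bounds for \<open>X\<close> apply to \<open>1 + l\<close>.\<close>

lemma nearest_block_orthogonal: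
  assumes X: "X \<in> block_diagonal ns"
    and lower: "\<And>y. y \<in> carrier_vec (sum_list ns) \<Longrightarrow> \<beta>1 * euclid_norm y \<le> euclid_norm (X *\<^sub>v y)"
    and upper: "\<And>y. y \<in> carrier_vec (sum_list ns) \<Longrightarrow> euclid_norm (X *\<^sub>v y) \<le> \<beta>2 * euclid_norm y"
    and c: "0 \<le> c" "\<beta>2 - 1 \<le> c" "1 - \<beta>1 \<le> c"
  obtains U where "U \<in> block_orthogonal ns"
    "\<And>y. y \<in> carrier_vec (sum_list ns) \<Longrightarrow> euclid_norm (X *\<^sub>v y - U *\<^sub>v y) \<le> c * euclid_norm y"
proof -
  let ?N = "sum_list ns"
  have Xc: "X \<in> carrier_mat ?N ?N" using X by (simp add: block_diagonal_iff)
  obtain U where U: "U \<in> block_orthogonal ns" and HT: "(U\<^sup>T * X)\<^sup>T = U\<^sup>T * X" and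
    psd: "\<And>v k. v \<in> carrier_vec ?N \<Longrightarrow> (\<And>i. i < ?N \<Longrightarrow> blk ns i \<noteq> k \<Longrightarrow> v $ i = 0) \<Longrightarrow>
       0 \<le> v \<bullet> ((U\<^sup>T * X) *\<^sub>v v)"
    using block_polar[OF X] by blast
  note u = block_orthogonalD[OF U]
  define H where "H = U\<^sup>T * X"
  have UT: "U\<^sup>T \<in> carrier_mat ?N ?N" using u by simp
  have Hc: "H \<in> carrier_mat ?N ?N" unfolding H_def using UT Xc by (rule mult_carrier_mat)
  have Hbd: "H \<in> block_diagonal ns"
    unfolding H_def by (rule block_diagonal_mult[OF block_diagonal_transpose[OF u(1)] X])
  have Hy: "H *\<^sub>v y = U\<^sup>T *\<^sub>v (X *\<^sub>v y)" if "y \<in> carrier_vec ?N" for y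
    unfolding H_def by (rule assoc_mult_mat_vec[OF UT Xc that])
  have normH: "euclid_norm (H *\<^sub>v y) = euclid_norm (X *\<^sub>v y)" if y: "y \<in> carrier_vec ?N" for y
    unfolding Hy[OF y] by (rule euclid_norm_isometry[OF UT]) (use u Xc y in auto)
  define S where "S = H - 1\<^sub>m ?N"
  have Sc: "S \<in> carrier_mat ?N ?N" "S\<^sup>T = S"
    using Hc HT[folded H_def] by (auto simp: S_def transpose_minus[of _ ?N ?N] transpose_one)
  have Sy: "S *\<^sub>v y = H *\<^sub>v y - y" if "y \<in> carrier_vec ?N" for y
    using minus_mult_distrib_mat_vec[OF Hc one_carrier_mat that] that by (simp add: S_def)
  have Sbound: "euclid_norm (S *\<^sub>v y) \<le> c * euclid_norm y" if y: "y \<in> carrier_vec ?N" for y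
  proof (rule symmetric_norm_le[OF Sc c(1) _ y])
    fix x l assume x: "x \<in> carrier_vec ?N" "x \<noteq> 0\<^sub>v ?N" and Sx: "S *\<^sub>v x = l \<cdot>\<^sub>v x"
    have Hx: "(H *\<^sub>v x) $ i = (1 + l) * x $ i" if "i < ?N" for i
      using arg_cong[OF Sx, of "\<lambda>v. v $ i"] that x Hc unfolding Sy[OF x(1)]
      by (simp add: algebra_simps del: index_mult_mat_vec)
    obtain i0 where i0: "i0 < ?N" "x $ i0 \<noteq> 0" using x by (metis eq_vecI carrier_vecD index_zero_vec)
    define z where "z = vec ?N (\<lambda>i. if blk ns i = blk ns i0 then x $ i else 0)"
    have z: "z \<in> carrier_vec ?N" by (simp add: z_def)
    have "z $ i0 \<noteq> 0" using i0 by (simp add: z_def)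
    then have "z \<noteq> 0\<^sub>v ?N" using i0 by auto
    then have nz: "0 < euclid_norm z" using euclid_norm_eq_0_iff[OF z] by (simp add: less_le)
    have Hz: "H *\<^sub>v z = (1 + l) \<cdot>\<^sub>v z"
    proof (rule eq_vecI)
      fix i assume "i < dim_vec ((1 + l) \<cdot>\<^sub>v z)"
      then have i: "i < ?N" by (simp add: z_def)
      have "(H *\<^sub>v z) $ i = (\<Sum>j<?N. if blk ns i = blk ns i0 then H $$ (i, j) * x $ j else 0)"
        unfolding mult_mat_vec_index[OF Hc z i]
        using Hbd i by (intro sum.cong refl) (auto simp: z_def block_diagonal_iff)
      also have "\<dots> = (if blk ns i = blk ns i0 then (H *\<^sub>v x) $ i else 0)"
        unfolding mult_mat_vec_index[OF Hc x(1) i] by simp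
      finally show "(H *\<^sub>v z) $ i = ((1 + l) \<cdot>\<^sub>v z) $ i" using i Hx[OF i] by (simp add: z_def)
    qed (use Hc in \<open>auto simp: z_def\<close>)
    have "0 \<le> z \<bullet> (H *\<^sub>v z)"
      unfolding H_def by (rule psd[OF z, of "blk ns i0"]) (simp add: z_def)
    also have "\<dots> = (1 + l) * (euclid_norm z)\<^sup>2" unfolding Hz using z by (simp add: euclid_norm_sq_scalar)
    finally have l1: "0 \<le> 1 + l" using nz by (simp add: zero_le_mult_iff)
    have "euclid_norm (X *\<^sub>v z) = (1 + l) * euclid_norm z"
      unfolding normH[OF z, symmetric] Hz euclid_norm_smult using l1 by simp
    then have "\<beta>1 \<le> 1 + l" "1 + l \<le> \<beta>2" using lower[OF z] upper[OF z] nz by simp_all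
    then show "\<bar>l\<bar> \<le> c" using c by linarith
  qed
  show thesis
  proof (rule that[OF U])
    fix y :: "real vec" assume y: "y \<in> carrier_vec ?N"
    have Xy: "X *\<^sub>v y \<in> carrier_vec ?N" "H *\<^sub>v y \<in> carrier_vec ?N" using Xc Hc y by auto
    have "U *\<^sub>v (H *\<^sub>v y) = X *\<^sub>v y"
      unfolding Hy[OF y] using assoc_mult_mat_vec[OF u(2) UT Xy(1)] Xy(1) by (simp add: u(4))
    then have "X *\<^sub>v y - U *\<^sub>v y = U *\<^sub>v (S *\<^sub>v y)"
      unfolding Sy[OF y] using mult_minus_distrib_mat_vec[OF u(2) Xy(2) y] by simp
    then have "euclid_norm (X *\<^sub>v y - U *\<^sub>v y) = euclid_norm (S *\<^sub>v y)"
      using euclid_norm_isometry[OF u(2,3), of "S *\<^sub>v y"] Sc y by simp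
    then show "euclid_norm (X *\<^sub>v y - U *\<^sub>v y) \<le> c * euclid_norm y" using Sbound[OF y] by simp
  qed
qed

section \<open>From the off-diagonal bound to the block orthogonal approximation\<close>

lemma L2_set_sum_le:
  assumes "finite J"
  shows "L2_set (\<lambda>i. \<Sum>k\<in>J. f k i) I \<le> (\<Sum>k\<in>J. L2_set (f k) I)"
  using assms
proof (induction J rule: finite_induct)
  case (insert k J)
  have "L2_set (\<lambda>i. f k i + (\<Sum>k\<in>J. f k i)) I \<le> L2_set (f k) I + L2_set (\<lambda>i. \<Sum>k\<in>J. f k i) I"
    by (rule L2_set_triangle_ineq)
  then show ?case using insert by simp
qed (simp add: L2_set_0')

lemma sum_le_sqrt_card:
  fixes a :: "'a \<Rightarrow> real"
  shows "(\<Sum>k\<in>J. a k) \<le> sqrt (card J) * sqrt (\<Sum>k\<in>J. (a k)\<^sup>2)"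
proof -
  have "(\<Sum>k\<in>J. a k) \<le> (\<Sum>k\<in>J. \<bar>1\<bar> * \<bar>a k\<bar>)" by (rule sum_mono) simp
  also have "\<dots> \<le> L2_set (\<lambda>_. 1) J * L2_set a J" by (rule L2_set_mult_ineq)
  also have "\<dots> = sqrt (card J) * sqrt (\<Sum>k\<in>J. (a k)\<^sup>2)" by (simp add: L2_set_def)
  finally show ?thesis .
qed

context matched_block_perturbation
begin

definition part :: "nat \<Rightarrow> real vec \<Rightarrow> real vec" where
  "part k y = vec n (\<lambda>i. if b i = k then y $ i else 0)"

lemma part_supp: "part k y \<in> supp k"
  by (simp add: part_def supp_def)

lemma supp_carrier: "y \<in> supp k \<Longrightarrow> y \<in> carrier_vec n"
  by (simp add: supp_def)

lemma norm_parts: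
  assumes y: "y \<in> carrier_vec n"
  shows "(euclid_norm y)\<^sup>2 = (\<Sum>k<t. (euclid_norm (part k y))\<^sup>2)"
proof -
  have "(\<Sum>k<t. (euclid_norm (part k y))\<^sup>2) = (\<Sum>k<t. \<Sum>i<n. if b i = k then (y $ i)\<^sup>2 else 0)"
    by (auto simp: euclid_norm_sq part_def intro!: sum.cong)
  also have "\<dots> = (\<Sum>i<n. \<Sum>k<t. if b i = k then (y $ i)\<^sup>2 else 0)" by (rule sum.swap)
  also have "\<dots> = (\<Sum>i<n. (y $ i)\<^sup>2)" using label by (intro sum.cong refl) simp
  finally show ?thesis using y by (simp add: euclid_norm_sq)
qed

text \<open>The triangle inequality over the blocks and Cauchy--Schwarz. This is the source of the factors
  \<open>\<surd>t\<close> and \<open>\<surd>(t - 1)\<close> in the error bound.\<close>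

lemma norm_mult_parts_le:
  assumes A: "A \<in> carrier_mat r n" and y: "y \<in> carrier_vec n" and J: "J \<subseteq> {..<t}"
    and vanish: "\<And>i. i < n \<Longrightarrow> b i \<notin> J \<Longrightarrow> y $ i = 0"
  shows "euclid_norm (A *\<^sub>v y) \<le> sqrt (card J) * sqrt (\<Sum>k\<in>J. (euclid_norm (A *\<^sub>v part k y))\<^sup>2)"
proof -
  have fin: "finite J" using J finite_subset by blast
  have c: "part k y \<in> carrier_vec n" for k by (simp add: part_def)
  have entry: "(A *\<^sub>v y) $ i = (\<Sum>k\<in>J. (A *\<^sub>v part k y) $ i)" if i: "i < r" for i
  proof -
    have "(\<Sum>k\<in>J. (A *\<^sub>v part k y) $ i) = (\<Sum>l<n. \<Sum>k\<in>J. A $$ (i, l) * (if b l = k then y $ l else 0))"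
      unfolding mult_mat_vec_index[OF A c i] by (subst sum.swap) (simp add: part_def)
    also have "\<dots> = (\<Sum>l<n. A $$ (i, l) * y $ l)"
    proof (intro sum.cong refl)
      fix l assume "l \<in> {..<n}"
      then show "(\<Sum>k\<in>J. A $$ (i, l) * (if b l = k then y $ l else 0)) = A $$ (i, l) * y $ l"
        using vanish[of l] fin by (cases "b l \<in> J") (auto simp: if_distrib[of "\<lambda>c. _ * c"] sum.delta' intro!: sum.neutral cong: if_cong)
    qed
    finally show ?thesis unfolding mult_mat_vec_index[OF A y i] by simp
  qed
  have "euclid_norm (A *\<^sub>v y) = L2_set (\<lambda>i. \<Sum>k\<in>J. (A *\<^sub>v part k y) $ i) {..<r}"
    unfolding euclid_norm_L2_set using A entry by (intro L2_set_cong) auto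
  also have "\<dots> \<le> (\<Sum>k\<in>J. L2_set (\<lambda>i. (A *\<^sub>v part k y) $ i) {..<r})" by (rule L2_set_sum_le[OF fin])
  also have "\<dots> = (\<Sum>k\<in>J. euclid_norm (A *\<^sub>v part k y))" using A by (simp add: euclid_norm_L2_set)
  also have "\<dots> \<le> sqrt (card J) * sqrt (\<Sum>k\<in>J. (euclid_norm (A *\<^sub>v part k y))\<^sup>2)" by (rule sum_le_sqrt_card)
  finally show ?thesis .
qed

text \<open>\<open>X\<close> maps block \<open>j\<close> into block \<open>\<pi> j\<close>, so the images of different blocks are orthogonal.\<close>

lemma norm_X_parts:
  assumes \<pi>: "bij_betw \<pi> {..<t} {..<t}" and y: "y \<in> carrier_vec n"
  shows "(euclid_norm (X *\<^sub>v y))\<^sup>2 = (\<Sum>j<t. (euclid_norm (X *\<^sub>v part j y))\<^sup>2)"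
proof -
  have eq: "part (\<pi> j) (X *\<^sub>v y) = X *\<^sub>v part j y" if j: "j < t" for j
  proof (rule eq_vecI)
    fix i assume "i < dim_vec (X *\<^sub>v part j y)"
    then have i: "i < n" by (simp add: carrier_matD[OF XY_carrier(1)])
    have c: "part j y \<in> carrier_vec n" by (simp add: part_def)
    show "part (\<pi> j) (X *\<^sub>v y) $ i = (X *\<^sub>v part j y) $ i"
    proof (cases "b i = \<pi> j")
      case True
      have "(X *\<^sub>v part j y) $ i = (\<Sum>l<n. X $$ (i, l) * y $ l)"
        unfolding mult_mat_vec_index[OF XY_carrier(1) c i]
      proof (intro sum.cong refl)
        fix l assume "l \<in> {..<n}"
        then have l: "l < n" by simp
        show "X $$ (i, l) * part j y $ l = X $$ (i, l) * y $ l"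
        proof (cases "b l = j")
          case False
          then have "\<pi> (b l) \<noteq> \<pi> j"
            using bij_betw_imp_inj_on[OF \<pi>] label[OF l] j by (auto dest: inj_onD)
          then have "X $$ (i, l) = 0" using True i l by (simp add: X_def)
          then show ?thesis by simp
        qed (use l in \<open>simp add: part_def\<close>)
      qed
      then show ?thesis
        unfolding part_def using True i by (simp add: mult_mat_vec_index[OF XY_carrier(1) y i] del: index_mult_mat_vec)
    next
      case False
      then show ?thesis using i unfolding XY_supp[OF part_supp i] by (simp add: part_def)
    qed
  qed (simp add: part_def carrier_matD[OF XY_carrier(1)])
  have "(euclid_norm (X *\<^sub>v y))\<^sup>2 = (\<Sum>k<t. (euclid_norm (part k (X *\<^sub>v y)))\<^sup>2)"
    by (rule norm_parts) (rule mult_mat_vec_carrier[OF XY_carrier(1) y])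
  also have "\<dots> = (\<Sum>j<t. (euclid_norm (part (\<pi> j) (X *\<^sub>v y)))\<^sup>2)"
    by (rule sum.reindex_bij_betw[OF \<pi>, symmetric])
  also have "\<dots> = (\<Sum>j<t. (euclid_norm (X *\<^sub>v part j y))\<^sup>2)" using eq by simp
  finally show ?thesis .
qed

lemma norm_Y_le_global:
  assumes \<pi>: "bij_betw \<pi> {..<t} {..<t}" and \<epsilon>: "0 \<le> \<epsilon>"
    and YX: "\<And>j y. j < t \<Longrightarrow> y \<in> supp j \<Longrightarrow> euclid_norm (Y *\<^sub>v y) \<le> \<epsilon> * euclid_norm (X *\<^sub>v y)"
    and y: "y \<in> carrier_vec n"
  shows "euclid_norm (Y *\<^sub>v y) \<le> sqrt t * \<epsilon> * euclid_norm (X *\<^sub>v y)"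
proof -
  have "(\<Sum>k<t. (euclid_norm (Y *\<^sub>v part k y))\<^sup>2) \<le> (\<Sum>k<t. (\<epsilon> * euclid_norm (X *\<^sub>v part k y))\<^sup>2)"
    by (intro sum_mono power_mono YX[OF _ part_supp]) auto
  also have "\<dots> = (\<epsilon> * euclid_norm (X *\<^sub>v y))\<^sup>2"
    by (simp add: norm_X_parts[OF \<pi> y] power_mult_distrib sum_distrib_left)
  finally have le: "sqrt (\<Sum>k<t. (euclid_norm (Y *\<^sub>v part k y))\<^sup>2) \<le> \<epsilon> * euclid_norm (X *\<^sub>v y)"
    using \<epsilon> by (intro real_le_lsqrt sum_nonneg) auto
  have "euclid_norm (Y *\<^sub>v y) \<le> sqrt (card {..<t}) * sqrt (\<Sum>k<t. (euclid_norm (Y *\<^sub>v part k y))\<^sup>2)"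
    by (rule norm_mult_parts_le[OF XY_carrier(2) y]) (use label in auto)
  also have "\<dots> \<le> sqrt (card {..<t}) * (\<epsilon> * euclid_norm (X *\<^sub>v y))"
    by (rule mult_left_mono[OF le]) simp
  finally show ?thesis by (simp add: mult.assoc)
qed

text \<open>Here \<open>W = W' V\<close>, where \<open>W\<close> and \<open>W'\<close> act isometrically on each block. For \<open>y\<close> in block \<open>j\<close>,
  \<open>W y = W' (X y) + W' (Y y)\<close>: the first term has the length of \<open>X y\<close>, and the second meets only
  the \<open>t - 1\<close> other blocks.\<close>

lemma norm_X_bounds:
  assumes \<pi>: "bij_betw \<pi> {..<t} {..<t}" and \<epsilon>: "0 \<le> \<epsilon>" and x: "x = sqrt (real t - 1) * \<epsilon>" "x < 1"
    and YX: "\<And>j y. j < t \<Longrightarrow> y \<in> supp j \<Longrightarrow> euclid_norm (Y *\<^sub>v y) \<le> \<epsilon> * euclid_norm (X *\<^sub>v y)"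
    and W: "W' \<in> carrier_mat n n" "W = W' * V"
    and iso: "\<And>j y. j < t \<Longrightarrow> y \<in> supp j \<Longrightarrow> euclid_norm (W *\<^sub>v y) = euclid_norm y"
      "\<And>j y. j < t \<Longrightarrow> y \<in> supp j \<Longrightarrow> euclid_norm (W' *\<^sub>v y) = euclid_norm y"
    and t: "1 \<le> t" and y: "y \<in> carrier_vec n"
  shows "(1 - x) * euclid_norm (X *\<^sub>v y) \<le> euclid_norm y" "euclid_norm y \<le> (1 + x) * euclid_norm (X *\<^sub>v y)"
proof -
  have x0: "0 \<le> x" using x \<epsilon> t by simp
  have block: "(1 - x) * euclid_norm (X *\<^sub>v y) \<le> euclid_norm y \<and> euclid_norm y \<le> (1 + x) * euclid_norm (X *\<^sub>v y)"
    if j: "j < t" and y: "y \<in> supp j" for j y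
  proof -
    have y': "y \<in> carrier_vec n" using y by (rule supp_carrier)
    have Xy: "X *\<^sub>v y \<in> carrier_vec n" "Y *\<^sub>v y \<in> carrier_vec n"
      using mult_mat_vec_carrier[OF XY_carrier(1) y'] mult_mat_vec_carrier[OF XY_carrier(2) y'] by auto
    have Xs: "X *\<^sub>v y \<in> supp (\<pi> j)" using Xy by (auto simp: supp_def XY_supp[OF y] simp del: index_mult_mat_vec)
    have Wy: "W *\<^sub>v y = W' *\<^sub>v (X *\<^sub>v y) + W' *\<^sub>v (Y *\<^sub>v y)"
      unfolding W(2) assoc_mult_mat_vec[OF W(1) carr(1) y'] V_split[OF y']
      by (rule mult_add_distrib_mat_vec[OF W(1) Xy])
    have Wc: "W' *\<^sub>v (X *\<^sub>v y) \<in> carrier_vec n" "W' *\<^sub>v (Y *\<^sub>v y) \<in> carrier_vec n"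
      using mult_mat_vec_carrier[OF W(1)] Xy by auto
    let ?J = "{..<t} - {\<pi> j}"
    have card: "real (card ?J) = real t - 1" using \<pi>_less[OF j] t by (simp add: of_nat_diff)
    have "(\<Sum>k\<in>?J. (euclid_norm (W' *\<^sub>v part k (Y *\<^sub>v y)))\<^sup>2) = (\<Sum>k\<in>?J. (euclid_norm (part k (Y *\<^sub>v y)))\<^sup>2)"
      by (intro sum.cong refl) (simp add: iso(2)[OF _ part_supp])
    also have "\<dots> \<le> (\<Sum>k<t. (euclid_norm (part k (Y *\<^sub>v y)))\<^sup>2)" by (rule sum_mono2) auto
    also have "\<dots> = (euclid_norm (Y *\<^sub>v y))\<^sup>2" by (rule norm_parts[OF Xy(2), symmetric])
    finally have le: "sqrt (\<Sum>k\<in>?J. (euclid_norm (W' *\<^sub>v part k (Y *\<^sub>v y)))\<^sup>2) \<le> euclid_norm (Y *\<^sub>v y)"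
      by (intro real_le_lsqrt sum_nonneg) auto
    have "euclid_norm (W' *\<^sub>v (Y *\<^sub>v y)) \<le> sqrt (card ?J) * sqrt (\<Sum>k\<in>?J. (euclid_norm (W' *\<^sub>v part k (Y *\<^sub>v y)))\<^sup>2)"
      by (rule norm_mult_parts_le[OF W(1) Xy(2)])
         (use label in \<open>auto simp: XY_supp[OF y] simp del: index_mult_mat_vec\<close>)
    also have "\<dots> \<le> sqrt (real (card ?J)) * euclid_norm (Y *\<^sub>v y)"
      by (rule mult_left_mono[OF le]) simp
    also have "\<dots> = sqrt (real t - 1) * euclid_norm (Y *\<^sub>v y)" unfolding card ..
    also have "\<dots> \<le> sqrt (real t - 1) * (\<epsilon> * euclid_norm (X *\<^sub>v y))"
      by (intro mult_left_mono YX[OF j y]) (use t in auto)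
    finally have small: "euclid_norm (W' *\<^sub>v (Y *\<^sub>v y)) \<le> x * euclid_norm (X *\<^sub>v y)" by (simp add: x mult.assoc)
    have main: "euclid_norm (W' *\<^sub>v (X *\<^sub>v y)) = euclid_norm (X *\<^sub>v y)" by (rule iso(2)[OF \<pi>_less[OF j] Xs])
    show ?thesis
      using euclid_norm_triangle[OF Wc] euclid_norm_ge_diff[OF Wc] iso(1)[OF j y] small main
      unfolding Wy by (auto simp: algebra_simps)
  qed
  have "((1 - x) * euclid_norm (X *\<^sub>v y))\<^sup>2 = (\<Sum>j<t. ((1 - x) * euclid_norm (X *\<^sub>v part j y))\<^sup>2)"
    by (simp add: norm_X_parts[OF \<pi> y] power_mult_distrib sum_distrib_left)
  also have "\<dots> \<le> (\<Sum>j<t. (euclid_norm (part j y))\<^sup>2)"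
    using block part_supp x by (intro sum_mono power_mono) auto
  also have "\<dots> = (euclid_norm y)\<^sup>2" by (rule norm_parts[OF y, symmetric])
  finally show "(1 - x) * euclid_norm (X *\<^sub>v y) \<le> euclid_norm y" by (rule power2_le_imp_le) simp
  have "(euclid_norm y)\<^sup>2 = (\<Sum>j<t. (euclid_norm (part j y))\<^sup>2)" by (rule norm_parts[OF y])
  also have "\<dots> \<le> (\<Sum>j<t. ((1 + x) * euclid_norm (X *\<^sub>v part j y))\<^sup>2)"
    using block part_supp by (intro sum_mono power_mono) auto
  also have "\<dots> = ((1 + x) * euclid_norm (X *\<^sub>v y))\<^sup>2"
    by (simp add: norm_X_parts[OF \<pi> y] power_mult_distrib sum_distrib_left)
  finally show "euclid_norm y \<le> (1 + x) * euclid_norm (X *\<^sub>v y)" by (rule power2_le_imp_le) (use x0 in simp)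
qed

end

section \<open>The constants\<close>

text \<open>The inequality \<open>\<alpha> \<le> \<tau> / (1 + \<tau>\<^sup>2)\<close> is what the bootstrap needs, and \<open>\<alpha> \<le> 1 - 1 / \<surd>2\<close> is what makes
  its starting point available.\<close>

lemma tau_alpha_bounds:
  fixes \<tau> \<alpha> :: real
  assumes \<tau>: "0 < \<tau>" "\<tau> \<le> sqrt 2 - 1" and \<alpha>: "\<alpha> = 2 * \<tau> / (sqrt 2 + \<tau>)\<^sup>2"
  shows "0 < \<alpha>" "\<alpha> * (1 + \<tau>\<^sup>2) \<le> \<tau>" "\<alpha> \<le> 1 - 1 / sqrt 2" "\<tau> < 1" "\<alpha> < 1 / 2"
proof -
  have s2: "sqrt 2 * sqrt 2 = (2 :: real)" by simp
  have s: "sqrt 2 < (3 / 2 :: real)" by (rule real_less_lsqrt) (simp_all add: power2_eq_square)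
  have s1: "(1 :: real) < sqrt 2" by simp
  have pos: "0 < (sqrt 2 + \<tau>)\<^sup>2" using \<tau> s1 by simp
  show "0 < \<alpha>" using \<alpha> \<tau> pos by simp
  have e: "\<alpha> * (sqrt 2 + \<tau>)\<^sup>2 = 2 * \<tau>" using \<alpha> pos by simp
  have sq: "(sqrt 2 + \<tau>)\<^sup>2 = 2 + 2 * sqrt 2 * \<tau> + \<tau>\<^sup>2" by (simp add: power2_eq_square algebra_simps)
  have "2 * (1 + \<tau>\<^sup>2) \<le> (sqrt 2 + \<tau>)\<^sup>2"
  proof -
    have "\<tau> * \<tau> \<le> 2 * sqrt 2 * \<tau>" using \<tau> s1 by (intro mult_right_mono) auto
    then show ?thesis unfolding sq by (simp add: power2_eq_square)
  qed
  then have "\<alpha> * (2 * (1 + \<tau>\<^sup>2)) \<le> \<alpha> * (sqrt 2 + \<tau>)\<^sup>2" using \<open>0 < \<alpha>\<close> by (intro mult_left_mono) auto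
  then have "2 * (\<alpha> * (1 + \<tau>\<^sup>2)) \<le> 2 * \<tau>" unfolding e by (simp only: mult.left_commute)
  then show "\<alpha> * (1 + \<tau>\<^sup>2) \<le> \<tau>" by simp
  show "\<tau> < 1" using \<tau> s by simp
  have h: "\<tau> \<le> 1 / 2" using \<tau> s by simp
  have i2: "1 / sqrt 2 = sqrt 2 / (2 :: real)" by (simp add: field_simps)
  have "2 * \<tau> \<le> (1 - sqrt 2 / 2) * (2 + 2 * sqrt 2 * \<tau>)"
  proof -
    have "(1 - sqrt 2 / 2) * (2 + 2 * sqrt 2 * \<tau>) - 2 * \<tau> = (2 - sqrt 2) * (1 - 2 * \<tau>)"
      using s2 by (simp add: algebra_simps)
    moreover have "0 \<le> (2 - sqrt 2) * (1 - 2 * \<tau>)" using s h by (intro mult_nonneg_nonneg) auto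
    ultimately show ?thesis by linarith
  qed
  also have "\<dots> \<le> (1 - sqrt 2 / 2) * (sqrt 2 + \<tau>)\<^sup>2" unfolding sq using s by (intro mult_left_mono) auto
  finally have "\<alpha> * (sqrt 2 + \<tau>)\<^sup>2 \<le> (1 - sqrt 2 / 2) * (sqrt 2 + \<tau>)\<^sup>2" unfolding e .
  then show "\<alpha> \<le> 1 - 1 / sqrt 2" unfolding i2 using pos by (rule mult_right_le_imp_le)
  then show "\<alpha> < 1 / 2" unfolding i2 using s1 by linarith
qed

text \<open>The separation \<open>(1 - \<alpha>) g - \<nu>\<close> of the unmatched eigenvalues is at least \<open>\<surd>2 \<alpha> g\<close>. The factor
  \<open>\<surd>2\<close> makes the unmatched part no larger than the matched one, where the bootstrap starts.\<close>

lemma gap_arithmetic: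
  fixes \<alpha> g \<nu> :: real
  assumes \<alpha>: "\<alpha> \<le> 1 - 1 / sqrt 2" and g: "0 \<le> g" and \<nu>: "sqrt 2 * \<nu> < (1 - 2 * \<alpha>) * g"
  shows "sqrt 2 * (\<alpha> * g) \<le> (1 - \<alpha>) * g - \<nu>"
proof -
  define h where "h = sqrt 2 / (2 :: real)"
  have r: "sqrt 2 = 2 * h" and h: "0 \<le> h" "2 * h * h = 1" by (simp_all add: h_def)
  have "1 / sqrt 2 = h" by (simp add: h_def field_simps)
  then have a: "\<alpha> \<le> 1 - h" using \<alpha> by simp
  have "h * (2 * h * \<nu>) \<le> h * ((1 - 2 * \<alpha>) * g)"
    using mult_left_mono[OF less_imp_le[OF \<nu>] h(1)] unfolding r .
  moreover have "h * (2 * h * \<nu>) = (2 * h * h) * \<nu>" by simp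
  ultimately have "\<nu> \<le> h * ((1 - 2 * \<alpha>) * g)" unfolding h(2) by simp
  moreover have "2 * h * \<alpha> * g \<le> ((1 - \<alpha>) - h * (1 - 2 * \<alpha>)) * g"
    by (rule mult_right_mono[OF _ g]) (use a in \<open>simp add: algebra_simps\<close>)
  ultimately show ?thesis unfolding r by (simp add: algebra_simps)
qed

text \<open>The singular values of the matched part lie between \<open>1 / (1 + x)\<close> and \<open>1 / (1 - x)\<close>. The number
  \<open>\<beta>\<close> is at least the second, and \<open>\<beta> - 1\<close> bounds the distance of both from 1.\<close>

lemma polar_constants:
  fixes x :: real
  assumes x: "0 \<le> x" "x < sqrt 2 - 1"
  defines "\<beta> \<equiv> 1 / sqrt (1 - 2 * x - x\<^sup>2)"
  shows "0 < 1 - 2 * x - x\<^sup>2" "x < 1" "1 \<le> \<beta> * (1 - x)" "1 \<le> \<beta>" "1 - 1 / (1 + x) \<le> \<beta> - 1"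
proof -
  have "(x + 1)\<^sup>2 < (sqrt 2)\<^sup>2" by (rule power_strict_mono) (use x in auto)
  then show D: "0 < 1 - 2 * x - x\<^sup>2" by (simp add: power2_eq_square algebra_simps)
  have "sqrt 2 < (2 :: real)" by (rule real_less_lsqrt) simp_all
  then show x1: "x < 1" using x by simp
  let ?d = "sqrt (1 - 2 * x - x\<^sup>2)"
  have d: "0 < ?d" using D by simp
  have "?d \<le> 1 - x" by (rule real_le_lsqrt) (use x x1 in \<open>auto simp: power2_eq_square algebra_simps\<close>)
  then show "1 \<le> \<beta> * (1 - x)" using d by (simp add: \<beta>_def field_simps)
  have "?d * (1 + x) \<le> 1"
  proof (rule power2_le_imp_le)
    have "(?d * (1 + x))\<^sup>2 = (1 - (2 * x + x\<^sup>2)) * (1 + (2 * x + x\<^sup>2))"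
      using D by (simp add: power_mult_distrib) (simp add: power2_eq_square algebra_simps)
    also have "\<dots> = 1 - (2 * x + x\<^sup>2)\<^sup>2" by (simp add: power2_eq_square algebra_simps)
    finally show "(?d * (1 + x))\<^sup>2 \<le> 1\<^sup>2" by simp
  qed simp
  then have b: "1 + x \<le> \<beta>" using d by (simp add: \<beta>_def field_simps)
  then show "1 \<le> \<beta>" using x by simp
  have "1 - 1 / (1 + x) \<le> x" using x by (simp add: field_simps)
  then show "1 - 1 / (1 + x) \<le> \<beta> - 1" using b by simp
qed

lemma inverse_sqrt_expansion:
  fixes u :: real
  assumes u: "0 \<le> u" "u \<le> 1 / 2"
  shows "1 + u / 2 \<le> 1 / sqrt (1 - u)" "1 / sqrt (1 - u) \<le> 1 + u / 2 + u\<^sup>2"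
proof -
  let ?d = "sqrt (1 - u)"
  define w where "w = u / 2"
  have uw: "u = 2 * w" by (simp add: w_def)
  have w: "0 \<le> w" "w \<le> 1 / 4" using u by (auto simp: w_def)
  have d: "0 < ?d" "?d\<^sup>2 = 1 - 2 * w" using u by (auto simp: uw)
  have "?d * (1 + w) \<le> 1"
  proof (rule power2_le_imp_le)
    have "(?d * (1 + w))\<^sup>2 = (1 - 2 * w) * (1 + w)\<^sup>2" unfolding power_mult_distrib d(2) ..
    also have "\<dots> = 1 - w\<^sup>2 * (3 + 2 * w)" by (simp add: power2_eq_square algebra_simps)
    also have "\<dots> \<le> 1" using w by simp
    finally show "(?d * (1 + w))\<^sup>2 \<le> 1\<^sup>2" by simp
  qed simp
  then show "1 + u / 2 \<le> 1 / ?d" using d by (simp add: w_def field_simps)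
  have "1 \<le> ?d * (1 + w + 4 * w\<^sup>2)"
  proof (rule power2_le_imp_le)
    have "w * w * w \<le> 1 / 4 * (1 / 4) * (1 / 4)" using w by (intro mult_mono) auto
    then have "0 \<le> w\<^sup>2 * (5 - 10 * w - 32 * (w * w * w))" using w by (intro mult_nonneg_nonneg) auto
    also have "\<dots> = (1 - 2 * w) * (1 + w + 4 * w\<^sup>2)\<^sup>2 - 1" by (simp add: power2_eq_square algebra_simps)
    finally show "1\<^sup>2 \<le> (?d * (1 + w + 4 * w\<^sup>2))\<^sup>2" unfolding power_mult_distrib d(2) by simp
  qed (use w d in auto)
  moreover have "1 + w + 4 * w\<^sup>2 = 1 + u / 2 + u\<^sup>2" by (simp add: uw power_mult_distrib)
  ultimately have "1 \<le> (1 + u / 2 + u\<^sup>2) * ?d" by (simp only: mult.commute)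
  then show "1 / ?d \<le> 1 + u / 2 + u\<^sup>2" by (simp only: pos_divide_le_eq[OF d(1)])
qed

text \<open>With \<open>x = C d\<close> and \<open>u = 2 c x + c\<^sup>2 x\<^sup>2\<close> the fraction is \<open>(1 + a x) (1 + u / 2 + O(u\<^sup>2))\<close>, whose linear
  part in \<open>x\<close> is \<open>(a + c) x\<close>.\<close>

lemma error_bound_expansion:
  fixes a c C :: real
  assumes a: "0 \<le> a" and c: "0 \<le> c" and C: "0 \<le> C"
  shows "(\<lambda>d. (1 + a * (C * d)) / sqrt (1 - 2 * c * (C * d) - c\<^sup>2 * (C * d)\<^sup>2) - 1 - (a + c) * (C * d))
    \<in> O[at_right 0](\<lambda>d. d\<^sup>2)"
proof -
  define e where "e = 2 * c + c\<^sup>2"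
  have e: "0 \<le> e" using c by (simp add: e_def)
  define L where "L = c\<^sup>2 / 2 + e\<^sup>2 + a * e / 2 + a * e\<^sup>2"
  have lim: "((\<lambda>d. C * d) \<longlongrightarrow> C * 0) (at_right 0)" "((\<lambda>d. e * (C * d)) \<longlongrightarrow> e * (C * 0)) (at_right 0)"
    by (intro tendsto_intros)+
  have "eventually (\<lambda>d. C * d < 1) (at_right 0)" by (rule order_tendstoD(2)[OF lim(1)]) simp
  moreover have "eventually (\<lambda>d. e * (C * d) < 1 / 2) (at_right 0)" by (rule order_tendstoD(2)[OF lim(2)]) simp
  moreover have "eventually (\<lambda>d :: real. 0 < d) (at_right 0)" by (rule eventually_at_right_less)
  ultimately have ev: "eventually (\<lambda>d. norm ((1 + a * (C * d)) / sqrt (1 - 2 * c * (C * d) - c\<^sup>2 * (C * d)\<^sup>2)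
      - 1 - (a + c) * (C * d)) \<le> (L * C\<^sup>2) * norm (d\<^sup>2)) (at_right 0)"
  proof eventually_elim
    case (elim d)
    define x where "x = C * d"
    have x: "0 \<le> x" "x \<le> 1" "e * x \<le> 1 / 2" using elim C by (auto simp: x_def)
    define u where "u = 2 * c * x + c\<^sup>2 * x\<^sup>2"
    have u0: "0 \<le> u" using x c by (simp add: u_def)
    have "x * x \<le> 1 * x" by (rule mult_right_mono) (use x in auto)
    then have "c\<^sup>2 * x\<^sup>2 \<le> c\<^sup>2 * x" by (intro mult_left_mono) (auto simp: power2_eq_square)
    then have ue: "u \<le> e * x" by (simp add: u_def e_def algebra_simps)
    define h where "h = 1 / sqrt (1 - u) - 1 - u / 2"
    have h: "0 \<le> h" "h \<le> u\<^sup>2" using inverse_sqrt_expansion[of u] u0 ue x(3) by (auto simp: h_def)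
    have "u\<^sup>2 \<le> (e * x)\<^sup>2" by (rule power_mono[OF ue u0])
    then have hx: "h \<le> e\<^sup>2 * x\<^sup>2" using h by (simp add: power_mult_distrib)
    have "(1 + a * x) / sqrt (1 - 2 * c * x - c\<^sup>2 * x\<^sup>2) - 1 - (a + c) * x = (1 + a * x) * (h + 1 + u / 2) - 1 - (a + c) * x"
      by (simp add: h_def u_def diff_diff_eq)
    also have "\<dots> = c\<^sup>2 / 2 * x\<^sup>2 + h + a * x * u / 2 + a * x * h"
      by (simp add: u_def power2_eq_square algebra_simps)
    finally have eq: "(1 + a * x) / sqrt (1 - 2 * c * x - c\<^sup>2 * x\<^sup>2) - 1 - (a + c) * x =
      c\<^sup>2 / 2 * x\<^sup>2 + h + a * x * u / 2 + a * x * h" .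
    have "a * x * u \<le> a * x * (e * x)" by (rule mult_left_mono[OF ue]) (use a x in simp)
    moreover have "a * x * h \<le> a * 1 * (e\<^sup>2 * x\<^sup>2)"
      by (intro mult_mono hx mult_left_mono) (use a x h in auto)
    ultimately have "c\<^sup>2 / 2 * x\<^sup>2 + h + a * x * u / 2 + a * x * h \<le> L * x\<^sup>2"
      using hx by (simp add: L_def algebra_simps power2_eq_square)
    moreover have "0 \<le> c\<^sup>2 / 2 * x\<^sup>2 + h + a * x * u / 2 + a * x * h"
      using a x h u0 by (intro add_nonneg_nonneg) auto
    ultimately show ?case
      unfolding x_def[symmetric] eq by (simp add: x_def power_mult_distrib mult_ac)
  qed
  show ?thesis by (rule bigoI[OF ev])
qed

section \<open>The residual of the exact family\<close>

text \<open>With \<open>V = Q\<^sup>-\<^sup>1\<close> and \<open>Z = Q \<Gamma> V\<close>, the congruence by \<open>V\<close> turns the commutator of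
  \<open>W'\<^sup>T L W'\<close> with \<open>\<Gamma>\<close> into \<open>W\<^sup>T L W Z - Z\<^sup>T W\<^sup>T L W\<close>.\<close>

lemma commutator_congruence:
  fixes W W' Q V G L :: "real mat"
  assumes c: "W \<in> carrier_mat n n" "W' \<in> carrier_mat n n" "Q \<in> carrier_mat n n" "V \<in> carrier_mat n n"
      "G \<in> carrier_mat n n" "L \<in> carrier_mat n n"
    and G: "G\<^sup>T = G" and W: "W' = W * Q" "W = W' * V"
  shows "V\<^sup>T * (W'\<^sup>T * L * W' * G - G * (W'\<^sup>T * L * W')) * V =
    W\<^sup>T * L * (W' * G * V) - (W' * G * V)\<^sup>T * L * W"
proof -
  note assoc = assoc_mult_mat[of _ n n _ n _ n]
  have cT: "W\<^sup>T \<in> carrier_mat n n" "W'\<^sup>T \<in> carrier_mat n n" "V\<^sup>T \<in> carrier_mat n n" using c by auto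
  note mc = mult_carrier_mat[of _ n n _ n]
  let ?B = "W'\<^sup>T * L * W'"
  have B: "?B \<in> carrier_mat n n" using c cT by (intro mc)
  have WT: "W\<^sup>T = V\<^sup>T * W'\<^sup>T" unfolding W(2) by (rule transpose_mult[OF c(2,4)])
  have T: "(W' * G * V)\<^sup>T = V\<^sup>T * (G * W'\<^sup>T)"
    using c by (simp add: transpose_mult[of _ n n _ n] G mc)
  have GV: "G * V \<in> carrier_mat n n" "W' * G \<in> carrier_mat n n" using c by (auto intro: mc)
  have "V\<^sup>T * (?B * G - G * ?B) * V = (V\<^sup>T * (?B * G) - V\<^sup>T * (G * ?B)) * V"
    by (subst mult_minus_distrib_mat[OF cT(3)]) (use B c in \<open>auto intro: mc\<close>)
  also have "\<dots> = V\<^sup>T * (?B * G) * V - V\<^sup>T * (G * ?B) * V"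
    by (rule minus_mult_distrib_mat[of _ n n _ _ n]) (use B c cT in \<open>auto intro: mc\<close>)
  also have "V\<^sup>T * (?B * G) * V = W\<^sup>T * L * (W' * G * V)"
    unfolding WT using c cT by (simp add: assoc mc)
  also have "V\<^sup>T * (G * ?B) * V = (W' * G * V)\<^sup>T * L * W"
  proof -
    have "V\<^sup>T * (G * ?B) * V = V\<^sup>T * (G * (W'\<^sup>T * (L * (W' * V))))"
      using c cT by (simp add: assoc mc)
    also have "\<dots> = (W' * G * V)\<^sup>T * L * W"
      unfolding T W(2)[symmetric] using c cT by (simp add: assoc mc)
    finally show ?thesis .
  qed
  finally show ?thesis .
qed

text \<open>The matrix \<open>D\<close> is the perturbation of \<open>A\<close>. Both terms that contain it also contain \<open>W Z\<close>, which equals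
  \<open>W' G V\<close>; this is why \<open>W'\<close> and a single factor \<open>V\<close> appear in the bound.\<close>

lemma residual_norm_le:
  fixes W W' Q V G A D :: "real mat"
  assumes c: "W \<in> carrier_mat n n" "W' \<in> carrier_mat n n" "Q \<in> carrier_mat n n" "V \<in> carrier_mat n n"
      "G \<in> carrier_mat n n" "A \<in> carrier_mat n n" "D \<in> carrier_mat n n"
    and G: "G\<^sup>T = G" "spectral_norm G \<le> 1" and W: "W' = W * Q" "W = W' * V"
  defines "Z \<equiv> Q * G * V" and "B \<equiv> W\<^sup>T * A * W"
  shows "frobenius_norm (B * Z - Z\<^sup>T * B) \<le>
    (spectral_norm V)\<^sup>2 * frobenius_norm (W'\<^sup>T * (A + D) * W' * G - G * (W'\<^sup>T * (A + D) * W'))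
    + 2 * spectral_norm V * spectral_norm W * spectral_norm W' * frobenius_norm D"
proof -
  note assoc = assoc_mult_mat[of _ n n _ n _ n]
  note mc = mult_carrier_mat[of _ n n _ n]
  have cT: "W\<^sup>T \<in> carrier_mat n n" "W'\<^sup>T \<in> carrier_mat n n" "V\<^sup>T \<in> carrier_mat n n" using c by auto
  define S where "S = W' * G * V"
  have S: "S \<in> carrier_mat n n" "S\<^sup>T \<in> carrier_mat n n" using c by (auto simp: S_def intro!: mc)
  have Z: "Z \<in> carrier_mat n n" "Z\<^sup>T \<in> carrier_mat n n" using c by (auto simp: Z_def intro!: mc)
  have SZ: "S = W * Z" unfolding S_def Z_def W(1) using c by (simp add: assoc mc)
  have ST: "S\<^sup>T = Z\<^sup>T * W\<^sup>T" unfolding SZ by (rule transpose_mult[OF c(1) Z(1)])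
  define R where "R = W'\<^sup>T * (A + D) * W' * G - G * (W'\<^sup>T * (A + D) * W')"
  have AD: "A + D \<in> carrier_mat n n" using c by auto
  have R: "R \<in> carrier_mat n n" unfolding R_def using c cT by (intro minus_carrier_mat mc) auto
  let ?P = "W\<^sup>T * D * S" and ?P' = "S\<^sup>T * D * W"
  have P: "?P \<in> carrier_mat n n" "?P' \<in> carrier_mat n n" using c cT S by (auto intro!: mc)
  have BZ: "W\<^sup>T * A * S = B * Z" "S\<^sup>T * A * W = Z\<^sup>T * B"
    unfolding ST unfolding SZ B_def using c cT Z by (simp_all add: assoc mc)
  have BZc: "B * Z \<in> carrier_mat n n" "Z\<^sup>T * B \<in> carrier_mat n n" unfolding B_def using c cT Z by (auto intro!: mc)
  have "V\<^sup>T * R * V = W\<^sup>T * (A + D) * S - S\<^sup>T * (A + D) * W"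
    unfolding R_def S_def by (rule commutator_congruence[OF c(1-5) AD G(1) W])
  also have "W\<^sup>T * (A + D) * S = B * Z + ?P"
    unfolding BZ(1)[symmetric] using c cT S
    by (simp add: mult_add_distrib_mat[OF cT(1)] add_mult_distrib_mat[of _ n n _ _ n] mc)
  also have "S\<^sup>T * (A + D) * W = Z\<^sup>T * B + ?P'"
    unfolding BZ(2)[symmetric] using c cT S
    by (simp add: mult_add_distrib_mat[OF S(2)] add_mult_distrib_mat[of _ n n _ _ n] mc)
  finally have eq: "V\<^sup>T * R * V = (B * Z + ?P) - (Z\<^sup>T * B + ?P')" .
  have PD: "frobenius_norm (W\<^sup>T * X * S) \<le> spectral_norm V * spectral_norm W * spectral_norm W' * frobenius_norm X"
    if X: "X \<in> carrier_mat n n" for X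
  proof -
    have "spectral_norm S \<le> spectral_norm (W' * G) * spectral_norm V"
      unfolding S_def by (rule spectral_norm_mult_le[OF mc[OF c(2,5)] c(4)])
    also have "\<dots> \<le> (spectral_norm W' * spectral_norm G) * spectral_norm V"
      by (intro mult_right_mono spectral_norm_mult_le[OF c(2,5)]) simp
    also have "\<dots> \<le> (spectral_norm W' * 1) * spectral_norm V"
      by (intro mult_right_mono mult_left_mono G) auto
    finally have nS: "spectral_norm S \<le> spectral_norm W' * spectral_norm V" by simp
    have "frobenius_norm (W\<^sup>T * X * S) \<le> frobenius_norm (W\<^sup>T * X) * spectral_norm S"
      by (rule frobenius_norm_mult_le_right) (use c cT S X in \<open>auto intro: mc\<close>)
    also have "\<dots> \<le> (spectral_norm W * frobenius_norm X) * (spectral_norm W' * spectral_norm V)"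
    proof (intro mult_mono nS)
      have "frobenius_norm (W\<^sup>T * X) \<le> spectral_norm (W\<^sup>T) * frobenius_norm X"
        by (rule frobenius_norm_mult_le_left[OF cT(1) X])
      also have "\<dots> \<le> spectral_norm W * frobenius_norm X"
        by (intro mult_right_mono spectral_norm_transpose_le[OF c(1)]) simp
      finally show "frobenius_norm (W\<^sup>T * X) \<le> spectral_norm W * frobenius_norm X" .
    qed auto
    finally show ?thesis by (simp add: mult_ac)
  qed
  have "B * Z - Z\<^sup>T * B = V\<^sup>T * R * V - (?P - ?P')"
  proof -
    have "X - Y = ((X + F) - (Y + H)) - (F - H)"
      if "X \<in> carrier_mat n n" "Y \<in> carrier_mat n n" "F \<in> carrier_mat n n" "H \<in> carrier_mat n n"
      for X Y F H :: "real mat"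
      using that by (intro eq_matI) auto
    from this[OF BZc P] show ?thesis unfolding eq .
  qed
  then have "frobenius_norm (B * Z - Z\<^sup>T * B) \<le> frobenius_norm (V\<^sup>T * R * V) + frobenius_norm (?P - ?P')"
    using P R c cT by (simp add: frobenius_norm_minus_triangle[of _ n n] mc minus_carrier_mat)
  moreover have "frobenius_norm (?P - ?P') \<le> frobenius_norm ?P + frobenius_norm ?P'"
    by (rule frobenius_norm_minus_triangle[OF P])
  moreover have "frobenius_norm ?P' = frobenius_norm (W\<^sup>T * D\<^sup>T * S)"
  proof -
    have "?P'\<^sup>T = W\<^sup>T * (D\<^sup>T * S)" using c S by (simp add: transpose_mult[of _ n n _ n] mc)
    also have "\<dots> = W\<^sup>T * D\<^sup>T * S" by (rule assoc[symmetric]) (use c S in simp_all)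
    finally show ?thesis by (metis frobenius_norm_transpose)
  qed
  moreover have "frobenius_norm (V\<^sup>T * R * V) \<le> (spectral_norm V)\<^sup>2 * frobenius_norm R"
  proof -
    have "frobenius_norm (V\<^sup>T * R * V) \<le> frobenius_norm (V\<^sup>T * R) * spectral_norm V"
      by (rule frobenius_norm_mult_le_right) (use c cT R in \<open>auto intro: mc\<close>)
    also have "\<dots> \<le> (spectral_norm (V\<^sup>T) * frobenius_norm R) * spectral_norm V"
      by (intro mult_right_mono frobenius_norm_mult_le_left[OF cT(3) R]) simp
    also have "\<dots> \<le> (spectral_norm V * frobenius_norm R) * spectral_norm V"
      by (intro mult_right_mono spectral_norm_transpose_le[OF c(4)]) auto
    finally show ?thesis by (simp add: power2_eq_square mult_ac)
  qed
  moreover have "frobenius_norm ?P \<le> spectral_norm V * spectral_norm W * spectral_norm W' * frobenius_norm D"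
    by (rule PD[OF c(7)])
  moreover have "frobenius_norm (W\<^sup>T * D\<^sup>T * S) \<le> spectral_norm V * spectral_norm W * spectral_norm W' * frobenius_norm D"
    using PD[of "D\<^sup>T"] c(7) by simp
  ultimately show ?thesis unfolding R_def[symmetric] by linarith
qed

section \<open>Block estimates for the residual equation\<close>

lemma sum_offdiag_pairs:
  fixes f :: "nat \<Rightarrow> nat \<Rightarrow> real"
  shows "(\<Sum>j<t. \<Sum>k<t. if j = k then 0 else f j k) = (\<Sum>j<t. \<Sum>k<t. if j < k then f j k + f k j else 0)"
proof -
  have "(\<Sum>j<t. \<Sum>k<t. if j = k then 0 else f j k) =
      (\<Sum>j<t. \<Sum>k<t. (if j < k then f j k else 0) + (if k < j then f j k else 0))"
    by (intro sum.cong refl) auto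
  also have "\<dots> = (\<Sum>j<t. \<Sum>k<t. if j < k then f j k else 0) + (\<Sum>j<t. \<Sum>k<t. if k < j then f j k else 0)"
    by (simp add: sum.distrib)
  also have "(\<Sum>j<t. \<Sum>k<t. if k < j then f j k else 0) = (\<Sum>j<t. \<Sum>k<t. if j < k then f k j else 0)"
    by (rule sum.swap)
  also have "(\<Sum>j<t. \<Sum>k<t. if j < k then f j k else 0) + (\<Sum>j<t. \<Sum>k<t. if j < k then f k j else 0) =
      (\<Sum>j<t. \<Sum>k<t. if j < k then f j k + f k j else 0)"
    unfolding sum.distrib[symmetric] by (intro sum.cong refl) simp
  finally show ?thesis .
qed

lemma block_dim [simp]: "dim_row (block ns A j k) = ns ! j" "dim_col (block ns A j k) = ns ! k"
  by (simp_all add: block_def)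

lemma block_residual:
  assumes D: "D \<in> block_diagonal ns" and Z: "Z \<in> carrier_mat (sum_list ns) (sum_list ns)"
    and jk: "j < length ns" "k < length ns"
  shows "block ns (D * Z - Z\<^sup>T * D) j k =
    block ns D j j * block ns Z j k - (block ns Z k j)\<^sup>T * block ns D k k"
proof -
  have Dc: "D \<in> carrier_mat (sum_list ns) (sum_list ns)" using D by (simp add: block_diagonal_iff)
  have c: "D * Z \<in> carrier_mat (sum_list ns) (sum_list ns)" "Z\<^sup>T * D \<in> carrier_mat (sum_list ns) (sum_list ns)"
    using Dc Z by (auto intro!: mult_carrier_mat[of _ _ "sum_list ns"])
  show ?thesis
    unfolding block_minus[OF c jk] block_mult_left[OF D Z jk] block_mult_transpose[OF D Z jk] ..
qed

text \<open>The blocks \<open>(j, k)\<close> and \<open>(k, j)\<close> of the residual equation together form one linear system for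
  \<open>Z\<^sub>j\<^sub>k\<close> and \<open>- Z\<^sub>k\<^sub>j\<^sup>T\<close>, whose matrix is the one in the modulus of uniqueness.\<close>

lemma off_block_bound:
  assumes ns: "\<And>j. j < length ns \<Longrightarrow> 0 < ns ! j"
    and D: "\<And>i. i < m \<Longrightarrow> D i \<in> block_diagonal ns" and Z: "Z \<in> carrier_mat (sum_list ns) (sum_list ns)"
    and \<omega>: "0 \<le> \<omega>" "\<And>j k. j < k \<Longrightarrow> k < length ns \<Longrightarrow>
      \<omega> \<le> sigma_min (G_off m (ns ! j) (ns ! k) (\<lambda>i. block ns (D i) j j) (\<lambda>i. block ns (D i) k k))"
  shows "\<omega>\<^sup>2 * (frobenius_norm (Z - Bdiag ns Z))\<^sup>2 \<le> (\<Sum>i<m. (frobenius_norm (D i * Z - Z\<^sup>T * D i))\<^sup>2)"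
proof -
  let ?N = "sum_list ns" and ?t = "length ns"
  let ?E = "\<lambda>i. D i * Z - Z\<^sup>T * D i"
  define z e where "z j k = (frobenius_norm (block ns Z j k))\<^sup>2"
    and "e j k = (\<Sum>i<m. (frobenius_norm (block ns (?E i) j k))\<^sup>2)" for j k
  have E: "?E i \<in> carrier_mat ?N ?N" if "i < m" for i
    using D[OF that] Z by (auto simp: block_diagonal_iff intro!: minus_carrier_mat mult_carrier_mat[of _ _ ?N])
  have pair: "\<omega>\<^sup>2 * (z j k + z k j) \<le> e j k + e k j" if jk: "j < k" "k < ?t" for j k
  proof -
    have jk': "j < ?t" "k < ?t" using jk by auto
    let ?B = "\<lambda>i. block ns (D i) j j" and ?C = "\<lambda>i. block ns (D i) k k"
    let ?X = "block ns Z j k" and ?Y = "- ((block ns Z k j)\<^sup>T)"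
    have X: "?X \<in> carrier_mat (ns ! j) (ns ! k)" and Y: "?Y \<in> carrier_mat (ns ! j) (ns ! k)"
      by (auto simp: block_def)
    have "\<omega>\<^sup>2 * ((frobenius_norm ?X)\<^sup>2 + (frobenius_norm ?Y)\<^sup>2) \<le>
      (\<Sum>i<m. (frobenius_norm (?B i * ?X + ?Y * ?C i))\<^sup>2 + (frobenius_norm ((?B i)\<^sup>T * ?X + ?Y * (?C i)\<^sup>T))\<^sup>2)"
      by (rule sigma_min_G_off_le[OF _ _ X Y ns ns \<omega>(1) \<omega>(2)[OF jk]]) (use jk' in auto)
    also have "\<dots> = e j k + e k j"
      unfolding e_def sum.distrib[symmetric]
    proof (intro sum.cong refl)
      fix i assume "i \<in> {..<m}"
      then have Di: "D i \<in> block_diagonal ns" using D by simp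
      have c: "block ns (D i) a b \<in> carrier_mat (ns ! a) (ns ! b)" "block ns Z a b \<in> carrier_mat (ns ! a) (ns ! b)" for a b
        by auto
      have 1: "?B i * ?X + ?Y * ?C i = block ns (?E i) j k"
        unfolding block_residual[OF Di Z jk'] using c[of j j] c[of j k] c[of k j] c[of k k]
        by (intro eq_matI) (auto simp: scalar_prod_def sum_negf)
      have 2: "(?B i)\<^sup>T * ?X + ?Y * (?C i)\<^sup>T = - ((block ns (?E i) k j)\<^sup>T)"
        unfolding block_residual[OF Di Z jk'(2,1)] using c[of j j] c[of j k] c[of k j] c[of k k]
        by (intro eq_matI) (auto simp: scalar_prod_def sum_negf mult.commute)
      show "(frobenius_norm (?B i * ?X + ?Y * ?C i))\<^sup>2 + (frobenius_norm ((?B i)\<^sup>T * ?X + ?Y * (?C i)\<^sup>T))\<^sup>2 =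
        (frobenius_norm (block ns (?E i) j k))\<^sup>2 + (frobenius_norm (block ns (?E i) k j))\<^sup>2"
        unfolding 1 2 frobenius_norm_uminus frobenius_norm_transpose ..
    qed
    finally show ?thesis by (simp add: z_def frobenius_norm_uminus)
  qed
  have Fc: "Z - Bdiag ns Z \<in> carrier_mat ?N ?N" by (simp add: Bdiag_blk minus_carrier_mat)
  have blockF: "(frobenius_norm (block ns (Z - Bdiag ns Z) j k))\<^sup>2 = (if j = k then 0 else z j k)"
    if "j < ?t" "k < ?t" for j k
    unfolding z_def frobenius_norm_sq_block using that Z offset_add_less[of _ ns] blk_offset[of _ ns]
    by (auto simp: Bdiag_blk)
  have "\<omega>\<^sup>2 * (frobenius_norm (Z - Bdiag ns Z))\<^sup>2 = \<omega>\<^sup>2 * (\<Sum>j<?t. \<Sum>k<?t. if j = k then 0 else z j k)"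
    unfolding frobenius_norm_sq_blocks[OF Fc] using blockF by simp
  also have "\<dots> = (\<Sum>j<?t. \<Sum>k<?t. if j < k then \<omega>\<^sup>2 * (z j k + z k j) else 0)"
    unfolding sum_offdiag_pairs sum_distrib_left by (intro sum.cong refl) auto
  also have "\<dots> \<le> (\<Sum>j<?t. \<Sum>k<?t. if j < k then e j k + e k j else 0)"
    by (intro sum_mono) (use pair in auto)
  also have "\<dots> = (\<Sum>j<?t. \<Sum>k<?t. if j = k then 0 else e j k)" by (rule sum_offdiag_pairs[symmetric])
  also have "\<dots> \<le> (\<Sum>j<?t. \<Sum>k<?t. e j k)" by (intro sum_mono) (auto simp: e_def sum_nonneg)
  also have "\<dots> = (\<Sum>i<m. \<Sum>j<?t. \<Sum>k<?t. (frobenius_norm (block ns (?E i) j k))\<^sup>2)"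
    unfolding e_def by (subst (2) sum.swap, subst sum.swap) (rule refl)
  also have "\<dots> = (\<Sum>i<m. (frobenius_norm (?E i))\<^sup>2)"
    by (intro sum.cong refl) (simp add: frobenius_norm_sq_blocks[OF E])
  finally show ?thesis .
qed

definition block_mean :: "nat list \<Rightarrow> real mat \<Rightarrow> nat \<Rightarrow> real" where
  "block_mean ns Z j = (\<Sum>a<ns ! j. block ns Z j j $$ (a, a)) / real (ns ! j)"

definition scalar_part :: "nat list \<Rightarrow> real mat \<Rightarrow> real mat" where
  "scalar_part ns Z = mat (sum_list ns) (sum_list ns)
     (\<lambda>(i, l). if i = l then block_mean ns Z (blk ns l) else 0)"

lemma frobenius_norm_sq_scalar_part:
  "(frobenius_norm (Bdiag ns Z - scalar_part ns Z))\<^sup>2 =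
    (\<Sum>j<length ns. (frobenius_norm (block ns Z j j - block_mean ns Z j \<cdot>\<^sub>m 1\<^sub>m (ns ! j)))\<^sup>2)"
proof -
  let ?t = "length ns"
  let ?N = "Bdiag ns Z - scalar_part ns Z"
  have N: "?N \<in> carrier_mat (sum_list ns) (sum_list ns)" by (simp add: scalar_part_def minus_carrier_mat)
  have diag: "block ns ?N j j = block ns Z j j - block_mean ns Z j \<cdot>\<^sub>m 1\<^sub>m (ns ! j)" if "j < ?t" for j
    using that offset_add_less[of j ns] blk_offset[of j ns]
    by (intro eq_matI) (auto simp: block_def Bdiag_blk scalar_part_def)
  have off: "(frobenius_norm (block ns ?N j k))\<^sup>2 = 0" if "j < ?t" "k < ?t" "j \<noteq> k" for j k
    unfolding frobenius_norm_sq_block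
  proof (intro sum.neutral ballI)
    fix a c assume "a \<in> {..<ns ! j}" "c \<in> {..<ns ! k}"
    then have ac: "a < ns ! j" "c < ns ! k" by auto
    have ne: "offset ns j + a \<noteq> offset ns k + c"
      using blk_offset[OF that(1) ac(1)] blk_offset[OF that(2) ac(2)] that(3) by auto
    show "(?N $$ (offset ns j + a, offset ns k + c))\<^sup>2 = 0"
      using ne that ac offset_add_less[OF that(1) ac(1)] offset_add_less[OF that(2) ac(2)]
      by (simp add: Bdiag_blk scalar_part_def blk_offset)
  qed
  have "(frobenius_norm ?N)\<^sup>2 = (\<Sum>j<?t. \<Sum>k<?t. if k = j then (frobenius_norm (block ns ?N j j))\<^sup>2 else 0)"
    unfolding frobenius_norm_sq_blocks[OF N] by (intro sum.cong refl) (use off in auto)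
  also have "\<dots> = (\<Sum>j<?t. (frobenius_norm (block ns ?N j j))\<^sup>2)"
    by (intro sum.cong refl) (simp add: sum.delta')
  finally show ?thesis using diag by simp
qed

text \<open>A block of order 1 is scalar, so only the larger blocks need the modulus.\<close>

lemma scalar_block_bound:
  assumes ns: "\<And>j. j < length ns \<Longrightarrow> 0 < ns ! j"
    and D: "\<And>i. i < m \<Longrightarrow> D i \<in> block_diagonal ns" and Z: "Z \<in> carrier_mat (sum_list ns) (sum_list ns)"
    and dim: "\<And>j. j < length ns \<Longrightarrow> N_dim (ns ! j) m (\<lambda>i. block ns (D i) j j) = 1"
    and \<omega>: "0 \<le> \<omega>" "\<And>j. j < length ns \<Longrightarrow> 1 < ns ! j \<Longrightarrow>
      \<omega> \<le> sigma_min_nonzero (G_diag m (ns ! j) (\<lambda>i. block ns (D i) j j))"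
  shows "\<omega>\<^sup>2 * (frobenius_norm (Bdiag ns Z - scalar_part ns Z))\<^sup>2 \<le>
    (\<Sum>i<m. (frobenius_norm (D i * Z - Z\<^sup>T * D i))\<^sup>2)"
proof -
  let ?N = "sum_list ns" and ?t = "length ns"
  let ?E = "\<lambda>i. D i * Z - Z\<^sup>T * D i"
  have E: "?E i \<in> carrier_mat ?N ?N" if "i < m" for i
    using D[OF that] Z by (auto simp: block_diagonal_iff intro!: minus_carrier_mat mult_carrier_mat[of _ _ ?N])
  have one: "\<omega>\<^sup>2 * (frobenius_norm (block ns Z j j - block_mean ns Z j \<cdot>\<^sub>m 1\<^sub>m (ns ! j)))\<^sup>2 \<le>
      (\<Sum>i<m. (frobenius_norm (block ns (?E i) j j))\<^sup>2)" if j: "j < ?t" for j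
  proof (cases "1 < ns ! j")
    case True
    have "\<omega>\<^sup>2 * (frobenius_norm (block ns Z j j - block_mean ns Z j \<cdot>\<^sub>m 1\<^sub>m (ns ! j)))\<^sup>2 \<le>
      (\<Sum>i<m. (frobenius_norm (block ns (D i) j j * block ns Z j j - (block ns Z j j)\<^sup>T * block ns (D i) j j))\<^sup>2)"
      by (rule sigma_min_nonzero_G_diag_le[OF _ _ dim[OF j] ns[OF j] \<omega>(1) \<omega>(2)[OF j True]])
         (auto simp: block_mean_def)
    also have "\<dots> = (\<Sum>i<m. (frobenius_norm (block ns (?E i) j j))\<^sup>2)"
      by (intro sum.cong refl) (simp add: block_residual[OF D Z j j])
    finally show ?thesis .
  next
    case False
    then have "ns ! j = 1" using ns[OF j] by simp
    then have "frobenius_norm (block ns Z j j - block_mean ns Z j \<cdot>\<^sub>m 1\<^sub>m (ns ! j)) = 0"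
      by (simp add: frobenius_norm_def block_mean_def block_def)
    then show ?thesis by (simp add: sum_nonneg)
  qed
  have "\<omega>\<^sup>2 * (frobenius_norm (Bdiag ns Z - scalar_part ns Z))\<^sup>2 \<le>
      (\<Sum>j<?t. \<Sum>i<m. (frobenius_norm (block ns (?E i) j j))\<^sup>2)"
    unfolding frobenius_norm_sq_scalar_part sum_distrib_left by (intro sum_mono one) simp
  also have "\<dots> = (\<Sum>i<m. \<Sum>j<?t. (frobenius_norm (block ns (?E i) j j))\<^sup>2)" by (rule sum.swap)
  also have "\<dots> \<le> (\<Sum>i<m. \<Sum>j<?t. \<Sum>k<?t. (frobenius_norm (block ns (?E i) j k))\<^sup>2)"
    by (intro sum_mono member_le_sum[where f = "\<lambda>k. (frobenius_norm (block ns (?E _) _ k))\<^sup>2"]) auto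
  also have "\<dots> = (\<Sum>i<m. (frobenius_norm (?E i))\<^sup>2)"
    by (intro sum.cong refl) (simp add: frobenius_norm_sq_blocks[OF E])
  finally show ?thesis .
qed

definition pad_block :: "nat list \<Rightarrow> nat \<Rightarrow> real vec \<Rightarrow> real vec" where
  "pad_block ns j a = vec (sum_list ns) (\<lambda>i. if blk ns i = j then a $ (i - offset ns j) else 0)"

lemma pad_block_nonzero:
  assumes j: "j < length ns" and a: "a \<in> carrier_vec (ns ! j)" "a \<noteq> 0\<^sub>v (ns ! j)"
  shows "pad_block ns j a \<noteq> 0\<^sub>v (sum_list ns)"
proof -
  obtain k where k: "k < ns ! j" "a $ k \<noteq> 0" using a by (metis eq_vecI carrier_vecD index_zero_vec)
  have i: "offset ns j + k < sum_list ns" by (rule offset_add_less[OF j k(1)])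
  have "pad_block ns j a $ (offset ns j + k) \<noteq> 0"
    using i k blk_offset[OF j k(1)] by (simp add: pad_block_def)
  then show ?thesis using i by auto
qed

lemma Bdiag_mult_pad_block:
  assumes j: "j < length ns" and a: "a \<in> carrier_vec (ns ! j)"
  shows "Bdiag ns Z *\<^sub>v pad_block ns j a = pad_block ns j (block ns Z j j *\<^sub>v a)"
proof (rule eq_vecI)
  let ?N = "sum_list ns"
  have Bc: "Bdiag ns Z \<in> carrier_mat ?N ?N" by (simp add: Bdiag_blk)
  have pc: "pad_block ns j a \<in> carrier_vec ?N" by (simp add: pad_block_def)
  fix i assume "i < dim_vec (pad_block ns j (block ns Z j j *\<^sub>v a))"
  then have i: "i < ?N" by (simp add: pad_block_def)
  obtain r where r: "r < ns ! blk ns i" "i = offset ns (blk ns i) + r" using block_position[OF i] by blast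
  have "(Bdiag ns Z *\<^sub>v pad_block ns j a) $ i = (\<Sum>l<?N. Bdiag ns Z $$ (i, l) * pad_block ns j a $ l)"
    by (rule mult_mat_vec_index[OF Bc pc i])
  also have "\<dots> = (\<Sum>l<?N. if blk ns l = j then (if blk ns i = j then Z $$ (i, l) * a $ (l - offset ns j) else 0) else 0)"
    using i by (intro sum.cong refl) (auto simp: Bdiag_blk pad_block_def)
  also have "\<dots> = (\<Sum>c<ns ! j. if blk ns i = j then Z $$ (i, offset ns j + c) * a $ c else 0)"
    unfolding sum_one_block[OF j] by (intro sum.cong) auto
  also have "\<dots> = pad_block ns j (block ns Z j j *\<^sub>v a) $ i"
  proof (cases "blk ns i = j")
    case True
    then have "pad_block ns j (block ns Z j j *\<^sub>v a) $ i = (block ns Z j j *\<^sub>v a) $ r"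
      using i r by (simp add: pad_block_def)
    also have "\<dots> = (\<Sum>c<ns ! j. block ns Z j j $$ (r, c) * a $ c)"
      by (rule mult_mat_vec_index[OF block_carrier a]) (use True r in simp)
    also have "\<dots> = (\<Sum>c<ns ! j. Z $$ (i, offset ns j + c) * a $ c)"
      using True r by (intro sum.cong refl) (simp add: block_index)
    finally show ?thesis using True by simp
  qed (use i in \<open>simp add: pad_block_def\<close>)
  finally show "(Bdiag ns Z *\<^sub>v pad_block ns j a) $ i = pad_block ns j (block ns Z j j *\<^sub>v a) $ i" .
qed (simp add: pad_block_def Bdiag_blk)

lemma pad_block_lincomb:
  assumes j: "j < length ns" and a: "a \<in> carrier_vec (ns ! j)" "c \<in> carrier_vec (ns ! j)"
  shows "pad_block ns j (x \<cdot>\<^sub>v a - y \<cdot>\<^sub>v c) = x \<cdot>\<^sub>v pad_block ns j a - y \<cdot>\<^sub>v pad_block ns j c"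
    "pad_block ns j (x \<cdot>\<^sub>v a + y \<cdot>\<^sub>v c) = x \<cdot>\<^sub>v pad_block ns j a + y \<cdot>\<^sub>v pad_block ns j c"
proof -
  have r: "i - offset ns j < ns ! j" if "i < sum_list ns" "blk ns i = j" for i
    using block_position[OF that(1)] that(2) by auto
  show "pad_block ns j (x \<cdot>\<^sub>v a - y \<cdot>\<^sub>v c) = x \<cdot>\<^sub>v pad_block ns j a - y \<cdot>\<^sub>v pad_block ns j c"
    "pad_block ns j (x \<cdot>\<^sub>v a + y \<cdot>\<^sub>v c) = x \<cdot>\<^sub>v pad_block ns j a + y \<cdot>\<^sub>v pad_block ns j c"
    using a r by (auto simp: pad_block_def intro!: eq_vecI)
qed

text \<open>The normalization says that the columns of \<open>W\<close> in one block are orthonormal.\<close>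

lemma block_normalized_isometry:
  assumes W: "W \<in> block_normalized ns" and y: "y \<in> carrier_vec (sum_list ns)"
    and supp: "\<And>i. i < sum_list ns \<Longrightarrow> blk ns i \<noteq> j \<Longrightarrow> y $ i = 0"
  shows "euclid_norm (W *\<^sub>v y) = euclid_norm y"
proof -
  let ?N = "sum_list ns"
  have Wc: "W \<in> carrier_mat ?N ?N" and WW: "Bdiag ns (W\<^sup>T * W) = 1\<^sub>m ?N" using W by (auto simp: block_normalized_def)
  have c: "W\<^sup>T * W \<in> carrier_mat ?N ?N" using Wc by simp
  have entry: "(W\<^sup>T * W) $$ (i, l) = (if i = l then 1 else 0)"
    if il: "i < ?N" "l < ?N" "blk ns i = blk ns l" for i l
  proof -
    have "(W\<^sup>T * W) $$ (i, l) = Bdiag ns (W\<^sup>T * W) $$ (i, l)"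
      unfolding Bdiag_blk using il by (simp del: index_mult_mat(1))
    then show ?thesis unfolding WW using il by simp
  qed
  have "(euclid_norm (W *\<^sub>v y))\<^sup>2 = y \<bullet> ((W\<^sup>T * W) *\<^sub>v y)" by (rule scalar_prod_gram[OF Wc y, symmetric])
  also have "\<dots> = (\<Sum>i<?N. y $ i * (\<Sum>l<?N. (W\<^sup>T * W) $$ (i, l) * y $ l))"
  proof -
    have "y \<bullet> ((W\<^sup>T * W) *\<^sub>v y) = (\<Sum>i<?N. y $ i * ((W\<^sup>T * W) *\<^sub>v y) $ i)"
      using Wc by (simp add: scalar_prod_def[of y] lessThan_atLeast0 del: index_mult_mat_vec)
    also have "\<dots> = (\<Sum>i<?N. y $ i * (\<Sum>l<?N. (W\<^sup>T * W) $$ (i, l) * y $ l))"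
      by (intro sum.cong refl) (simp only: mult_mat_vec_index[OF c y] lessThan_iff)
    finally show ?thesis .
  qed
  also have "\<dots> = (\<Sum>i<?N. y $ i * y $ i)"
  proof (intro sum.cong refl)
    fix i assume "i \<in> {..<?N}"
    then have i: "i < ?N" by simp
    show "y $ i * (\<Sum>l<?N. (W\<^sup>T * W) $$ (i, l) * y $ l) = y $ i * y $ i"
    proof (cases "blk ns i = j")
      case True
      have "(\<Sum>l<?N. (W\<^sup>T * W) $$ (i, l) * y $ l) = (\<Sum>l<?N. if l = i then y $ l else 0)"
      proof (intro sum.cong refl)
        fix l assume "l \<in> {..<?N}"
        then show "(W\<^sup>T * W) $$ (i, l) * y $ l = (if l = i then y $ l else 0)"
          using entry[OF i, of l] supp[of l] True by (cases "blk ns l = j") (auto simp del: index_mult_mat(1))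
      qed
      then show ?thesis using i by simp
    qed (use supp[OF i] in simp)
  qed
  also have "\<dots> = (euclid_norm y)\<^sup>2" unfolding euclid_norm_sq using y by (simp add: power2_eq_square)
  finally show ?thesis by (simp add: power2_eq_iff_nonneg)
qed

section \<open>Permutation matrices\<close>

definition perm_mat :: "nat \<Rightarrow> (nat \<Rightarrow> nat) \<Rightarrow> real mat" where
  "perm_mat n p = mat n n (\<lambda>(i, j). if i = p j then 1 else 0)"

lemma perm_mat_carrier [simp]: "perm_mat n p \<in> carrier_mat n n"
  by (simp add: perm_mat_def)

lemma perm_mat_orthogonal:
  assumes p: "p permutes {..<n}"
  shows "(perm_mat n p)\<^sup>T * perm_mat n p = 1\<^sub>m n" "perm_mat n p * (perm_mat n p)\<^sup>T = 1\<^sub>m n"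
proof -
  have pl: "p l < n" if "l < n" for l using permutes_in_image[OF p, of l] that by simp
  show 1: "(perm_mat n p)\<^sup>T * perm_mat n p = 1\<^sub>m n"
  proof (rule eq_matI)
    fix i j assume "i < dim_row (1\<^sub>m n :: real mat)" "j < dim_col (1\<^sub>m n :: real mat)"
    then have ij: "i < n" "j < n" by auto
    have "((perm_mat n p)\<^sup>T * perm_mat n p) $$ (i, j) =
        (\<Sum>k<n. (if k = p i then 1 else 0) * (if k = p j then 1 else 0))"
      using ij by (simp add: perm_mat_def scalar_prod_def lessThan_atLeast0)
    also have "\<dots> = (\<Sum>k<n. if k = p i then (if p i = p j then 1 else 0) else 0)"
      by (intro sum.cong) auto
    also have "\<dots> = 1\<^sub>m n $$ (i, j)"
      using ij pl[OF ij(1)] inj_eq[OF permutes_inj[OF p]] by simp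
    finally show "((perm_mat n p)\<^sup>T * perm_mat n p) $$ (i, j) = 1\<^sub>m n $$ (i, j)" .
  qed (auto simp: perm_mat_def)
  show "perm_mat n p * (perm_mat n p)\<^sup>T = 1\<^sub>m n"
    by (rule mat_mult_left_right_inverse[OF _ perm_mat_carrier 1]) simp
qed

lemma mult_perm_mat_transpose_index:
  assumes A: "A \<in> carrier_mat n n" and p: "p permutes {..<n}" and il: "i < n" "l < n"
  shows "(A * (perm_mat n p)\<^sup>T) $$ (i, p l) = A $$ (i, l)"
proof -
  have pl: "p l < n" using permutes_in_image[OF p, of l] il by simp
  have "(A * (perm_mat n p)\<^sup>T) $$ (i, p l) = (\<Sum>k<n. A $$ (i, k) * (if p l = p k then 1 else 0))"
    using A il pl by (simp add: perm_mat_def scalar_prod_def lessThan_atLeast0)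
  also have "\<dots> = (\<Sum>k<n. if k = l then A $$ (i, k) else 0)"
    by (intro sum.cong) (auto simp: inj_eq[OF permutes_inj[OF p]])
  finally have "(A * (perm_mat n p)\<^sup>T) $$ (i, p l) = (\<Sum>k<n. if k = l then A $$ (i, k) else 0)" .
  then show ?thesis using il by simp
qed

lemma mult_perm_mat_index:
  assumes A: "A \<in> carrier_mat n n" and p: "p permutes {..<n}" and il: "i < n" "l < n"
  shows "(A * perm_mat n p) $$ (i, l) = A $$ (i, p l)"
proof -
  have pl: "p l < n" using permutes_in_image[OF p, of l] il by simp
  have "(A * perm_mat n p) $$ (i, l) = (\<Sum>k<n. A $$ (i, k) * (if k = p l then 1 else 0))"
    using A il by (simp add: perm_mat_def scalar_prod_def lessThan_atLeast0)
  also have "\<dots> = (\<Sum>k<n. if k = p l then A $$ (i, k) else 0)" by (intro sum.cong) auto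
  finally have "(A * perm_mat n p) $$ (i, l) = (\<Sum>k<n. if k = p l then A $$ (i, k) else 0)" .
  then show ?thesis using pl by simp
qed

text \<open>Conjugation puts the entry at \<open>(p i, p l)\<close> into position \<open>(i, l)\<close>, and \<open>\<pi>\<close> keeps different blocks
  different.\<close>

lemma perm_mat_block_permutation:
  assumes p: "p permutes {..<sum_list ns}" and \<pi>: "inj_on \<pi> {..<length ns}"
    and b: "\<And>l. l < sum_list ns \<Longrightarrow> blk ns (p l) = \<pi> (blk ns l)"
  shows "perm_mat (sum_list ns) p \<in> block_permutations ns"
proof -
  let ?N = "sum_list ns" and ?P = "perm_mat (sum_list ns) p"
  have PT: "?P\<^sup>T \<in> carrier_mat ?N ?N" by simp
  have "?P\<^sup>T * D * ?P \<in> block_diagonal ns" if D: "D \<in> block_diagonal ns" for D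
  proof -
    have Dc: "D \<in> carrier_mat ?N ?N" using D by (simp add: block_diagonal_iff)
    have "(?P\<^sup>T * D * ?P) $$ (i, l) = 0" if il: "i < ?N" "l < ?N" "blk ns i \<noteq> blk ns l" for i l
    proof -
      have pl: "p l < ?N" "p i < ?N" using permutes_in_image[OF p] il by auto
      have PD: "?P\<^sup>T * D \<in> carrier_mat ?N ?N" using Dc PT by (intro mult_carrier_mat)
      have "(?P\<^sup>T * D * ?P) $$ (i, l) = (?P\<^sup>T * D) $$ (i, p l)" by (rule mult_perm_mat_index[OF PD p il(1,2)])
      also have "\<dots> = (D\<^sup>T * ?P) $$ (p l, i)"
      proof -
        have "?P\<^sup>T * D = (D\<^sup>T * ?P)\<^sup>T" using transpose_mult[of "D\<^sup>T" ?N ?N ?P ?N] Dc by simp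
        then show ?thesis using Dc il pl by (simp add: carrier_matD[OF perm_mat_carrier] del: index_mult_mat(1))
      qed
      also have "\<dots> = D\<^sup>T $$ (p l, p i)"
        by (rule mult_perm_mat_index[OF _ p pl(1) il(1)]) (use Dc in simp)
      also have "\<dots> = D $$ (p i, p l)" using Dc pl by simp
      also have "\<dots> = 0"
      proof -
        have "blk ns (p i) \<noteq> blk ns (p l)"
          unfolding b[OF il(1)] b[OF il(2)] using il \<pi> blk_less by (auto dest: inj_onD)
        then show ?thesis using D pl by (simp add: block_diagonal_iff)
      qed
      finally show ?thesis .
    qed
    moreover have "?P\<^sup>T * D * ?P \<in> carrier_mat ?N ?N" using Dc PT by (intro mult_carrier_mat) auto
    ultimately show ?thesis by (simp add: block_diagonal_iff)
  qed
  moreover have "?P \<in> permutation_mats ?N" using p by (auto simp: permutation_mats_def perm_mat_def)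
  ultimately show ?thesis by (simp add: block_permutations_def)
qed

lemma one_block_permutation: "1\<^sub>m (sum_list ns) \<in> block_permutations ns"
proof -
  have "perm_mat (sum_list ns) id \<in> block_permutations ns"
    by (rule perm_mat_block_permutation[where \<pi> = id]) (auto simp: permutes_id)
  moreover have "perm_mat (sum_list ns) id = 1\<^sub>m (sum_list ns)"
    by (intro eq_matI) (auto simp: perm_mat_def)
  ultimately show ?thesis by simp
qed

lemma block_permutationsD:
  assumes "P \<in> block_permutations ns"
  shows "P \<in> carrier_mat (sum_list ns) (sum_list ns)"
  using assms by (auto simp: block_permutations_def permutation_mats_def)

lemma finite_block_permutations: "finite (block_permutations ns)"
proof (rule finite_subset)
  show "block_permutations ns \<subseteq> perm_mat (sum_list ns) ` {p. p permutes {..<sum_list ns}}"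
    by (auto simp: block_permutations_def permutation_mats_def perm_mat_def)
qed (simp add: finite_permutations)

text \<open>The distance to the family \<open>W' D P\<close> is attained: for each of the finitely many \<open>P\<close> it is a
  Lipschitz function of \<open>D\<close>.\<close>

lemma block_distance_minimum:
  fixes nrm :: "real mat \<Rightarrow> real"
  assumes W: "W \<in> carrier_mat (sum_list ns) (sum_list ns)" "W' \<in> carrier_mat (sum_list ns) (sum_list ns)"
    and pos: "0 < nrm W'"
    and tri: "\<And>A B. A \<in> carrier_mat (sum_list ns) (sum_list ns) \<Longrightarrow> B \<in> carrier_mat (sum_list ns) (sum_list ns) \<Longrightarrow>
      nrm (A + B) \<le> nrm A + nrm B"
    and frob: "\<And>A. nrm A \<le> frobenius_norm A"
  shows "\<exists>D P. is_arg_min (\<lambda>(D, P). nrm (W - W' * D * P) / nrm W')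
    (\<lambda>(D, P). D \<in> block_diagonal ns \<and> D\<^sup>T * D = 1\<^sub>m (sum_list ns) \<and> P \<in> block_permutations ns) (D, P)"
proof -
  let ?N = "sum_list ns"
  define f where "f D P = nrm (W - W' * D * P) / nrm W'" for D P
  note mc = mult_carrier_mat[of _ ?N ?N _ ?N]
  have diff: "nrm A - nrm B \<le> frobenius_norm (A - B)"
    if AB: "A \<in> carrier_mat ?N ?N" "B \<in> carrier_mat ?N ?N" for A B
  proof -
    have "A = (A - B) + B" using AB by (intro eq_matI) auto
    then have "nrm A \<le> nrm (A - B) + nrm B" using tri[of "A - B" B] AB by (simp add: minus_carrier_mat)
    then show ?thesis using frob[of "A - B"] by simp
  qed
  have "\<exists>U. U \<in> block_orthogonal ns \<and> (\<forall>D\<in>block_orthogonal ns. f U P \<le> f D P)" if P: "P \<in> block_permutations ns" for P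
  proof -
    note Pc = block_permutationsD[OF P]
    define L where "L = frobenius_norm W' * frobenius_norm P / nrm W'"
    have one: "f A P - f B P \<le> L * frobenius_norm (A - B)"
      if AB: "A \<in> carrier_mat ?N ?N" "B \<in> carrier_mat ?N ?N" for A B
    proof -
      have c: "W - W' * A * P \<in> carrier_mat ?N ?N" "W - W' * B * P \<in> carrier_mat ?N ?N"
        "W' * A * P \<in> carrier_mat ?N ?N" "W' * B * P \<in> carrier_mat ?N ?N" "A - B \<in> carrier_mat ?N ?N"
        "B - A \<in> carrier_mat ?N ?N"
        using W Pc AB by (auto intro!: minus_carrier_mat mc)
      have "(W - W' * A * P) - (W - W' * B * P) = W' * (B - A) * P"
      proof -
        have "W' * (B - A) * P = (W' * B - W' * A) * P" using W AB by (simp add: mult_minus_distrib_mat[of _ ?N ?N])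
        also have "\<dots> = W' * B * P - W' * A * P"
          by (rule minus_mult_distrib_mat[of _ ?N ?N _ _ ?N]) (use W AB Pc in \<open>auto intro: mc\<close>)
        finally have e: "W' * (B - A) * P = W' * B * P - W' * A * P" .
        have "(W - X) - (W - Y) = Y - X" if "X \<in> carrier_mat ?N ?N" "Y \<in> carrier_mat ?N ?N" for X Y
          using that W by (intro eq_matI) auto
        from this[OF c(3,4)] show ?thesis unfolding e .
      qed
      then have "nrm (W - W' * A * P) - nrm (W - W' * B * P) \<le> frobenius_norm (W' * (B - A) * P)"
        using diff[OF c(1,2)] by simp
      also have "\<dots> \<le> frobenius_norm (W' * (B - A)) * frobenius_norm P"
        by (rule frobenius_norm_mult_le[OF mc[OF W(2) c(6)] Pc])
      also have "\<dots> \<le> (frobenius_norm W' * frobenius_norm (B - A)) * frobenius_norm P"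
        by (intro mult_right_mono frobenius_norm_mult_le[OF W(2) c(6)]) simp
      also have "frobenius_norm (B - A) = frobenius_norm (A - B)"
      proof -
        have "B - A = - (A - B)" using AB by (intro eq_matI) auto
        then show ?thesis by (simp add: frobenius_norm_uminus)
      qed
      finally have "(nrm (W - W' * A * P) - nrm (W - W' * B * P)) / nrm W' \<le>
          frobenius_norm W' * frobenius_norm (A - B) * frobenius_norm P / nrm W'"
        using pos by (intro divide_right_mono) auto
      then show ?thesis by (simp add: f_def L_def diff_divide_distrib mult_ac)
    qed
    have "\<bar>f A P - f B P\<bar> \<le> L * frobenius_norm (A - B)"
      if AB: "A \<in> carrier_mat ?N ?N" "B \<in> carrier_mat ?N ?N" for A B
    proof -
      have "B - A = - (A - B)" using AB by (intro eq_matI) auto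
      then have "frobenius_norm (B - A) = frobenius_norm (A - B)" by (simp add: frobenius_norm_uminus)
      then show ?thesis using one[OF AB] one[OF AB(2,1)] by (simp add: abs_le_iff)
    qed
    then show ?thesis using block_orthogonal_minimum[of ns "\<lambda>D. f D P" L] by metis
  qed
  then obtain U where U: "\<And>P. P \<in> block_permutations ns \<Longrightarrow> U P \<in> block_orthogonal ns"
    "\<And>P D. P \<in> block_permutations ns \<Longrightarrow> D \<in> block_orthogonal ns \<Longrightarrow> f (U P) P \<le> f D P"
    by metis
  have fin: "finite ((\<lambda>P. f (U P) P) ` block_permutations ns)" using finite_block_permutations by simp
  have ne: "(\<lambda>P. f (U P) P) ` block_permutations ns \<noteq> {}" using one_block_permutation by blast
  obtain P0 where P0: "P0 \<in> block_permutations ns" "Min ((\<lambda>P. f (U P) P) ` block_permutations ns) = f (U P0) P0"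
    using Min_in[OF fin ne] by (rule imageE)
  have min: "f (U P0) P0 \<le> f D P" if "D \<in> block_orthogonal ns" "P \<in> block_permutations ns" for D P
  proof -
    have "f (U P0) P0 \<le> f (U P) P"
      unfolding P0(2)[symmetric] by (rule Min_le[OF fin]) (use that in blast)
    also have "\<dots> \<le> f D P" by (rule U(2)[OF that(2,1)])
    finally show ?thesis .
  qed
  have "is_arg_min (\<lambda>(D, P). nrm (W - W' * D * P) / nrm W')
    (\<lambda>(D, P). D \<in> block_diagonal ns \<and> D\<^sup>T * D = 1\<^sub>m ?N \<and> P \<in> block_permutations ns) (U P0, P0)"
    unfolding is_arg_min_def
    using min U(1)[OF P0(1)] P0(1) by (auto simp: f_def[symmetric] block_orthogonal_def not_less)
  then show ?thesis by blast
qed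

section \<open>The approximation\<close>

text \<open>With \<open>P\<close> the matrix of \<open>p\<close>, the matrix \<open>X P\<^sup>T\<close> is block diagonal with singular values close to 1, so it
  is close to some block diagonal orthogonal \<open>U\<close>, and \<open>V - U P = (X P\<^sup>T - U) P + Y\<close>.\<close>

lemma (in matched_block_perturbation) block_orthogonal_approximation:
  fixes ns :: "nat list" and p :: "nat \<Rightarrow> nat"
  assumes n: "n = sum_list ns" and t: "t = length ns" "1 \<le> t" and b: "b = blk ns"
    and \<pi>: "bij_betw \<pi> {..<t} {..<t}" and p: "p permutes {..<n}" "\<And>l. l < n \<Longrightarrow> b (p l) = \<pi> (b l)"
    and \<epsilon>: "0 \<le> \<epsilon>" "sqrt (real t - 1) * \<epsilon> < sqrt 2 - 1"
    and YX: "\<And>j y. j < t \<Longrightarrow> y \<in> supp j \<Longrightarrow> euclid_norm (Y *\<^sub>v y) \<le> \<epsilon> * euclid_norm (X *\<^sub>v y)"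
    and W: "W \<in> block_normalized ns" "W' \<in> block_normalized ns" "W = W' * V"
  obtains U where "U \<in> block_orthogonal ns"
    "spectral_norm (V - U * perm_mat n p) \<le>
      (1 + sqrt t * \<epsilon>) / sqrt (1 - 2 * sqrt (real t - 1) * \<epsilon> - (real t - 1) * \<epsilon>\<^sup>2) - 1"
proof -
  define x where "x = sqrt (real t - 1) * \<epsilon>"
  have x: "0 \<le> x" "x < sqrt 2 - 1" using \<epsilon> t by (auto simp: x_def)
  define \<beta> where "\<beta> = 1 / sqrt (1 - 2 * x - x\<^sup>2)"
  note pc = polar_constants[OF x, folded \<beta>_def]
  have W'c: "W' \<in> carrier_mat n n" using W(2) n by (simp add: block_normalized_def)
  have iso: "euclid_norm (W *\<^sub>v y) = euclid_norm y" "euclid_norm (W' *\<^sub>v y) = euclid_norm y"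
    if "y \<in> supp j" for j y
  proof -
    have y: "y \<in> carrier_vec (sum_list ns)" "\<And>i. i < sum_list ns \<Longrightarrow> blk ns i \<noteq> j \<Longrightarrow> y $ i = 0"
      using that unfolding supp_def n[symmetric] b[symmetric] by auto
    show "euclid_norm (W *\<^sub>v y) = euclid_norm y" by (rule block_normalized_isometry[OF W(1) y])
    show "euclid_norm (W' *\<^sub>v y) = euclid_norm y" by (rule block_normalized_isometry[OF W(2) y])
  qed
  have Xb: "(1 - x) * euclid_norm (X *\<^sub>v y) \<le> euclid_norm y" "euclid_norm y \<le> (1 + x) * euclid_norm (X *\<^sub>v y)"
    if y: "y \<in> carrier_vec n" for y
    by (rule norm_X_bounds[OF \<pi> \<epsilon>(1) x_def pc(2) YX W'c W(3) iso t(2) y]; assumption)+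
  let ?P = "perm_mat n p"
  note P = perm_mat_orthogonal[OF p(1)]
  have PT: "?P\<^sup>T \<in> carrier_mat n n" by simp
  define X' where "X' = X * ?P\<^sup>T"
  have X'c: "X' \<in> carrier_mat n n" unfolding X'_def using PT by (intro mult_carrier_mat) auto
  have X'bd: "X' \<in> block_diagonal ns"
  proof -
    have "X' $$ (i, l) = 0" if il: "i < n" "l < n" "b i \<noteq> b l" for i l
    proof -
      obtain l' where l': "l' < n" "l = p l'"
        using permutes_image[OF p(1)] il(2) by (metis imageE lessThan_iff)
      have "X' $$ (i, l) = X $$ (i, l')"
        unfolding X'_def l'(2) by (rule mult_perm_mat_transpose_index[OF XY_carrier(1) p(1) il(1) l'(1)])
      also have "\<dots> = 0" using il l' p(2)[OF l'(1)] by (simp add: X_def)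
      finally show ?thesis .
    qed
    then show ?thesis using X'c by (simp add: block_diagonal_iff n b)
  qed
  have X'v: "X' *\<^sub>v z = X *\<^sub>v (?P\<^sup>T *\<^sub>v z)" "euclid_norm (?P\<^sup>T *\<^sub>v z) = euclid_norm z" "?P\<^sup>T *\<^sub>v z \<in> carrier_vec n"
    if z: "z \<in> carrier_vec n" for z
  proof -
    show "X' *\<^sub>v z = X *\<^sub>v (?P\<^sup>T *\<^sub>v z)" unfolding X'_def by (rule assoc_mult_mat_vec[OF XY_carrier(1) PT z])
    show "euclid_norm (?P\<^sup>T *\<^sub>v z) = euclid_norm z"
      by (rule euclid_norm_isometry[OF PT _ z]) (simp add: P)
    show "?P\<^sup>T *\<^sub>v z \<in> carrier_vec n" using mult_mat_vec_carrier[OF PT z] .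
  qed
  have up: "euclid_norm (X *\<^sub>v y) \<le> \<beta> * euclid_norm y" if y: "y \<in> carrier_vec n" for y
  proof -
    have "1 * euclid_norm (X *\<^sub>v y) \<le> (\<beta> * (1 - x)) * euclid_norm (X *\<^sub>v y)"
      by (rule mult_right_mono[OF pc(3)]) simp
    also have "\<dots> = \<beta> * ((1 - x) * euclid_norm (X *\<^sub>v y))" by simp
    also have "\<dots> \<le> \<beta> * euclid_norm y" by (rule mult_left_mono[OF Xb(1)[OF y]]) (use pc(4) in simp)
    finally show ?thesis by simp
  qed
  have lo: "1 / (1 + x) * euclid_norm y \<le> euclid_norm (X *\<^sub>v y)" if y: "y \<in> carrier_vec n" for y
    using Xb(2)[OF y] x(1) by (simp add: field_simps)
  obtain U where U: "U \<in> block_orthogonal ns"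
    and UX: "\<And>z. z \<in> carrier_vec (sum_list ns) \<Longrightarrow> euclid_norm (X' *\<^sub>v z - U *\<^sub>v z) \<le> (\<beta> - 1) * euclid_norm z"
  proof (rule nearest_block_orthogonal[OF X'bd, of "1 / (1 + x)" \<beta> "\<beta> - 1"])
    fix z :: "real vec" assume "z \<in> carrier_vec (sum_list ns)"
    then have z: "z \<in> carrier_vec n" by (simp add: n)
    show "1 / (1 + x) * euclid_norm z \<le> euclid_norm (X' *\<^sub>v z)" "euclid_norm (X' *\<^sub>v z) \<le> \<beta> * euclid_norm z"
      using lo[OF X'v(3)[OF z]] up[OF X'v(3)[OF z]] unfolding X'v(1)[OF z] X'v(2)[OF z] .
  qed (use pc in auto)
  have Uc: "U \<in> carrier_mat n n" using block_orthogonalD(2)[OF U] n by simp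
  have UP: "U * ?P \<in> carrier_mat n n" using Uc by (intro mult_carrier_mat) auto
  have "spectral_norm (V - U * ?P) \<le> (1 + sqrt t * \<epsilon>) * \<beta> - 1"
  proof (rule spectral_norm_le[of _ n n])
    show "V - U * ?P \<in> carrier_mat n n" using UP by (rule minus_carrier_mat)
    have "1 * 1 \<le> (1 + sqrt t * \<epsilon>) * \<beta>" using \<epsilon>(1) pc(4) by (intro mult_mono) auto
    then show "0 \<le> (1 + sqrt t * \<epsilon>) * \<beta> - 1" by simp
    fix y :: "real vec" assume y: "y \<in> carrier_vec n"
    define z where "z = ?P *\<^sub>v y"
    have z: "z \<in> carrier_vec n" unfolding z_def by (rule mult_mat_vec_carrier[OF perm_mat_carrier y])
    have nz: "euclid_norm z = euclid_norm y" unfolding z_def by (rule euclid_norm_isometry[OF perm_mat_carrier P(1) y])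
    have yz: "?P\<^sup>T *\<^sub>v z = y"
      unfolding z_def using assoc_mult_mat_vec[OF PT perm_mat_carrier[of n p] y] y by (simp add: P)
    have XX: "X' *\<^sub>v z = X *\<^sub>v y" unfolding X'v(1)[OF z] yz ..
    have UPy: "(U * ?P) *\<^sub>v y = U *\<^sub>v z" unfolding z_def by (rule assoc_mult_mat_vec[OF Uc perm_mat_carrier y])
    have c: "X *\<^sub>v y \<in> carrier_vec n" "Y *\<^sub>v y \<in> carrier_vec n" "U *\<^sub>v z \<in> carrier_vec n"
      using mult_mat_vec_carrier[OF XY_carrier(1) y] mult_mat_vec_carrier[OF XY_carrier(2) y] mult_mat_vec_carrier[OF Uc z] by auto
    have "(V - U * ?P) *\<^sub>v y = V *\<^sub>v y - (U * ?P) *\<^sub>v y" by (rule minus_mult_distrib_mat_vec[OF carr(1) UP y])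
    also have "\<dots> = (X *\<^sub>v y - U *\<^sub>v z) + Y *\<^sub>v y"
    proof -
      have "(u + w) - v = (u - v) + w" if "u \<in> carrier_vec n" "w \<in> carrier_vec n" "v \<in> carrier_vec n" for u v w :: "real vec"
        using that by (intro eq_vecI) auto
      from this[OF c] show ?thesis unfolding V_split[OF y] UPy .
    qed
    finally have "euclid_norm ((V - U * ?P) *\<^sub>v y) \<le> euclid_norm (X *\<^sub>v y - U *\<^sub>v z) + euclid_norm (Y *\<^sub>v y)"
      using euclid_norm_triangle[of "X *\<^sub>v y - U *\<^sub>v z" n "Y *\<^sub>v y"] c by simp
    also have "\<dots> \<le> (\<beta> - 1) * euclid_norm y + sqrt t * \<epsilon> * (\<beta> * euclid_norm y)"
    proof (rule add_mono)
      show "euclid_norm (X *\<^sub>v y - U *\<^sub>v z) \<le> (\<beta> - 1) * euclid_norm y"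
        using UX[of z] z unfolding XX nz n by simp
      have "euclid_norm (Y *\<^sub>v y) \<le> sqrt t * \<epsilon> * euclid_norm (X *\<^sub>v y)"
        by (rule norm_Y_le_global[OF \<pi> \<epsilon>(1) YX y])
      also have "\<dots> \<le> sqrt t * \<epsilon> * (\<beta> * euclid_norm y)"
        by (rule mult_left_mono[OF up[OF y]]) (use \<epsilon> in simp)
      finally show "euclid_norm (Y *\<^sub>v y) \<le> sqrt t * \<epsilon> * (\<beta> * euclid_norm y)" .
    qed
    finally show "euclid_norm ((V - U * ?P) *\<^sub>v y) \<le> ((1 + sqrt t * \<epsilon>) * \<beta> - 1) * euclid_norm y"
      by (simp add: algebra_simps)
  qed
  moreover have "(1 + sqrt t * \<epsilon>) * \<beta> - 1 =
      (1 + sqrt t * \<epsilon>) / sqrt (1 - 2 * sqrt (real t - 1) * \<epsilon> - (real t - 1) * \<epsilon>\<^sup>2) - 1"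
    using t(2) by (simp add: \<beta>_def x_def power_mult_distrib mult.assoc)
  ultimately show thesis using that[OF U] by simp
qed

section \<open>The perturbation bound\<close>

lemma invertible_mat_inv_mult:
  assumes W: "W \<in> carrier_mat n n" "invertible_mat W" and W': "W' \<in> carrier_mat n n" "invertible_mat W'"
  shows "invertible_mat (mat_inv W * W')"
proof -
  note mc = mult_carrier_mat[of _ n n _ n]
  note Wi = mat_inv[OF W] and W'i = mat_inv[OF W']
  let ?Q = "mat_inv W * W'" and ?B = "mat_inv W' * W"
  have Q: "?Q \<in> carrier_mat n n" using Wi(3) W'(1) by (rule mc)
  have B: "?B \<in> carrier_mat n n" using W'i(3) W(1) by (rule mc)
  have "?Q * ?B = mat_inv W * (W' * ?B)" by (rule assoc_mult_mat[OF Wi(3) W'(1) B])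
  also have "W' * ?B = W" using assoc_mult_mat[OF W'(1) W'i(3) W(1)] W(1) by (simp add: W'i)
  finally have 1: "?Q * ?B = 1\<^sub>m n" by (simp add: Wi)
  have "?B * ?Q = mat_inv W' * (W * ?Q)" by (rule assoc_mult_mat[OF W'i(3) W(1) Q])
  also have "W * ?Q = W'" using assoc_mult_mat[OF W(1) Wi(3) W'(1)] W'(1) by (simp add: Wi)
  finally have 2: "?B * ?Q = 1\<^sub>m n" by (simp add: W'i)
  show ?thesis
    unfolding invertible_mat_def inverts_mat_def square_mat.simps
    using Q B by (intro conjI exI[of _ ?B]) (simp_all only: carrier_matD 1 2)
qed

lemma spectral_norm_diagonal_le_1:
  assumes f: "\<And>i. i < n \<Longrightarrow> \<bar>f i\<bar> \<le> (1 :: real)"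
  shows "spectral_norm (mat n n (\<lambda>(i, l). if i = l then f i else 0)) \<le> 1"
proof (rule spectral_norm_le[of _ n n])
  let ?G = "mat n n (\<lambda>(i, l). if i = l then f i else 0)"
  show Gc: "?G \<in> carrier_mat n n" by simp
  fix x :: "real vec" assume x: "x \<in> carrier_vec n"
  have "euclid_norm (?G *\<^sub>v x) \<le> euclid_norm x"
  proof (rule euclid_norm_mono[of _ n])
    fix i assume i: "i < n"
    have "(?G *\<^sub>v x) $ i = (\<Sum>l<n. if l = i then f i * x $ l else 0)"
      unfolding mult_mat_vec_index[OF Gc x i] using i by (intro sum.cong) auto
    then have "(?G *\<^sub>v x) $ i = f i * x $ i" using i by simp
    then show "\<bar>(?G *\<^sub>v x) $ i\<bar> \<le> \<bar>x $ i\<bar>"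
      using f[OF i] by (simp add: abs_mult mult_left_le_one_le del: index_mult_mat_vec)
  qed (rule mult_mat_vec_carrier[OF Gc x], rule x)
  then show "euclid_norm (?G *\<^sub>v x) \<le> 1 * euclid_norm x" by simp
qed simp

lemma omega_uq_le:
  assumes "j < k" "k < length ns"
  shows "omega_uq ns m A W \<le> sigma_min (G_off m (ns ! j) (ns ! k) (diag_part ns A W j) (diag_part ns A W k))"
proof -
  let ?S = "{sigma_min (G_off m (ns ! j) (ns ! k) (diag_part ns A W j) (diag_part ns A W k)) | j k. j < k \<and> k < length ns}"
  have "?S \<subseteq> (\<lambda>(j, k). sigma_min (G_off m (ns ! j) (ns ! k) (diag_part ns A W j) (diag_part ns A W k)))
      ` ({..<length ns} \<times> {..<length ns})" by auto
  then have "finite ?S" by (rule finite_subset) simp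
  then show ?thesis unfolding omega_uq_def by (rule Min_le) (use assms in blast)
qed

text \<open>If all blocks have order 1, the modulus is infinite. In this case every \<open>\<omega> \<ge> 0\<close> satisfies the
  hypothesis of \<open>bound\<close> vacuously, which forces \<open>x = 0\<close>.\<close>

lemma omega_nd_bound:
  assumes bound: "\<And>\<omega>. 0 \<le> \<omega> \<Longrightarrow> (\<And>j. j < length ns \<Longrightarrow> 1 < ns ! j \<Longrightarrow>
      \<omega> \<le> sigma_min_nonzero (G_diag m (ns ! j) (diag_part ns A W j))) \<Longrightarrow> \<omega> * x \<le> \<delta>"
    and x: "0 \<le> x" and \<delta>: "0 \<le> \<delta>" and c: "0 < c"
    and lt: "ereal \<delta> < ereal c * omega_nd ns m A W / ereal (sqrt 2)"
  shows "sqrt 2 * x < c"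
proof (cases "\<forall>j<length ns. ns ! j = 1")
  case True
  have all: "y * x \<le> \<delta>" if "0 \<le> y" for y using bound[OF that] True by simp
  have "x = 0"
  proof (rule ccontr)
    assume "x \<noteq> 0"
    then show False using all[of "(\<delta> + 1) / x"] x \<delta> by simp
  qed
  then show ?thesis using c by simp
next
  case False
  define S where "S = {sigma_min_nonzero (G_diag m (ns ! j) (diag_part ns A W j)) | j. j < length ns \<and> 1 < ns ! j}"
  have "omega_nd ns m A W = ereal (Min S)" unfolding omega_nd_def S_def by (simp only: False if_False)
  with lt have lt: "\<delta> < c * Min S / sqrt 2" by simp
  have pos: "0 < Min S"
  proof (rule ccontr)
    assume "\<not> 0 < Min S"
    then have "c * Min S / sqrt 2 \<le> 0" using c by (simp add: divide_le_0_iff mult_le_0_iff)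
    then show False using lt \<delta> by simp
  qed
  have "finite S" by (simp add: S_def)
  have "Min S * x \<le> \<delta>"
  proof (rule bound)
    fix j assume "j < length ns" "1 < ns ! j"
    then show "Min S \<le> sigma_min_nonzero (G_diag m (ns ! j) (diag_part ns A W j))"
      by (intro Min_le[OF \<open>finite S\<close>]) (auto simp: S_def)
  qed (use pos in simp)
  then have "sqrt 2 * (Min S * x) \<le> sqrt 2 * \<delta>" by (rule mult_left_mono) simp
  also have "\<dots> < c * Min S" using lt by (simp add: pos_less_divide_eq mult.commute)
  finally have "Min S * (sqrt 2 * x) < Min S * c" by (simp only: mult_ac)
  then show ?thesis using pos by simp
qed

text \<open>No block is empty, so every block is hit by the permutation, and \<open>\<pi>\<close> is onto.\<close>

lemma block_matching_bij:
  assumes ns: "\<And>j. j < length ns \<Longrightarrow> 0 < ns ! j" and \<pi>: "\<And>j. j < length ns \<Longrightarrow> \<pi> j < length ns"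
    and p: "p permutes {..<sum_list ns}" "\<And>l. l < sum_list ns \<Longrightarrow> blk ns (p l) = \<pi> (blk ns l)"
  shows "bij_betw \<pi> {..<length ns} {..<length ns}"
proof -
  have surj: "{..<length ns} \<subseteq> \<pi> ` {..<length ns}"
  proof
    fix k assume "k \<in> {..<length ns}"
    then have k: "k < length ns" "0 < ns ! k" using ns by auto
    let ?i = "offset ns k + 0"
    have "?i < sum_list ns" using offset_add_less[OF k] .
    then obtain l where l: "l < sum_list ns" "?i = p l" using permutes_image[OF p(1)] by (metis imageE lessThan_iff)
    have "k = \<pi> (blk ns l)" using blk_offset[OF k] p(2)[OF l(1)] l(2) by simp
    then show "k \<in> \<pi> ` {..<length ns}" using blk_less[OF l(1)] by blast
  qed
  have "inj_on \<pi> {..<length ns}" by (rule finite_surj_inj[OF _ surj]) simp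
  then show ?thesis using surj \<pi> by (auto simp: bij_betw_def)
qed

theorem theorem3p3:
  fixes n m :: nat and ns :: "nat list"
    and A \<Delta>A :: "nat \<Rightarrow> real mat" and W W' :: "real mat" and \<gamma> :: "nat \<Rightarrow> real"
  defines "t \<equiv> length ns"
  defines "A' \<equiv> (\<lambda>i. A i + \<Delta>A i)"
  defines "\<Gamma> \<equiv> diag_block_mat (map (\<lambda>j. \<gamma> j \<cdot>\<^sub>m 1\<^sub>m (ns ! j)) [0..<t])"
  defines "\<delta>\<^sub>A \<equiv> sqrt (\<Sum>i<m. (frobenius_norm (\<Delta>A i))\<^sup>2)"
  defines "R \<equiv> (\<lambda>i. W'\<^sup>T * A' i * W' * \<Gamma> - \<Gamma> * (W'\<^sup>T * A' i * W'))"
  defines "r \<equiv> sqrt (\<Sum>i<m. (frobenius_norm (R i))\<^sup>2)"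
  defines "g \<equiv> Min {\<bar>\<gamma> j - \<gamma> k\<bar> | j k. j < t \<and> k < t \<and> j \<noteq> k}"
  defines "Q \<equiv> mat_inv W * W'"
  defines "\<kappa> \<equiv> cond2 Q"
  defines "\<omega>\<^sub>u\<^sub>q \<equiv> omega_uq ns m A W"
  defines "\<omega>\<^sub>n\<^sub>d \<equiv> omega_nd ns m A W"
  defines "\<tau> \<equiv> (sqrt 2 - 1) / sqrt (real t - 1)"
  defines "\<alpha> \<equiv> 2 * \<tau> / (sqrt 2 + \<tau>)\<^sup>2"
  defines "\<delta> \<equiv> (spectral_norm (mat_inv Q))\<^sup>2 * r
                + 2 * spectral_norm (mat_inv Q) * spectral_norm W * spectral_norm W' * \<delta>\<^sub>A"
  defines "\<epsilon>\<^sub>s \<equiv> (\<lambda>d. \<tau> * \<kappa> * d / (\<alpha> * g * \<omega>\<^sub>u\<^sub>q))"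
  defines "\<epsilon>\<^sub>u\<^sub>b \<equiv> (\<lambda>d. (1 + sqrt (real t) * \<epsilon>\<^sub>s d)
                / sqrt (1 - 2 * sqrt (real t - 1) * \<epsilon>\<^sub>s d - (real t - 1) * (\<epsilon>\<^sub>s d)\<^sup>2) - 1)"
  assumes "partition_of n ns" and "2 \<le> t"
    and "\<And>i. i < m \<Longrightarrow> A i \<in> carrier_mat n n"
    and "\<And>i. i < m \<Longrightarrow> \<Delta>A i \<in> carrier_mat n n"
    and "W \<in> block_normalized ns" and "block_diagonalizer ns m A W"
    and "\<And>j. j < t \<Longrightarrow> N_dim (ns ! j) m (diag_part ns A W j) = 1"
    and "W' \<in> block_normalized ns"
    and "inj_on \<gamma> {..<t}" and "\<And>j. j < t \<Longrightarrow> \<bar>\<gamma> j\<bar> \<le> 1"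
    and "ereal \<delta> < min (ereal (\<alpha> * g * \<omega>\<^sub>u\<^sub>q / \<kappa>))
                        (ereal ((1 - 2 * \<alpha>) * g) * \<omega>\<^sub>n\<^sub>d / ereal (sqrt 2))"
  shows "(\<forall>nrm \<in> {spectral_norm, frobenius_norm}. \<exists>D P.
            is_arg_min (\<lambda>(D, P). nrm (W - W' * D * P) / nrm W')
              (\<lambda>(D, P). D \<in> block_diagonal ns \<and> D\<^sup>T * D = 1\<^sub>m n \<and> P \<in> block_permutations ns)
              (D, P)
            \<and> nrm (W - W' * D * P) / nrm W' \<le> \<epsilon>\<^sub>u\<^sub>b \<delta>)
       \<and> (\<lambda>d. \<epsilon>\<^sub>u\<^sub>b d - \<tau> / \<alpha> * ((sqrt (real t) + sqrt (real t - 1)) * \<kappa> * d / (g * \<omega>\<^sub>u\<^sub>q)))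
            \<in> O[at_right 0](\<lambda>d. d\<^sup>2)"
proof -
  let ?P\<^sub>f = "\<lambda>(D, P). D \<in> block_diagonal ns \<and> D\<^sup>T * D = 1\<^sub>m n \<and> P \<in> block_permutations ns"
  have n: "sum_list ns = n" and ns_pos: "\<And>j. j < t \<Longrightarrow> 0 < ns ! j"
    using assms(17) by (auto simp: partition_of_def t_def)
  have t2: "2 \<le> t" by fact
  note mc = mult_carrier_mat[of _ n n _ n]
  have Wc: "W \<in> carrier_mat n n" "invertible_mat W" and W'c: "W' \<in> carrier_mat n n" "invertible_mat W'"
    using assms(21,24) by (auto simp: block_normalized_def n)
  note Wi = mat_inv[OF Wc] and W'i = mat_inv[OF W'c]
  have Qc: "Q \<in> carrier_mat n n" unfolding Q_def using Wi(3) W'c(1) by (rule mc)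
  have WQ: "W' = W * Q"
    unfolding Q_def using assoc_mult_mat[OF Wc(1) Wi(3) W'c(1)] W'c(1) by (simp add: Wi)
  have "invertible_mat Q" unfolding Q_def by (rule invertible_mat_inv_mult[OF Wc W'c])
  note Vi = mat_inv[OF Qc this]
  define V where "V = mat_inv Q"
  have Vc: "V \<in> carrier_mat n n" and QV: "Q * V = 1\<^sub>m n" and VQ: "V * Q = 1\<^sub>m n"
    using Vi by (simp_all add: V_def)
  have WV: "W = W' * V"
    unfolding WQ using assoc_mult_mat[OF Wc(1) Qc Vc] Wc(1) by (simp add: QV)
  have \<Gamma>: "\<Gamma> = mat n n (\<lambda>(i, l). if i = l then \<gamma> (blk ns i) else 0)"
    unfolding \<Gamma>_def t_def diag_block_scalars n ..
  have \<Gamma>c: "\<Gamma> \<in> carrier_mat n n" by (simp add: \<Gamma>)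
  have \<Gamma>T: "\<Gamma>\<^sup>T = \<Gamma>" unfolding \<Gamma> by (intro eq_matI) auto
  have lab: "blk ns i < t" if "i < n" for i using blk_less[of i ns] that by (simp add: n t_def)
  have \<Gamma>_norm: "spectral_norm \<Gamma> \<le> 1"
    unfolding \<Gamma> by (rule spectral_norm_diagonal_le_1) (use assms(26) lab in simp)
  define Z where "Z = Q * \<Gamma> * V"
  have Zc: "Z \<in> carrier_mat n n" unfolding Z_def using Qc \<Gamma>c Vc by (intro mc)
  define D where "D i = W\<^sup>T * A i * W" for i
  have D: "D i \<in> block_diagonal ns" if "i < m" for i
    using assms(22) that by (simp add: block_diagonalizer_def D_def)
  have dp: "diag_part ns A W j = (\<lambda>i. block ns (D i) j j)" for j by (simp add: diag_part_def D_def fun_eq_iff)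
  define E where "E i = D i * Z - Z\<^sup>T * D i" for i

  have \<delta>0: "0 \<le> \<delta>" unfolding \<delta>_def r_def \<delta>\<^sub>A_def by (intro add_nonneg_nonneg mult_nonneg_nonneg) (auto simp: sum_nonneg)
  have sumE: "(\<Sum>i<m. (frobenius_norm (E i))\<^sup>2) \<le> \<delta>\<^sup>2"
  proof -
    define a where "a = (spectral_norm V)\<^sup>2"
    define c where "c = 2 * spectral_norm V * spectral_norm W * spectral_norm W'"
    have ac: "0 \<le> a" "0 \<le> c" by (auto simp: a_def c_def)
    have "L2_set (\<lambda>i. frobenius_norm (E i)) {..<m} \<le>
        L2_set (\<lambda>i. a * frobenius_norm (R i) + c * frobenius_norm (\<Delta>A i)) {..<m}"
    proof (rule L2_set_mono)
      fix i assume "i \<in> {..<m}"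
      then have i: "i < m" by simp
      show "frobenius_norm (E i) \<le> a * frobenius_norm (R i) + c * frobenius_norm (\<Delta>A i)"
        unfolding E_def D_def Z_def R_def A'_def a_def c_def
        by (rule residual_norm_le[OF Wc(1) W'c(1) Qc Vc \<Gamma>c assms(19)[OF i] assms(20)[OF i] \<Gamma>T \<Gamma>_norm WQ WV])
    qed simp
    also have "\<dots> \<le> L2_set (\<lambda>i. a * frobenius_norm (R i)) {..<m} + L2_set (\<lambda>i. c * frobenius_norm (\<Delta>A i)) {..<m}"
      by (rule L2_set_triangle_ineq)
    also have "\<dots> = a * r + c * \<delta>\<^sub>A"
      using ac by (simp add: L2_set_right_distrib[symmetric] r_def \<delta>\<^sub>A_def L2_set_def[symmetric])
    also have "\<dots> = \<delta>" by (simp add: \<delta>_def a_def c_def V_def)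
    finally have "(L2_set (\<lambda>i. frobenius_norm (E i)) {..<m})\<^sup>2 \<le> \<delta>\<^sup>2" by (rule power_mono) simp
    then show ?thesis by (simp add: L2_set_def sum_nonneg)
  qed

  have \<kappa>: "\<kappa> = spectral_norm Q * spectral_norm V" by (simp add: \<kappa>_def cond2_def V_def)
  have st: "1 \<le> sqrt (real t - 1)" using t2 by simp
  have "sqrt (real t - 1) * \<tau> = sqrt 2 - 1" unfolding \<tau>_def using st by simp
  note \<tau>_eq = this
  have \<tau>: "0 < \<tau>" "\<tau> \<le> sqrt 2 - 1"
    unfolding \<tau>_def using st by (auto simp: divide_le_eq mult_le_cancel_left1 intro!: divide_pos_pos)
  note const = tau_alpha_bounds[OF \<tau> \<alpha>_def[THEN meta_eq_to_obj_eq]]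
  define Gs where "Gs = {\<bar>\<gamma> j - \<gamma> k\<bar> | j k. j < t \<and> k < t \<and> j \<noteq> k}"
  have "Gs \<subseteq> (\<lambda>(j, k). \<bar>\<gamma> j - \<gamma> k\<bar>) ` ({..<t} \<times> {..<t})" by (auto simp: Gs_def)
  then have Gs_fin: "finite Gs" by (rule finite_subset) simp
  have "\<bar>\<gamma> 0 - \<gamma> 1\<bar> \<in> Gs" unfolding Gs_def using t2 by fastforce
  then have Gs_ne: "Gs \<noteq> {}" by blast
  have g_Min: "g = Min Gs" by (simp add: g_def Gs_def)
  have g_le: "g \<le> \<bar>\<gamma> k - \<gamma> l\<bar>" if "k < t" "l < t" "k \<noteq> l" for k l
    unfolding g_Min by (rule Min_le[OF Gs_fin]) (use that in \<open>auto simp: Gs_def\<close>)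
  have g: "0 < g"
    unfolding g_Min using Gs_fin Gs_ne assms(25) by (auto simp: Gs_def dest: inj_onD)
  have h1: "\<delta> < \<alpha> * g * \<omega>\<^sub>u\<^sub>q / \<kappa>"
    and h2: "ereal \<delta> < ereal ((1 - 2 * \<alpha>) * g) * \<omega>\<^sub>n\<^sub>d / ereal (sqrt 2)"
    using assms(27) by auto
  have \<kappa>0: "0 \<le> \<kappa>" by (simp add: \<kappa>)
  \<comment> \<open>Division by zero gives 0, so a zero condition number would contradict the bound on \<open>\<delta>\<close>, as would
    a nonpositive modulus of uniqueness.\<close>
  have \<kappa>_pos: "0 < \<kappa>" using h1 \<delta>0 \<kappa>0 by (cases "\<kappa> = 0") auto
  have \<alpha>g: "0 < \<alpha> * g" using const(1) g by simp
  have \<omega>_pos: "0 < \<omega>\<^sub>u\<^sub>q"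
  proof (rule ccontr)
    assume "\<not> 0 < \<omega>\<^sub>u\<^sub>q"
    then have "\<alpha> * g * \<omega>\<^sub>u\<^sub>q / \<kappa> \<le> 0" using \<alpha>g \<kappa>_pos by (simp add: divide_le_0_iff mult_le_0_iff)
    then show False using h1 \<delta>0 by simp
  qed
  have \<kappa>\<delta>: "\<kappa> * \<delta> < \<alpha> * g * \<omega>\<^sub>u\<^sub>q" using h1 \<kappa>_pos by (simp add: pos_less_divide_eq mult.commute)
  have \<omega>_le: "\<omega>\<^sub>u\<^sub>q \<le> sigma_min (G_off m (ns ! j) (ns ! k) (\<lambda>i. block ns (D i) j j) (\<lambda>i. block ns (D i) k k))"
    if "j < k" "k < length ns" for j k
    using omega_uq_le[OF that, of m A W] by (simp add: \<omega>\<^sub>u\<^sub>q_def dp)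

  define F where "F = Z - Bdiag ns Z"
  have Bc: "Bdiag ns Z \<in> carrier_mat n n" by (simp add: Bdiag_blk n)
  have Fc: "F \<in> carrier_mat n n" unfolding F_def by (rule minus_carrier_mat[OF Bc])
  have "\<omega>\<^sub>u\<^sub>q\<^sup>2 * (frobenius_norm F)\<^sup>2 \<le> (\<Sum>i<m. (frobenius_norm (E i))\<^sup>2)"
    unfolding F_def E_def
    by (rule off_block_bound[OF _ D _ _ \<omega>_le]) (use ns_pos Zc \<omega>_pos in \<open>auto simp: n t_def\<close>)
  with sumE have "(\<omega>\<^sub>u\<^sub>q * frobenius_norm F)\<^sup>2 \<le> \<delta>\<^sup>2" by (simp add: power_mult_distrib)
  then have \<omega>F: "\<omega>\<^sub>u\<^sub>q * frobenius_norm F \<le> \<delta>" by (rule power2_le_imp_le[OF _ \<delta>0])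
  define N where "N = Bdiag ns Z - scalar_part ns Z"
  have N: "sqrt 2 * frobenius_norm N < (1 - 2 * \<alpha>) * g"
  proof -
    have pos: "0 < (1 - 2 * \<alpha>) * g" using const(5) g by simp
    have bound: "\<omega> * frobenius_norm N \<le> \<delta>" if \<omega>: "0 \<le> \<omega>" "\<And>j. j < length ns \<Longrightarrow> 1 < ns ! j \<Longrightarrow>
        \<omega> \<le> sigma_min_nonzero (G_diag m (ns ! j) (diag_part ns A W j))" for \<omega>
    proof -
      have "\<omega>\<^sup>2 * (frobenius_norm N)\<^sup>2 \<le> (\<Sum>i<m. (frobenius_norm (E i))\<^sup>2)"
        unfolding N_def E_def
        by (rule scalar_block_bound[OF _ D _ _ \<omega>[unfolded dp]])
           (use ns_pos Zc assms(23) in \<open>auto simp: n t_def dp\<close>)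
      with sumE have "(\<omega> * frobenius_norm N)\<^sup>2 \<le> \<delta>\<^sup>2" by (simp add: power_mult_distrib)
      then show ?thesis by (rule power2_le_imp_le[OF _ \<delta>0])
    qed
    show ?thesis
      by (rule omega_nd_bound[OF bound _ \<delta>0 pos h2[unfolded \<omega>\<^sub>n\<^sub>d_def]]) simp_all
  qed

  interpret P1: block_perturbation n t "blk ns" \<gamma> V Q "Bdiag ns Z" F
  proof
    show "Bdiag ns Z $$ (i, l) = 0" if "i < n" "l < n" "blk ns i \<noteq> blk ns l" for i l
      using that by (simp add: Bdiag_blk n)
    have "V * Z = V * Q * (\<Gamma> * V)"
      unfolding Z_def using Vc Qc \<Gamma>c by (simp add: assoc_mult_mat[of _ n n _ n _ n] mc)
    then have VZ: "V * Z = \<Gamma> * V" by (simp add: VQ left_mult_one_mat[OF mc[OF \<Gamma>c Vc]])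
    have "Z = Bdiag ns Z + F" unfolding F_def using Zc Bc by (intro eq_matI) auto
    then have split: "V * Z = V * Bdiag ns Z + V * F" using mult_add_distrib_mat[OF Vc Bc Fc] by simp
    show "\<gamma> (blk ns i) * V $$ (i, l) = (V * Bdiag ns Z) $$ (i, l) + (V * F) $$ (i, l)" if il: "i < n" "l < n" for i l
    proof -
      have "(\<Gamma> * V) $$ (i, l) = (\<Sum>j<n. if j = i then \<gamma> (blk ns i) * V $$ (j, l) else 0)"
        unfolding mult_mat_index[OF \<Gamma>c Vc il] using il by (intro sum.cong) (auto simp: \<Gamma>)
      then have "(\<Gamma> * V) $$ (i, l) = \<gamma> (blk ns i) * V $$ (i, l)" using il by simp
      moreover have "(V * Bdiag ns Z + V * F) $$ (i, l) = (V * Bdiag ns Z) $$ (i, l) + (V * F) $$ (i, l)"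
        using il mc[OF Vc Bc] mc[OF Vc Fc] by (intro index_add_mat) auto
      ultimately show ?thesis unfolding VZ[symmetric] split by simp
    qed
  qed (use Vc Qc Bc Fc QV lab in auto)
  have K\<omega>: "P1.K * \<omega>\<^sub>u\<^sub>q \<le> \<kappa> * \<delta>"
    using mult_left_mono[OF \<omega>F \<kappa>0] by (simp add: P1.K_def \<kappa> mult_ac)
  then have "P1.K * \<omega>\<^sub>u\<^sub>q < (\<alpha> * g) * \<omega>\<^sub>u\<^sub>q" using \<kappa>\<delta> by simp
  then have K: "P1.K < \<alpha> * g" using \<omega>_pos by simp
  have "\<exists>k<t. \<bar>block_mean ns Z j - \<gamma> k\<bar> \<le> \<alpha> * g" if j: "j < t" for j
  proof (rule mean_eigenvalue_near[where B = "block ns Z j j" and q = "ns ! j" and g = g])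
    have j': "j < length ns" using j by (simp add: t_def)
    fix \<sigma> \<omega> a c assume a: "a \<in> carrier_vec (ns ! j)" and c: "c \<in> carrier_vec (ns ! j)"
      and nz: "a \<noteq> 0\<^sub>v (ns ! j) \<or> c \<noteq> 0\<^sub>v (ns ! j)"
      and ea: "block ns Z j j *\<^sub>v a = \<sigma> \<cdot>\<^sub>v a - \<omega> \<cdot>\<^sub>v c" and ec: "block ns Z j j *\<^sub>v c = \<omega> \<cdot>\<^sub>v a + \<sigma> \<cdot>\<^sub>v c"
    have "\<exists>k<t. (\<gamma> k - \<sigma>)\<^sup>2 + \<omega>\<^sup>2 \<le> P1.K\<^sup>2"
    proof (rule P1.eigenvalue_near_label[of "pad_block ns j a" "pad_block ns j c"])
      show "pad_block ns j a \<noteq> 0\<^sub>v n \<or> pad_block ns j c \<noteq> 0\<^sub>v n"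
        using nz pad_block_nonzero[OF j' a] pad_block_nonzero[OF j' c] by (auto simp: n)
      show "Bdiag ns Z *\<^sub>v pad_block ns j a = \<sigma> \<cdot>\<^sub>v pad_block ns j a - \<omega> \<cdot>\<^sub>v pad_block ns j c"
        unfolding Bdiag_mult_pad_block[OF j' a] ea by (rule pad_block_lincomb(1)[OF j' a c])
      show "Bdiag ns Z *\<^sub>v pad_block ns j c = \<omega> \<cdot>\<^sub>v pad_block ns j a + \<sigma> \<cdot>\<^sub>v pad_block ns j c"
        unfolding Bdiag_mult_pad_block[OF j' c] ec by (rule pad_block_lincomb(2)[OF j' a c])
    qed (auto simp: pad_block_def n)
    moreover have "P1.K\<^sup>2 \<le> (\<alpha> * g)\<^sup>2" by (rule power_mono) (use K P1.K_nonneg in auto)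
    ultimately show "\<exists>k<t. (\<gamma> k - \<sigma>)\<^sup>2 + \<omega>\<^sup>2 \<le> (\<alpha> * g)\<^sup>2" by (meson order_trans)
  next
    have j': "j < length ns" using j by (simp add: t_def)
    let ?T = "\<lambda>j. (frobenius_norm (block ns Z j j - block_mean ns Z j \<cdot>\<^sub>m 1\<^sub>m (ns ! j)))\<^sup>2"
    have "?T j \<le> (\<Sum>j<length ns. ?T j)"
      by (rule member_le_sum) (use j' in auto)
    also have "\<dots> = (frobenius_norm N)\<^sup>2" unfolding N_def by (rule frobenius_norm_sq_scalar_part[symmetric])
    finally have "frobenius_norm (block ns Z j j - block_mean ns Z j \<cdot>\<^sub>m 1\<^sub>m (ns ! j)) \<le> frobenius_norm N"
      by (rule power2_le_imp_le) simp
    then have "sqrt 2 * frobenius_norm (block ns Z j j - block_mean ns Z j \<cdot>\<^sub>m 1\<^sub>m (ns ! j)) \<le> sqrt 2 * frobenius_norm N"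
      by (rule mult_left_mono) simp
    then show "sqrt 2 * frobenius_norm (block ns Z j j - block_mean ns Z j \<cdot>\<^sub>m 1\<^sub>m (ns ! j)) + 2 * (\<alpha> * g) < g"
    proof -
      have "(1 - 2 * \<alpha>) * g = g - 2 * (\<alpha> * g)" by (simp add: left_diff_distrib)
      with N have "sqrt 2 * frobenius_norm N < g - 2 * (\<alpha> * g)" by (simp only:)
      then show ?thesis using \<open>sqrt 2 * frobenius_norm (block ns Z j j - block_mean ns Z j \<cdot>\<^sub>m 1\<^sub>m (ns ! j)) \<le> sqrt 2 * frobenius_norm N\<close>
        by linarith
    qed
  qed (use ns_pos[OF j] g_le \<alpha>g in \<open>auto simp: block_mean_def\<close>)
  then obtain \<pi> where \<pi>: "\<And>j. j < t \<Longrightarrow> \<pi> j < t" "\<And>j. j < t \<Longrightarrow> \<bar>block_mean ns Z j - \<gamma> (\<pi> j)\<bar> \<le> \<alpha> * g"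
    by metis
  interpret P2: matched_block_perturbation n t "blk ns" \<gamma> V Q "Bdiag ns Z" F \<pi>
    by unfold_locales (rule \<pi>(1))
  define s where "s = frobenius_norm P2.Y * spectral_norm Q"
  \<comment> \<open>The crude bound on the unmatched part that starts the bootstrap.\<close>
  have s: "sqrt 2 * s < 1"
  proof -
    define d where "d = (1 - \<alpha>) * g"
    have gap: "d \<le> \<bar>\<gamma> k - block_mean ns Z j\<bar>" if "k < t" "j < t" "k \<noteq> \<pi> j" for k j
      using g_le[OF that(1) \<pi>(1)[OF that(2)] that(3)] \<pi>(2)[OF that(2)] by (simp add: d_def left_diff_distrib)
    have d0: "0 \<le> d" using const(5) g by (simp add: d_def)
    have sp: "Bdiag ns Z - mat n n (\<lambda>(i, l). if i = l then block_mean ns Z (blk ns l) else 0) = N"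
      by (simp add: N_def scalar_part_def n)
    have "(d - frobenius_norm N) * frobenius_norm P2.Y \<le> spectral_norm V * frobenius_norm F"
      by (rule P2.frobenius_norm_Y_le[where \<mu> = "block_mean ns Z"]) (use d0 gap in \<open>auto simp: sp\<close>)
    then have "(d - frobenius_norm N) * frobenius_norm P2.Y * spectral_norm Q \<le> spectral_norm V * frobenius_norm F * spectral_norm Q"
      by (rule mult_right_mono) simp
    then have "(d - frobenius_norm N) * s \<le> P1.K" by (simp add: s_def P1.K_def mult_ac)
    moreover have "sqrt 2 * (\<alpha> * g) \<le> d - frobenius_norm N"
      unfolding d_def by (rule gap_arithmetic[OF const(3) less_imp_le[OF g] N])
    then have "sqrt 2 * (\<alpha> * g) * s \<le> (d - frobenius_norm N) * s" by (rule mult_right_mono) (simp add: s_def)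
    ultimately have "(\<alpha> * g) * (sqrt 2 * s) < (\<alpha> * g) * 1" using K by (simp add: mult_ac)
    then show ?thesis using \<alpha>g by (simp only: mult_less_cancel_left_pos)
  qed
  have s0: "0 \<le> s" by (simp add: s_def)
  have s2: "2 * s\<^sup>2 \<le> 1"
  proof -
    have "(sqrt 2 * s)\<^sup>2 \<le> 1\<^sup>2" by (rule power_mono) (use s s0 in auto)
    then show ?thesis by (simp add: power_mult_distrib)
  qed
  have s1: "s < 1"
  proof -
    have "1 * s \<le> sqrt 2 * s" by (rule mult_right_mono) (use s0 in auto)
    then show ?thesis using s by simp
  qed
  obtain p where p: "p permutes {..<n}" "\<And>l. l < n \<Longrightarrow> blk ns (p l) = \<pi> (blk ns l)"
    using P2.matched_permutation s1 unfolding s_def by blast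
  have bij: "bij_betw \<pi> {..<t} {..<t}"
    unfolding t_def
    by (rule block_matching_bij) (use ns_pos \<pi>(1) p in \<open>auto simp: n t_def\<close>)
  then have inj: "inj_on \<pi> {..<t}" by (rule bij_betw_imp_inj_on)

  define \<epsilon> where "\<epsilon> = \<epsilon>\<^sub>s \<delta>"
  have \<epsilon>_eq: "\<epsilon> = \<tau> * (\<kappa> * \<delta> / (\<alpha> * g * \<omega>\<^sub>u\<^sub>q))" by (simp add: \<epsilon>_def \<epsilon>\<^sub>s_def)
  have agw: "0 < \<alpha> * g * \<omega>\<^sub>u\<^sub>q" using \<alpha>g \<omega>_pos by simp
  have \<epsilon>0: "0 \<le> \<epsilon>" unfolding \<epsilon>_eq using \<tau> \<kappa>0 \<delta>0 agw by simp
  have "\<kappa> * \<delta> / (\<alpha> * g * \<omega>\<^sub>u\<^sub>q) < 1" using \<kappa>\<delta> agw by simp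
  then have "\<epsilon> < \<tau>" unfolding \<epsilon>_eq using \<tau> by (simp only: mult_less_cancel_left2) simp
  then have "sqrt (real t - 1) * \<epsilon> < sqrt (real t - 1) * \<tau>" using st by simp
  then have \<epsilon>_small: "sqrt (real t - 1) * \<epsilon> < sqrt 2 - 1" unfolding \<tau>_eq .
  have YX: "euclid_norm (P2.Y *\<^sub>v y) \<le> \<epsilon> * euclid_norm (P2.X *\<^sub>v y)" if j: "j < t" and y: "y \<in> P2.supp j" for j y
  proof -
    have Kt: "P1.K * (1 + \<tau>\<^sup>2) \<le> g * \<tau>"
    proof -
      have "P1.K * (1 + \<tau>\<^sup>2) \<le> \<alpha> * g * (1 + \<tau>\<^sup>2)" by (rule mult_right_mono) (use K in auto)
      also have "\<dots> = g * (\<alpha> * (1 + \<tau>\<^sup>2))" by (simp add: mult_ac)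
      also have "\<dots> \<le> g * \<tau>" by (rule mult_left_mono[OF const(2)]) (use g in simp)
      finally show ?thesis .
    qed
    have "euclid_norm (P2.Y *\<^sub>v y) \<le> (P1.K / g * (1 + \<tau>\<^sup>2)) * euclid_norm (P2.X *\<^sub>v y)"
      by (rule P2.norm_Y_le_X[OF g_le g s2[unfolded s_def] _ const(4) Kt j y]) (use \<tau> in auto)
    also have "\<dots> \<le> \<epsilon> * euclid_norm (P2.X *\<^sub>v y)"
    proof (rule mult_right_mono)
      have "P1.K \<le> \<kappa> * \<delta> / \<omega>\<^sub>u\<^sub>q" using K\<omega> \<omega>_pos by (simp add: pos_le_divide_eq)
      moreover have "1 + \<tau>\<^sup>2 \<le> \<tau> / \<alpha>" using const(1,2) by (simp add: pos_le_divide_eq mult.commute)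
      ultimately have "P1.K * (1 + \<tau>\<^sup>2) \<le> (\<kappa> * \<delta> / \<omega>\<^sub>u\<^sub>q) * (\<tau> / \<alpha>)"
        using P1.K_nonneg \<kappa>0 \<delta>0 \<omega>_pos by (intro mult_mono) auto
      then have "P1.K * (1 + \<tau>\<^sup>2) / g \<le> (\<kappa> * \<delta> / \<omega>\<^sub>u\<^sub>q) * (\<tau> / \<alpha>) / g" by (rule divide_right_mono) (use g in simp)
      then show "P1.K / g * (1 + \<tau>\<^sup>2) \<le> \<epsilon>" by (simp add: \<epsilon>_eq mult_ac)
    qed simp
    finally show ?thesis .
  qed
  obtain U where U: "U \<in> block_orthogonal ns" and
    UV: "spectral_norm (V - U * perm_mat n p) \<le>
      (1 + sqrt t * \<epsilon>) / sqrt (1 - 2 * sqrt (real t - 1) * \<epsilon> - (real t - 1) * \<epsilon>\<^sup>2) - 1"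
    by (rule P2.block_orthogonal_approximation[OF n[symmetric] t_def[THEN meta_eq_to_obj_eq] _ refl bij p \<epsilon>0 \<epsilon>_small YX assms(21,24) WV])
       (use t2 in auto)
  note u = block_orthogonalD[OF U, unfolded n]
  have Pbp: "perm_mat n p \<in> block_permutations ns"
    unfolding n[symmetric] by (rule perm_mat_block_permutation[where \<pi> = \<pi>]) (use p inj in \<open>auto simp: n t_def\<close>)
  have UV': "spectral_norm (V - U * perm_mat n p) \<le> \<epsilon>\<^sub>u\<^sub>b \<delta>" using UV by (simp add: \<epsilon>\<^sub>u\<^sub>b_def \<epsilon>_def)
  have diff: "W - W' * U * perm_mat n p = W' * (V - U * perm_mat n p)"
  proof -
    have UP: "U * perm_mat n p \<in> carrier_mat n n" using u(2) perm_mat_carrier by (rule mc)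
    have "W' * (V - U * perm_mat n p) = W' * V - W' * (U * perm_mat n p)"
      by (rule mult_minus_distrib_mat[OF W'c(1) Vc UP])
    then show ?thesis unfolding WV[symmetric] assoc_mult_mat[OF W'c(1) u(2) perm_mat_carrier] ..
  qed
  have c: "V - U * perm_mat n p \<in> carrier_mat n n"
    by (rule minus_carrier_mat, rule mc[OF u(2) perm_mat_carrier])
  have W'_pos: "0 < spectral_norm W'" "0 < frobenius_norm W'"
  proof -
    have "0 < length ns" using t2 unfolding t_def by linarith
    then have "0 < n" using ns_pos[of 0] offset_add_less[of 0 ns 0] by (simp add: n t_def)
    then show "0 < spectral_norm W'" by (rule spectral_norm_pos[OF W'c])
    then show "0 < frobenius_norm W'" using spectral_norm_le_frobenius[of W'] by simp
  qed
  have first: "\<exists>D P. is_arg_min (\<lambda>(D, P). nrm (W - W' * D * P) / nrm W') ?P\<^sub>f (D, P)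
        \<and> nrm (W - W' * D * P) / nrm W' \<le> \<epsilon>\<^sub>u\<^sub>b \<delta>"
    if nrm: "nrm \<in> {spectral_norm, frobenius_norm}" for nrm
  proof -
    have pos: "0 < nrm W'" using nrm W'_pos by auto
    have sub: "nrm (W' * X) \<le> nrm W' * spectral_norm X" if "X \<in> carrier_mat n n" for X
      using nrm spectral_norm_mult_le[OF W'c(1) that] frobenius_norm_mult_le_right[OF W'c(1) that] by auto
    have "\<exists>D P. is_arg_min (\<lambda>(D, P). nrm (W - W' * D * P) / nrm W')
      (\<lambda>(D, P). D \<in> block_diagonal ns \<and> D\<^sup>T * D = 1\<^sub>m (sum_list ns) \<and> P \<in> block_permutations ns) (D, P)"
      by (rule block_distance_minimum)
         (use nrm pos Wc W'c spectral_norm_le_frobenius in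
          \<open>auto simp: n intro: spectral_norm_triangle frobenius_norm_triangle\<close>)
    then obtain D0 P0 where m: "is_arg_min (\<lambda>(D, P). nrm (W - W' * D * P) / nrm W') ?P\<^sub>f (D0, P0)"
      unfolding n by blast
    have "nrm (W - W' * D0 * P0) / nrm W' \<le> nrm (W - W' * U * perm_mat n p) / nrm W'"
      using m u Pbp by (auto simp: is_arg_min_def not_less)
    also have "\<dots> \<le> nrm W' * spectral_norm (V - U * perm_mat n p) / nrm W'"
      unfolding diff by (rule divide_right_mono[OF sub[OF c]]) (use pos in simp)
    also have "\<dots> \<le> \<epsilon>\<^sub>u\<^sub>b \<delta>" using UV' pos by simp
    finally show ?thesis using m by blast
  qed
  define C where "C = \<tau> * \<kappa> / (\<alpha> * g * \<omega>\<^sub>u\<^sub>q)"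
  have C: "0 \<le> C" unfolding C_def using \<tau> \<kappa>0 agw by simp
  have \<epsilon>C: "\<epsilon>\<^sub>s d = C * d" for d by (simp add: \<epsilon>\<^sub>s_def C_def)
  have sq: "(sqrt (real t - 1))\<^sup>2 = real t - 1" using t2 by simp
  have lin: "\<tau> / \<alpha> * ((sqrt (real t) + sqrt (real t - 1)) * \<kappa> * d / (g * \<omega>\<^sub>u\<^sub>q)) =
      (sqrt (real t) + sqrt (real t - 1)) * (C * d)" for d
    by (simp add: C_def mult_ac)
  have "(\<lambda>d. \<epsilon>\<^sub>u\<^sub>b d - \<tau> / \<alpha> * ((sqrt (real t) + sqrt (real t - 1)) * \<kappa> * d / (g * \<omega>\<^sub>u\<^sub>q)))
      \<in> O[at_right 0](\<lambda>d. d\<^sup>2)"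
    unfolding lin \<epsilon>\<^sub>u\<^sub>b_def \<epsilon>C
    using error_bound_expansion[of "sqrt (real t)" "sqrt (real t - 1)" C] C st unfolding sq by simp
  with first show ?thesis by blast
qed

end
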